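(* Let $(A,\ast,\circ)$ be an anti-pre-Poisson algebra and $r\in A\otimes A$ such that $r+\tau(r)$ is invariant. Then the following conditions are equivalent: (a) $r$ is a solution of the APP-YBE in $(A,\ast,\circ)$, such that $(A,\ast,\circ,\Delta_r,\delta_r)$ is a quasi-triangular anti-pre-Poisson bialgebra with $\Delta_r(x)=-(I\otimes L_\star(x)+L_\ast(x)\otimes I)r$ and $\delta_r(x)=(L_\circ(x)\otimes I-I\otimes\mathrm{ad}(x))r$. (b) $T_r$ is a relative Rota-Baxter operator of weight $-1$ on $(A,\ast,\circ)$ with respect to the $A$-anti-pre-Poisson algebra $(A^*,\ast_{r+\tau(r)},\circ_{r+\tau(r)},L_\star^*,-R_\ast^*,-\mathrm{ad}^*,R_\circ^* )$, that is, for all $\zeta,\eta\in A^*$, $$T_r(\zeta)\ast T_r(\eta)=T_r\big(L_\star^*(T_r(\zeta))\eta-R_\ast^*(T_r(\eta))\zeta-\zeta\ast_{r+\tau(r)}\eta\big),$$ $$T_r(\zeta)\circ T_r(\eta)=T_r\big(-\mathrm{ad}^*(T_r(\zeta))\eta+R_\circ^*(T_r(\eta))\zeta-\zeta\circ_{r+\tau(r)}\eta\big).$$ (c) $T_r$ is a relative Rota-Baxter operator of weight $-1$ on the Poisson algebra $(A,\star,[\ ,\ ])$ with respect to the $A$-Poisson algebra $(A^*,\star_{r+\tau(r)},[\ ,\ ]_{r+\tau(r)},L_\ast^*,-L_\circ^* )$, that is, for all $\zeta,\eta\in A^*$, $$T_r(\zeta)\star T_r(\eta)=T_r\big(L_\ast^*(T_r(\zeta))\eta+L_\ast^*(T_r(\eta))\zeta-\zeta\star_{r+\tau(r)}\eta\big),$$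 $$[T_r(\zeta),T_r(\eta)]=T_r\big(-L_\circ^*(T_r(\zeta))\eta+L_\circ^*(T_r(\eta))\zeta-[\zeta,\eta]_{r+\tau(r)}\big).$$
   Context: Throughout, $k$ is a field and all vector spaces and algebras are finite-dimensional over $k$. Algebras. An anti-Zinbiel algebra $(A,\ast)$ is a vector space with a bilinear operation such that $x\ast(y\ast z)=-(x\ast y+y\ast x)\ast z=-(y\ast z+z\ast y)\ast x=z\ast(y\ast x)$ and $z\ast(x\ast y)=x\ast(z\ast y)$ for all $x,y,z$. An anti-pre-Lie algebra $(A,\circ)$ is a vector space with a bilinear operation such that, with $[x,y]=x\circ y-y\circ x$, $x\circ(y\circ z)-y\circ(x\circ z)=[y,x]\circ z$ and $[x,y]\circ z+[y,z]\circ x+[z,x]\circ y=0$. An anti-pre-Poisson algebra $(A,\ast,\circ)$ consists of an anti-Zinbiel algebra $(A,\ast)$ and an anti-pre-Lie algebra $(A,\circ)$ with $(x\circ y-y\circ x)\ast z=y\ast(x\circ z)-x\circ(y\ast z)$, $(x\ast y+y\ast x)\circ z=-x\ast(y\circ z)-y\ast(x\circ z)$, and $z\circ(x\ast y+y\ast x)+x\ast(y\circ z)+y\ast(x\circ z)=x\ast(z\circ y)+y\ast(z\circ x)$. Put $x\star y=x\ast y+y\ast x$; $(A,\star,[\ ,\ ])$ is a Poisson algebra. Operators. $L_\ast(x)y=x\ast y$, $R_\ast(x)y=y\ast x$ (similarly for other operations), $\mathrm{ad}(x)=L_\circ(x)-R_\circ(x)$, $L_\star=L_\ast+R_\ast$.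 For $f:A\to\mathrm{End}(V)$, $f^*:A\to\mathrm{End}(V^* )$ is given by $\langle f^*(x)u^*,v\rangle=-\langle u^*,f(x)v\rangle$. $\tau(x\otimes y)=y\otimes x$; $I$ is the identity. For $s\in A\otimes A$, $T_s:A^*\to A$ is given by $\langle T_s(\zeta),\eta\rangle=\langle s,\zeta\otimes\eta\rangle$. Invariance. $s\in A\otimes A$ is invariant if $(I\otimes L_\star(x)+L_\ast(x)\otimes I)s=0$ and $(L_\circ(x)\otimes I-I\otimes\mathrm{ad}(x))s=0$ for all $x\in A$. Operations on $A^*$. For $s\in A\otimes A$ symmetric and invariant: $\zeta\ast_s\eta=L_\star^*(T_s(\zeta))\eta=-R_\ast^*(T_s(\eta))\zeta$, $\zeta\circ_s\eta=-\mathrm{ad}^*(T_s(\zeta))\eta=R_\circ^*(T_s(\eta))\zeta$, $\zeta\star_s\eta=\zeta\ast_s\eta+\eta\ast_s\zeta$, $[\zeta,\eta]_s=\zeta\circ_s\eta-\eta\circ_s\zeta$. (Here $s=r+\tau(r)$.) $A$-anti-pre-Poisson algebra. Let $(V,\ast_V,\circ_V)$ be an anti-pre-Poisson algebra and $l_\ast,r_\ast,l_\circ,r_\circ:A\to\mathrm{End}(V)$ linear. $(V,\ast_V,\circ_V,l_\ast,r_\ast,l_\circ,r_\circ)$ is an $A$-anti-pre-Poisson algebra iff $A\oplus V$ with $(x+a)\ast(y+b)=x\ast y+l_\ast(x)b+r_\ast(y)a+a\ast_Vb$ and $(x+a)\circ(y+b)=x\circ y+l_\circ(x)b+r_\circ(y)a+a\circ_Vb$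 is an anti-pre-Poisson algebra. A relative Rota-Baxter operator of weight $\lambda$ with respect to it is a linear map $T:V\to A$ with $T(u)\ast T(v)=T(l_\ast(T(u))v+r_\ast(T(v))u+\lambda u\ast_Vv)$ and $T(u)\circ T(v)=T(l_\circ(T(u))v+r_\circ(T(v))u+\lambda u\circ_Vv)$. Similarly, for a Poisson algebra $A$, an $A$-Poisson algebra $(V,\star_V,[\ ,\ ]_V,\mu,\rho)$ is a Poisson algebra $V$ with linear maps $\mu,\rho:A\to\mathrm{End}(V)$ such that $A\oplus V$ with $(x+a)\star(y+b)=x\star y+\mu(x)b+\mu(y)a+a\star_Vb$ and $[x+a,y+b]=[x,y]+\rho(x)b-\rho(y)a+[a,b]_V$ is a Poisson algebra; relative Rota-Baxter operators of weight $\lambda$ satisfy $T(u)\star T(v)=T(\mu(T(u))v+\mu(T(v))u+\lambda u\star_Vv)$ and $[T(u),T(v)]=T(\rho(T(u))v-\rho(T(v))u+\lambda[u,v]_V)$. APP-YBE for $r=\sum_ia_i\otimes b_i$: both $D(r)=\sum_{i,j}\big(a_i\otimes b_i\ast a_j\otimes b_j-a_i\ast a_j\otimes b_i\otimes b_j+a_i\otimes a_j\otimes b_i\star b_j\big)=0$ and $S(r)=\sum_{i,j}\big(a_i\circ a_j\otimes b_i\otimes b_j+a_i\otimes b_i\circ a_j\otimes b_j-a_i\otimes a_j\otimes[b_i,b_j]\big)=0$. If $r$ solves the APP-YBE and $r+\tau(r)$ is invariant, the anti-pre-Poisson bialgebra $(A,\ast,\circ,\Delta_r,\delta_r)$ is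 called quasi-triangular. Anti-pre-Poisson bialgebra $(A,\ast,\circ,\Delta,\delta)$: $(A,\ast,\circ)$ is an anti-pre-Poisson algebra; $(A,\Delta,\delta)$ is an anti-pre-Poisson coalgebra, i.e. (equivalently) the operations on $A^*$ dual to $\Delta$ and $\delta$ make $A^*$ an anti-pre-Poisson algebra; and for all $x,y\in A$: (1) $\Delta(x\star y)=(I\otimes L_\star(x))\Delta(y)-(L_\ast(y)\otimes I)\Delta(x)$; (2) $(\Delta+\tau\Delta)(x\ast y)=(L_\ast(x)\otimes I)(\Delta+\tau\Delta)(y)-(I\otimes R_\ast(y))\Delta(x)$; (3) $\delta([x,y])=(I\otimes\mathrm{ad}(x)-L_\circ(x)\otimes I)\delta(y)-(I\otimes\mathrm{ad}(y)-L_\circ(y)\otimes I)\delta(x)$; (4) $(I\otimes I-\tau)\big(\delta(x\circ y)-(L_\circ(x)\otimes I)\delta(y)-(I\otimes L_\circ(x))\delta(y)+(I\otimes R_\circ(y))\delta(x)\big)=0$; (5) $\delta(x\star y)=(I\otimes L_\star(x))\delta(y)+(I\otimes L_\star(y))\delta(x)+(L_\circ(x)\otimes I)\Delta(y)+(L_\circ(y)\otimes I)\Delta(x)$; (6) $\Delta([x,y])=-(L_\circ(x)\otimes I)\Delta(y)-(I\otimes L_\star(y))\delta(x)-(L_\ast(y)\otimes I)\delta(x)+(I\otimes\mathrm{ad}(x))\Delta(y)$; (7) $(\Delta+\tau\Delta)(x\circ y)=(I\otimes I+\tau)\big((L_\circ(x)\otimes I)\Delta(y)+(I\otimes L_\circ(x))\Delta(y)+(I\otimes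 R_\ast(y))\delta(x)\big)$; (8) $\delta(x\ast y)-\tau\delta(x\ast y)=(I\otimes L_\ast(x))\delta(y)-\tau(L_\ast(x)\otimes I)\delta(y)-(L_\circ(x)\otimes I)\Delta(y)-\tau(I\otimes L_\circ(x))\Delta(y)-(I\otimes R_\ast(y))\delta(x)-\tau(I\otimes R_\circ(y))\Delta(x)$. *)

theory Defs
  imports
    Complex_Main
    "HOL-Library.Poly_Mapping"
    "HOL-Library.Function_Algebras"
    "HOL-Library.Product_Plus"
begin

section \<open>Algebras on finite-dimensional carriers\<close>

text \<open>
  All algebras live on a carrier \<open>V\<close> that is a finite-dimensional subspace of an ambient
  vector space. The algebra \<open>A\<close> itself occupies a whole type (\<open>V = UNIV\<close>); carriers are
  needed for the dual space, which is a proper subset of the type of all functions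
  \<open>'a \<Rightarrow> 'k\<close>, and for the direct sum of \<open>A\<close> with it.
\<close>

locale fd_space = vector_space scale
  for scale :: "'k::field \<Rightarrow> 'v::ab_group_add \<Rightarrow> 'v" +
  fixes V :: "'v set"
  assumes finite_dim: "\<exists>B. finite B \<and> span B = V"

locale fd_algebra = fd_space scale V
  for scale :: "'k::field \<Rightarrow> 'v::ab_group_add \<Rightarrow> 'v" and V +
  fixes mult :: "'v \<Rightarrow> 'v \<Rightarrow> 'v"
  assumes mult_closed: "x \<in> V \<Longrightarrow> y \<in> V \<Longrightarrow> mult x y \<in> V"
    and mult_add_left: "x \<in> V \<Longrightarrow> x' \<in> V \<Longrightarrow> y \<in> V \<Longrightarrow> mult (x + x') y = mult x y + mult x' y"
    and mult_add_right: "x \<in> V \<Longrightarrow> y \<in> V \<Longrightarrow> y' \<in> V \<Longrightarrow> mult x (y + y') = mult x y + mult x y'"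
    and mult_scale_left: "x \<in> V \<Longrightarrow> y \<in> V \<Longrightarrow> mult (scale c x) y = scale c (mult x y)"
    and mult_scale_right: "x \<in> V \<Longrightarrow> y \<in> V \<Longrightarrow> mult x (scale c y) = scale c (mult x y)"

definition symmetrized :: "('v \<Rightarrow> 'v \<Rightarrow> 'v) \<Rightarrow> 'v \<Rightarrow> 'v \<Rightarrow> 'v::ab_group_add" where
  "symmetrized m x y = m x y + m y x"

definition commutator :: "('v \<Rightarrow> 'v \<Rightarrow> 'v) \<Rightarrow> 'v \<Rightarrow> 'v \<Rightarrow> 'v::ab_group_add" where
  "commutator m x y = m x y - m y x"

locale anti_zinbiel = fd_algebra scale V ast
  for scale :: "'k::field \<Rightarrow> 'v::ab_group_add \<Rightarrow> 'v" and V
    and ast (infixl \<open>\<ast>\<close> 70) +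
  assumes zinbiel_1: "x \<in> V \<Longrightarrow> y \<in> V \<Longrightarrow> z \<in> V \<Longrightarrow> x \<ast> (y \<ast> z) = - ((x \<ast> y + y \<ast> x) \<ast> z)"
    and zinbiel_2: "x \<in> V \<Longrightarrow> y \<in> V \<Longrightarrow> z \<in> V \<Longrightarrow> x \<ast> (y \<ast> z) = - ((y \<ast> z + z \<ast> y) \<ast> x)"
    and zinbiel_3: "x \<in> V \<Longrightarrow> y \<in> V \<Longrightarrow> z \<in> V \<Longrightarrow> x \<ast> (y \<ast> z) = z \<ast> (y \<ast> x)"
    and zinbiel_4: "x \<in> V \<Longrightarrow> y \<in> V \<Longrightarrow> z \<in> V \<Longrightarrow> z \<ast> (x \<ast> y) = x \<ast> (z \<ast> y)"

locale anti_pre_lie = fd_algebra scale V circ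
  for scale :: "'k::field \<Rightarrow> 'v::ab_group_add \<Rightarrow> 'v" and V
    and circ (infixl \<open>\<odot>\<close> 70) +
  assumes anti_pre_lie_1: "x \<in> V \<Longrightarrow> y \<in> V \<Longrightarrow> z \<in> V \<Longrightarrow>
      x \<odot> (y \<odot> z) - y \<odot> (x \<odot> z) = commutator (\<odot>) y x \<odot> z"
    and anti_pre_lie_2: "x \<in> V \<Longrightarrow> y \<in> V \<Longrightarrow> z \<in> V \<Longrightarrow>
      commutator (\<odot>) x y \<odot> z + commutator (\<odot>) y z \<odot> x + commutator (\<odot>) z x \<odot> y = 0"

locale anti_pre_poisson = anti_zinbiel scale V ast + anti_pre_lie scale V circ
  for scale :: "'k::field \<Rightarrow> 'v::ab_group_add \<Rightarrow> 'v" and V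
    and ast (infixl \<open>\<ast>\<close> 70) and circ (infixl \<open>\<odot>\<close> 70) +
  assumes compat_1: "x \<in> V \<Longrightarrow> y \<in> V \<Longrightarrow> z \<in> V \<Longrightarrow>
      (x \<odot> y - y \<odot> x) \<ast> z = y \<ast> (x \<odot> z) - x \<odot> (y \<ast> z)"
    and compat_2: "x \<in> V \<Longrightarrow> y \<in> V \<Longrightarrow> z \<in> V \<Longrightarrow>
      (x \<ast> y + y \<ast> x) \<odot> z = - (x \<ast> (y \<odot> z)) - y \<ast> (x \<odot> z)"
    and compat_3: "x \<in> V \<Longrightarrow> y \<in> V \<Longrightarrow> z \<in> V \<Longrightarrow>
      z \<odot> (x \<ast> y + y \<ast> x) + x \<ast> (y \<odot> z) + y \<ast> (x \<odot> z) = x \<ast> (z \<odot> y) + y \<ast> (z \<odot> x)"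

locale poisson = prod: fd_algebra scale V star + lie: fd_algebra scale V br
  for scale :: "'k::field \<Rightarrow> 'v::ab_group_add \<Rightarrow> 'v" and V
    and star (infixl \<open>\<star>\<close> 70) and br :: "'v \<Rightarrow> 'v \<Rightarrow> 'v" +
  assumes star_commute: "x \<in> V \<Longrightarrow> y \<in> V \<Longrightarrow> x \<star> y = y \<star> x"
    and star_assoc: "x \<in> V \<Longrightarrow> y \<in> V \<Longrightarrow> z \<in> V \<Longrightarrow> (x \<star> y) \<star> z = x \<star> (y \<star> z)"
    and br_alternating: "x \<in> V \<Longrightarrow> br x x = 0"
    and br_jacobi: "x \<in> V \<Longrightarrow> y \<in> V \<Longrightarrow> z \<in> V \<Longrightarrow>
      br x (br y z) + br y (br z x) + br z (br x y) = 0"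
    and leibniz: "x \<in> V \<Longrightarrow> y \<in> V \<Longrightarrow> z \<in> V \<Longrightarrow> br x (y \<star> z) = br x y \<star> z + y \<star> br x z"


section \<open>A-algebras and relative Rota-Baxter operators\<close>

definition linear_to_End ::
  "('k::field \<Rightarrow> 'a::ab_group_add \<Rightarrow> 'a) \<Rightarrow> ('k \<Rightarrow> 'v::ab_group_add \<Rightarrow> 'v) \<Rightarrow> 'v set
    \<Rightarrow> ('a \<Rightarrow> 'v \<Rightarrow> 'v) \<Rightarrow> bool" where
  "linear_to_End sA sV V f \<longleftrightarrow>
     (\<forall>x. \<forall>u\<in>V. f x u \<in> V) \<and>
     (\<forall>x. \<forall>u\<in>V. \<forall>v\<in>V. f x (u + v) = f x u + f x v) \<and>
     (\<forall>x c. \<forall>u\<in>V. f x (sV c u) = sV c (f x u)) \<and>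
     (\<forall>x y. \<forall>u\<in>V. f (x + y) u = f x u + f y u) \<and>
     (\<forall>x c. \<forall>u\<in>V. f (sA c x) u = sV c (f x u))"

definition linear_from ::
  "('k::field \<Rightarrow> 'a::ab_group_add \<Rightarrow> 'a) \<Rightarrow> ('k \<Rightarrow> 'v::ab_group_add \<Rightarrow> 'v) \<Rightarrow> 'v set
    \<Rightarrow> ('v \<Rightarrow> 'a) \<Rightarrow> bool" where
  "linear_from sA sV V T \<longleftrightarrow>
     (\<forall>u\<in>V. \<forall>v\<in>V. T (u + v) = T u + T v) \<and> (\<forall>c. \<forall>u\<in>V. T (sV c u) = sA c (T u))"

definition sum_scale ::
  "('k \<Rightarrow> 'a \<Rightarrow> 'a) \<Rightarrow> ('k \<Rightarrow> 'v \<Rightarrow> 'v) \<Rightarrow> 'k \<Rightarrow> 'a \<times> 'v \<Rightarrow> 'a \<times> 'v" where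
  "sum_scale sA sV c = (\<lambda>(x, a). (sA c x, sV c a))"

text \<open>The operation \<open>(x + a)(y + b) = x y + l(x) b + r(y) a + a b\<close> on \<open>A \<oplus> V\<close>.\<close>

definition sum_mult ::
  "('a \<Rightarrow> 'a \<Rightarrow> 'a) \<Rightarrow> ('v \<Rightarrow> 'v \<Rightarrow> 'v) \<Rightarrow> ('a \<Rightarrow> 'v \<Rightarrow> 'v) \<Rightarrow> ('a \<Rightarrow> 'v \<Rightarrow> 'v)
    \<Rightarrow> 'a \<times> 'v \<Rightarrow> 'a \<times> 'v \<Rightarrow> 'a \<times> 'v::ab_group_add" where
  "sum_mult m mV l r = (\<lambda>(x, a) (y, b). (m x y, l x b + r y a + mV a b))"

definition A_anti_pre_poisson ::
  "('k::field \<Rightarrow> 'a::ab_group_add \<Rightarrow> 'a) \<Rightarrow> ('a \<Rightarrow> 'a \<Rightarrow> 'a) \<Rightarrow> ('a \<Rightarrow> 'a \<Rightarrow> 'a)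
    \<Rightarrow> ('k \<Rightarrow> 'v::ab_group_add \<Rightarrow> 'v) \<Rightarrow> 'v set \<Rightarrow> ('v \<Rightarrow> 'v \<Rightarrow> 'v) \<Rightarrow> ('v \<Rightarrow> 'v \<Rightarrow> 'v)
    \<Rightarrow> ('a \<Rightarrow> 'v \<Rightarrow> 'v) \<Rightarrow> ('a \<Rightarrow> 'v \<Rightarrow> 'v) \<Rightarrow> ('a \<Rightarrow> 'v \<Rightarrow> 'v) \<Rightarrow> ('a \<Rightarrow> 'v \<Rightarrow> 'v) \<Rightarrow> bool" where
  "A_anti_pre_poisson sA ast circ sV V astV circV lA rA lC rC \<longleftrightarrow>
     anti_pre_poisson sV V astV circV \<and>
     linear_to_End sA sV V lA \<and> linear_to_End sA sV V rA \<and>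
     linear_to_End sA sV V lC \<and> linear_to_End sA sV V rC \<and>
     anti_pre_poisson (sum_scale sA sV) (UNIV \<times> V)
       (sum_mult ast astV lA rA) (sum_mult circ circV lC rC)"

definition A_poisson ::
  "('k::field \<Rightarrow> 'a::ab_group_add \<Rightarrow> 'a) \<Rightarrow> ('a \<Rightarrow> 'a \<Rightarrow> 'a) \<Rightarrow> ('a \<Rightarrow> 'a \<Rightarrow> 'a)
    \<Rightarrow> ('k \<Rightarrow> 'v::ab_group_add \<Rightarrow> 'v) \<Rightarrow> 'v set \<Rightarrow> ('v \<Rightarrow> 'v \<Rightarrow> 'v) \<Rightarrow> ('v \<Rightarrow> 'v \<Rightarrow> 'v)
    \<Rightarrow> ('a \<Rightarrow> 'v \<Rightarrow> 'v) \<Rightarrow> ('a \<Rightarrow> 'v \<Rightarrow> 'v) \<Rightarrow> bool" where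
  "A_poisson sA star br sV V starV brV \<mu> \<rho> \<longleftrightarrow>
     poisson sV V starV brV \<and>
     linear_to_End sA sV V \<mu> \<and> linear_to_End sA sV V \<rho> \<and>
     poisson (sum_scale sA sV) (UNIV \<times> V)
       (sum_mult star starV \<mu> \<mu>) (sum_mult br brV \<rho> (\<lambda>x a. - \<rho> x a))"

definition relative_RB_anti_pre_poisson ::
  "('k::field \<Rightarrow> 'a::ab_group_add \<Rightarrow> 'a) \<Rightarrow> ('a \<Rightarrow> 'a \<Rightarrow> 'a) \<Rightarrow> ('a \<Rightarrow> 'a \<Rightarrow> 'a)
    \<Rightarrow> ('k \<Rightarrow> 'v::ab_group_add \<Rightarrow> 'v) \<Rightarrow> 'v set \<Rightarrow> ('v \<Rightarrow> 'v \<Rightarrow> 'v) \<Rightarrow> ('v \<Rightarrow> 'v \<Rightarrow> 'v)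
    \<Rightarrow> ('a \<Rightarrow> 'v \<Rightarrow> 'v) \<Rightarrow> ('a \<Rightarrow> 'v \<Rightarrow> 'v) \<Rightarrow> ('a \<Rightarrow> 'v \<Rightarrow> 'v) \<Rightarrow> ('a \<Rightarrow> 'v \<Rightarrow> 'v)
    \<Rightarrow> 'k \<Rightarrow> ('v \<Rightarrow> 'a) \<Rightarrow> bool" where
  "relative_RB_anti_pre_poisson sA ast circ sV V astV circV lA rA lC rC lam T \<longleftrightarrow>
     A_anti_pre_poisson sA ast circ sV V astV circV lA rA lC rC \<and>
     linear_from sA sV V T \<and>
     (\<forall>u\<in>V. \<forall>v\<in>V. ast (T u) (T v) = T (lA (T u) v + rA (T v) u + sV lam (astV u v))) \<and>
     (\<forall>u\<in>V. \<forall>v\<in>V. circ (T u) (T v) = T (lC (T u) v + rC (T v) u + sV lam (circV u v)))"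

definition relative_RB_poisson ::
  "('k::field \<Rightarrow> 'a::ab_group_add \<Rightarrow> 'a) \<Rightarrow> ('a \<Rightarrow> 'a \<Rightarrow> 'a) \<Rightarrow> ('a \<Rightarrow> 'a \<Rightarrow> 'a)
    \<Rightarrow> ('k \<Rightarrow> 'v::ab_group_add \<Rightarrow> 'v) \<Rightarrow> 'v set \<Rightarrow> ('v \<Rightarrow> 'v \<Rightarrow> 'v) \<Rightarrow> ('v \<Rightarrow> 'v \<Rightarrow> 'v)
    \<Rightarrow> ('a \<Rightarrow> 'v \<Rightarrow> 'v) \<Rightarrow> ('a \<Rightarrow> 'v \<Rightarrow> 'v) \<Rightarrow> 'k \<Rightarrow> ('v \<Rightarrow> 'a) \<Rightarrow> bool" where
  "relative_RB_poisson sA star br sV V starV brV \<mu> \<rho> lam T \<longleftrightarrow>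
     A_poisson sA star br sV V starV brV \<mu> \<rho> \<and>
     linear_from sA sV V T \<and>
     (\<forall>u\<in>V. \<forall>v\<in>V. star (T u) (T v) = T (\<mu> (T u) v + \<mu> (T v) u + sV lam (starV u v))) \<and>
     (\<forall>u\<in>V. \<forall>v\<in>V. br (T u) (T v) = T (\<rho> (T u) v - \<rho> (T v) u + sV lam (brV u v)))"


section \<open>Tensors\<close>

text \<open>
  The tensor product is the free vector space on tuples modulo the span of the multilinearity
  relations. An element \<open>\<Sum>\<^sub>p c\<^sub>p \<cdot> (fst p \<otimes> snd p)\<close> of \<open>A \<otimes> A\<close> is represented by the finitely
  supported function \<open>c\<close>, and equality in \<open>A \<otimes> A\<close> and in \<open>A \<otimes> A \<otimes> A\<close> is the congruence
  \<open>tensor_eq\<close> resp. \<open>tensor3_eq\<close> below, not equality of representatives.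
\<close>

type_synonym ('a, 'k) tensor = "('a \<times> 'a) \<Rightarrow>\<^sub>0 'k"
type_synonym ('a, 'k) tensor3 = "('a \<times> 'a \<times> 'a) \<Rightarrow>\<^sub>0 'k"

definition free_scale :: "'k::field \<Rightarrow> ('x \<Rightarrow>\<^sub>0 'k) \<Rightarrow> ('x \<Rightarrow>\<^sub>0 'k)" where
  "free_scale c = Poly_Mapping.map ((*) c)"

lemma lookup_free_scale:
  "Poly_Mapping.lookup (free_scale c p) x = c * Poly_Mapping.lookup p x"
  by (simp add: free_scale_def map.rep_eq when_def)

lemma vector_space_free_scale: "vector_space free_scale"
  by unfold_locales
    (auto intro!: poly_mapping_eqI simp: lookup_free_scale lookup_add algebra_simps)

abbreviation free_gen :: "'x \<Rightarrow> ('x \<Rightarrow>\<^sub>0 'k::field)" where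
  "free_gen p \<equiv> Poly_Mapping.single p 1"

definition tensor_null :: "('k::field \<Rightarrow> 'a::ab_group_add \<Rightarrow> 'a) \<Rightarrow> ('a, 'k) tensor set" where
  "tensor_null scale = module.span free_scale
     ({free_gen (x + x', y) - free_gen (x, y) - free_gen (x', y) |x x' y. True} \<union>
      {free_gen (x, y + y') - free_gen (x, y) - free_gen (x, y') |x y y'. True} \<union>
      {free_gen (scale c x, y) - free_scale c (free_gen (x, y)) |c x y. True} \<union>
      {free_gen (x, scale c y) - free_scale c (free_gen (x, y)) |c x y. True})"

definition tensor3_null :: "('k::field \<Rightarrow> 'a::ab_group_add \<Rightarrow> 'a) \<Rightarrow> ('a, 'k) tensor3 set" where
  "tensor3_null scale = module.span free_scale
     ({free_gen (x + x', y, z) - free_gen (x, y, z) - free_gen (x', y, z) |x x' y z. True} \<union>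
      {free_gen (x, y + y', z) - free_gen (x, y, z) - free_gen (x, y', z) |x y y' z. True} \<union>
      {free_gen (x, y, z + z') - free_gen (x, y, z) - free_gen (x, y, z') |x y z z'. True} \<union>
      {free_gen (scale c x, y, z) - free_scale c (free_gen (x, y, z)) |c x y z. True} \<union>
      {free_gen (x, scale c y, z) - free_scale c (free_gen (x, y, z)) |c x y z. True} \<union>
      {free_gen (x, y, scale c z) - free_scale c (free_gen (x, y, z)) |c x y z. True})"

definition (in vector_space) tensor_eq ::
  "('b, 'a) tensor \<Rightarrow> ('b, 'a) tensor \<Rightarrow> bool" (infix \<open>\<approx>\<close> 50) where
  "s \<approx> t \<longleftrightarrow> s - t \<in> tensor_null scale"

definition (in vector_space) tensor3_eq ::
  "('b, 'a) tensor3 \<Rightarrow> ('b, 'a) tensor3 \<Rightarrow> bool" where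
  "tensor3_eq s t \<longleftrightarrow> s - t \<in> tensor3_null scale"

definition free_map :: "('x \<Rightarrow> 'y) \<Rightarrow> ('x \<Rightarrow>\<^sub>0 'k::field) \<Rightarrow> ('y \<Rightarrow>\<^sub>0 'k)" where
  "free_map f s = (\<Sum>p\<in>Poly_Mapping.keys s.
     Poly_Mapping.single (f p) (Poly_Mapping.lookup s p))"

text \<open>\<open>tensor_map f g\<close> is \<open>f \<otimes> g\<close>, and \<open>flip\<close> is \<open>\<tau>\<close>.\<close>

definition tensor_map ::
  "('a \<Rightarrow> 'a) \<Rightarrow> ('a \<Rightarrow> 'a) \<Rightarrow> ('a, 'k::field) tensor \<Rightarrow> ('a, 'k) tensor" where
  "tensor_map f g = free_map (\<lambda>(x, y). (f x, g y))"

definition flip :: "('a, 'k::field) tensor \<Rightarrow> ('a, 'k) tensor" where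
  "flip = free_map (\<lambda>(x, y). (y, x))"


section \<open>The dual space\<close>

definition dual :: "('k::field \<Rightarrow> 'a::ab_group_add \<Rightarrow> 'a) \<Rightarrow> ('a \<Rightarrow> 'k) set" where
  "dual scale = {\<zeta>. Vector_Spaces.linear scale (*) \<zeta>}"

definition dual_scale :: "'k::field \<Rightarrow> ('a \<Rightarrow> 'k) \<Rightarrow> ('a \<Rightarrow> 'k)" where
  "dual_scale c \<zeta> = (\<lambda>x. c * \<zeta> x)"

text \<open>\<open>dual_rep f\<close> is \<open>f\<^sup>*\<close>, with the sign convention of contragredient representations.\<close>

definition dual_rep :: "('a \<Rightarrow> 'a \<Rightarrow> 'a) \<Rightarrow> 'a \<Rightarrow> ('a \<Rightarrow> 'k::field) \<Rightarrow> ('a \<Rightarrow> 'k)" where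
  "dual_rep f x \<zeta> = (\<lambda>v. - \<zeta> (f x v))"

text \<open>\<open>pairing s \<zeta> \<eta>\<close> is \<open>\<langle>s, \<zeta> \<otimes> \<eta>\<rangle>\<close>.\<close>

definition pairing :: "('a, 'k::field) tensor \<Rightarrow> ('a \<Rightarrow> 'k) \<Rightarrow> ('a \<Rightarrow> 'k) \<Rightarrow> 'k" where
  "pairing s \<zeta> \<eta> = (\<Sum>p\<in>Poly_Mapping.keys s. Poly_Mapping.lookup s p * (\<zeta> (fst p) * \<eta> (snd p)))"

definition tensor_operator ::
  "('k::field \<Rightarrow> 'a::ab_group_add \<Rightarrow> 'a) \<Rightarrow> ('a, 'k) tensor \<Rightarrow> ('a \<Rightarrow> 'k) \<Rightarrow> 'a" where
  "tensor_operator scale s \<zeta> = (THE x. \<forall>\<eta>\<in>dual scale. \<eta> x = pairing s \<zeta> \<eta>)"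

definition dual_op ::
  "('a \<Rightarrow> ('a, 'k::field) tensor) \<Rightarrow> ('a \<Rightarrow> 'k) \<Rightarrow> ('a \<Rightarrow> 'k) \<Rightarrow> ('a \<Rightarrow> 'k)" where
  "dual_op \<Delta> \<zeta> \<eta> = (\<lambda>x. pairing (\<Delta> x) \<zeta> \<eta>)"


section \<open>Anti-pre-Poisson bialgebras\<close>

definition (in vector_space) linear_to_tensor :: "('b \<Rightarrow> ('b, 'a) tensor) \<Rightarrow> bool" where
  "linear_to_tensor \<Delta> \<longleftrightarrow>
     (\<forall>x y. \<Delta> (x + y) \<approx> \<Delta> x + \<Delta> y) \<and> (\<forall>c x. \<Delta> (scale c x) \<approx> free_scale c (\<Delta> x))"

locale anti_pre_poisson_bialgebra = anti_pre_poisson scale UNIV ast circ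
  for scale :: "'k::field \<Rightarrow> 'a::ab_group_add \<Rightarrow> 'a"
    and ast (infixl \<open>\<ast>\<close> 70) and circ (infixl \<open>\<odot>\<close> 70) +
  fixes \<Delta> \<delta> :: "'a \<Rightarrow> ('a, 'k) tensor"
  assumes linear_\<Delta>: "linear_to_tensor \<Delta>"
    and linear_\<delta>: "linear_to_tensor \<delta>"
    and coalgebra: "anti_pre_poisson dual_scale (dual scale) (dual_op \<Delta>) (dual_op \<delta>)"
    and bialgebra_1: "\<Delta> (symmetrized (\<ast>) x y) \<approx>
      tensor_map id (symmetrized (\<ast>) x) (\<Delta> y) - tensor_map (\<lambda>z. y \<ast> z) id (\<Delta> x)"
    and bialgebra_2: "\<Delta> (x \<ast> y) + flip (\<Delta> (x \<ast> y)) \<approx>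
      tensor_map (\<lambda>z. x \<ast> z) id (\<Delta> y + flip (\<Delta> y)) - tensor_map id (\<lambda>z. z \<ast> y) (\<Delta> x)"
    and bialgebra_3: "\<delta> (commutator (\<odot>) x y) \<approx>
      (tensor_map id (commutator (\<odot>) x) (\<delta> y) - tensor_map (\<lambda>z. x \<odot> z) id (\<delta> y)) -
      (tensor_map id (commutator (\<odot>) y) (\<delta> x) - tensor_map (\<lambda>z. y \<odot> z) id (\<delta> x))"
    and bialgebra_4:
      "t = \<delta> (x \<odot> y) - tensor_map (\<lambda>z. x \<odot> z) id (\<delta> y) - tensor_map id (\<lambda>z. x \<odot> z) (\<delta> y)
             + tensor_map id (\<lambda>z. z \<odot> y) (\<delta> x)
       \<Longrightarrow> t - flip t \<approx> 0"
    and bialgebra_5: "\<delta> (symmetrized (\<ast>) x y) \<approx>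
      tensor_map id (symmetrized (\<ast>) x) (\<delta> y) + tensor_map id (symmetrized (\<ast>) y) (\<delta> x) +
      tensor_map (\<lambda>z. x \<odot> z) id (\<Delta> y) + tensor_map (\<lambda>z. y \<odot> z) id (\<Delta> x)"
    and bialgebra_6: "\<Delta> (commutator (\<odot>) x y) \<approx>
      - tensor_map (\<lambda>z. x \<odot> z) id (\<Delta> y) - tensor_map id (symmetrized (\<ast>) y) (\<delta> x)
      - tensor_map (\<lambda>z. y \<ast> z) id (\<delta> x) + tensor_map id (commutator (\<odot>) x) (\<Delta> y)"
    and bialgebra_7:
      "t = tensor_map (\<lambda>z. x \<odot> z) id (\<Delta> y) + tensor_map id (\<lambda>z. x \<odot> z) (\<Delta> y)
             + tensor_map id (\<lambda>z. z \<ast> y) (\<delta> x)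
       \<Longrightarrow> \<Delta> (x \<odot> y) + flip (\<Delta> (x \<odot> y)) \<approx> t + flip t"
    and bialgebra_8: "\<delta> (x \<ast> y) - flip (\<delta> (x \<ast> y)) \<approx>
      tensor_map id (\<lambda>z. x \<ast> z) (\<delta> y) - flip (tensor_map (\<lambda>z. x \<ast> z) id (\<delta> y))
      - tensor_map (\<lambda>z. x \<odot> z) id (\<Delta> y) - flip (tensor_map id (\<lambda>z. x \<odot> z) (\<Delta> y))
      - tensor_map id (\<lambda>z. z \<ast> y) (\<delta> x) - flip (tensor_map id (\<lambda>z. z \<odot> y) (\<Delta> x))"


section \<open>The anti-pre-Poisson Yang-Baxter equation\<close>

definition invariant_tensor ::
  "('k::field \<Rightarrow> 'a::ab_group_add \<Rightarrow> 'a) \<Rightarrow> ('a \<Rightarrow> 'a \<Rightarrow> 'a) \<Rightarrow> ('a \<Rightarrow> 'a \<Rightarrow> 'a)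
    \<Rightarrow> ('a, 'k) tensor \<Rightarrow> bool" where
  "invariant_tensor scale ast circ s \<longleftrightarrow>
     (\<forall>x. vector_space.tensor_eq scale
            (tensor_map id (symmetrized ast x) s + tensor_map (ast x) id s) 0) \<and>
     (\<forall>x. vector_space.tensor_eq scale
            (tensor_map (circ x) id s - tensor_map id (commutator circ x) s) 0)"

text \<open>
  \<open>YBE_D\<close> and \<open>YBE_S\<close> are \<open>D(r)\<close> and \<open>S(r)\<close>, the double sums running over the support of the
  representative \<open>r = \<Sum>\<^sub>p c\<^sub>p \<cdot> (fst p \<otimes> snd p)\<close>.
\<close>

definition YBE_D ::
  "('a \<Rightarrow> 'a \<Rightarrow> 'a::ab_group_add) \<Rightarrow> ('a, 'k::field) tensor \<Rightarrow> ('a, 'k) tensor3" where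
  "YBE_D ast r = (\<Sum>p\<in>Poly_Mapping.keys r. \<Sum>q\<in>Poly_Mapping.keys r.
     free_scale (Poly_Mapping.lookup r p * Poly_Mapping.lookup r q)
       (free_gen (fst p, ast (snd p) (fst q), snd q)
        - free_gen (ast (fst p) (fst q), snd p, snd q)
        + free_gen (fst p, fst q, symmetrized ast (snd p) (snd q))))"

definition YBE_S ::
  "('a \<Rightarrow> 'a \<Rightarrow> 'a::ab_group_add) \<Rightarrow> ('a, 'k::field) tensor \<Rightarrow> ('a, 'k) tensor3" where
  "YBE_S circ r = (\<Sum>p\<in>Poly_Mapping.keys r. \<Sum>q\<in>Poly_Mapping.keys r.
     free_scale (Poly_Mapping.lookup r p * Poly_Mapping.lookup r q)
       (free_gen (circ (fst p) (fst q), snd p, snd q)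
        + free_gen (fst p, circ (snd p) (fst q), snd q)
        - free_gen (fst p, fst q, commutator circ (snd p) (snd q))))"

definition APP_YBE ::
  "('k::field \<Rightarrow> 'a::ab_group_add \<Rightarrow> 'a) \<Rightarrow> ('a \<Rightarrow> 'a \<Rightarrow> 'a) \<Rightarrow> ('a \<Rightarrow> 'a \<Rightarrow> 'a)
    \<Rightarrow> ('a, 'k) tensor \<Rightarrow> bool" where
  "APP_YBE scale ast circ r \<longleftrightarrow>
     vector_space.tensor3_eq scale (YBE_D ast r) 0 \<and>
     vector_space.tensor3_eq scale (YBE_S circ r) 0"

definition \<Delta>_of ::
  "('a \<Rightarrow> 'a \<Rightarrow> 'a::ab_group_add) \<Rightarrow> ('a, 'k::field) tensor \<Rightarrow> 'a \<Rightarrow> ('a, 'k) tensor" where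
  "\<Delta>_of ast r x = - (tensor_map id (symmetrized ast x) r + tensor_map (ast x) id r)"

definition \<delta>_of ::
  "('a \<Rightarrow> 'a \<Rightarrow> 'a::ab_group_add) \<Rightarrow> ('a, 'k::field) tensor \<Rightarrow> 'a \<Rightarrow> ('a, 'k) tensor" where
  "\<delta>_of circ r x = tensor_map (circ x) id r - tensor_map id (commutator circ x) r"

definition quasi_triangular ::
  "('k::field \<Rightarrow> 'a::ab_group_add \<Rightarrow> 'a) \<Rightarrow> ('a \<Rightarrow> 'a \<Rightarrow> 'a) \<Rightarrow> ('a \<Rightarrow> 'a \<Rightarrow> 'a)
    \<Rightarrow> ('a, 'k) tensor \<Rightarrow> bool" where
  "quasi_triangular scale ast circ r \<longleftrightarrow>
     APP_YBE scale ast circ r \<and>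
     invariant_tensor scale ast circ (r + flip r) \<and>
     anti_pre_poisson_bialgebra scale ast circ (\<Delta>_of ast r) (\<delta>_of circ r)"


section \<open>Operations on the dual induced by a symmetric invariant tensor\<close>

text \<open>
  For symmetric invariant \<open>s\<close> these are also \<open>- R\<^sub>\<ast>\<^sup>*(T\<^sub>s \<eta>) \<zeta>\<close> and \<open>R\<^sub>\<circ>\<^sup>*(T\<^sub>s \<eta>) \<zeta>\<close>, respectively.
\<close>

definition dual_ast ::
  "('k::field \<Rightarrow> 'a::ab_group_add \<Rightarrow> 'a) \<Rightarrow> ('a \<Rightarrow> 'a \<Rightarrow> 'a) \<Rightarrow> ('a, 'k) tensor
    \<Rightarrow> ('a \<Rightarrow> 'k) \<Rightarrow> ('a \<Rightarrow> 'k) \<Rightarrow> ('a \<Rightarrow> 'k)" where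
  "dual_ast scale ast s \<zeta> \<eta> = dual_rep (symmetrized ast) (tensor_operator scale s \<zeta>) \<eta>"

definition dual_circ ::
  "('k::field \<Rightarrow> 'a::ab_group_add \<Rightarrow> 'a) \<Rightarrow> ('a \<Rightarrow> 'a \<Rightarrow> 'a) \<Rightarrow> ('a, 'k) tensor
    \<Rightarrow> ('a \<Rightarrow> 'k) \<Rightarrow> ('a \<Rightarrow> 'k) \<Rightarrow> ('a \<Rightarrow> 'k)" where
  "dual_circ scale circ s \<zeta> \<eta> = - dual_rep (commutator circ) (tensor_operator scale s \<zeta>) \<eta>"

end

theory Submission
  imports Defs
begin

text \<open>
  Let \<open>T\<close>, \<open>T'\<close> be the operators \<open>A\<^sup>* \<rightarrow> A\<close> of \<open>r\<close> and \<open>\<tau>(r)\<close>; they are transposes of each other, and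
  \<open>S = T + T'\<close> is the operator of \<open>r + \<tau>(r)\<close>. As \<open>A\<close> is finite-dimensional, equality of tensors can
  be tested on functionals (\<open>tensor_eq_iff\<close>, \<open>tensor3_eq_iff\<close>), so the two components of the
  Yang-Baxter equation become the vanishing of two trilinear forms on \<open>A\<^sup>*\<close>, written with \<open>T\<close> and
  \<open>T'\<close> (\<open>pairing3_YBE\<close>). Invariance of \<open>r + \<tau>(r)\<close> says that \<open>S\<close> moves multiplications across the
  pairing. Testing a Rota-Baxter identity on a third functional and moving \<open>S\<close> across, one finds
  that its defect is one of these forms up to sign and order of the arguments
  (\<open>Rota_Baxter_defect\<close>). This holds for the identities in \<open>A\<close> as well as for those in the
  Poisson algebra of \<open>A\<close>, without dividing by 2, and makes all the operator identities equivalent to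
  the Yang-Baxter equation over any field.

  What remains are the structural claims, which hold for every \<open>r\<close> with \<open>r + \<tau>(r)\<close> invariant or
  follow from the Yang-Baxter equation.

  \<^item> The algebra \<open>E = A \<oplus> A\<^sup>*\<close> is anti-pre-Poisson (\<open>anti_pre_poisson_E\<close>): the map
    \<open>x + \<zeta> \<mapsto> x + S \<zeta>\<close> from \<open>E\<close> to \<open>A\<close> is a homomorphism, and \<open>E\<close> acts through it on the ideal \<open>A\<^sup>*\<close>
    by the coadjoint actions. An identity with an argument in \<open>A\<^sup>*\<close> is thus an identity of these
    actions, that is, the dual of an identity of \<open>A\<close>.

  \<^item> The Poisson statement about \<open>E\<close> follows because symmetrized product and commutator turn every
    anti-pre-Poisson algebra into a Poisson algebra (\<open>poisson_symmetrized_commutator\<close>).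

  \<^item> The operations on \<open>A\<^sup>*\<close> dual to \<open>\<Delta>\<^sub>r\<close> and \<open>\<delta>\<^sub>r\<close> satisfy all identities because, for a
    Rota-Baxter operator \<open>T\<close> of weight \<open>-1\<close>, the map \<open>\<zeta> \<mapsto> (T \<zeta>, -\<zeta>)\<close> embeds them into \<open>E\<close>
    (\<open>coalgebra_dual\<close>).

  \<^item> The eight compatibility conditions of a bialgebra are linear in \<open>r\<close>. Invariance rewrites
    \<open>\<tau>\<Delta>\<^sub>r\<close> and \<open>\<tau>\<delta>\<^sub>r\<close> as operators applied to \<open>r\<close> itself (\<open>pairing_flip_\<Delta>\<close>, \<open>pairing_flip_\<delta>\<close>);
    then the terms acting on both tensor factors cancel, and the others are identities of \<open>A\<close>.
\<close>

section \<open>Tensors as bilinear forms on the dual space\<close>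

text \<open>
  The linear extension of \<open>\<phi>\<close> from generators to the free vector space. Pairings of tensors with
  functionals are the case of the scalar field, so their linearity is proved once.
\<close>

definition free_lift ::
  "('k::field \<Rightarrow> 'v \<Rightarrow> 'v) \<Rightarrow> ('x \<Rightarrow> 'v) \<Rightarrow> ('x \<Rightarrow>\<^sub>0 'k) \<Rightarrow> 'v::ab_group_add" where
  "free_lift sc \<phi> s = (\<Sum>p\<in>Poly_Mapping.keys s. sc (Poly_Mapping.lookup s p) (\<phi> p))"

context vector_space
begin

lemma free_lift_superset:
  assumes "finite K" "Poly_Mapping.keys s \<subseteq> K"
  shows "free_lift scale \<phi> s = (\<Sum>p\<in>K. scale (Poly_Mapping.lookup s p) (\<phi> p))"
  unfolding free_lift_def
  by (rule sum.mono_neutral_left) (use assms in \<open>auto simp: in_keys_iff\<close>)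

lemma free_lift_add: "free_lift scale \<phi> (s + t) = free_lift scale \<phi> s + free_lift scale \<phi> t"
proof -
  let ?K = "Poly_Mapping.keys s \<union> Poly_Mapping.keys t"
  show ?thesis
    using Poly_Mapping.keys_add[of s t]
    by (simp add: free_lift_superset[of ?K] lookup_add scale_left_distrib sum.distrib)
qed

lemma free_lift_free_scale: "free_lift scale \<phi> (free_scale c s) = scale c (free_lift scale \<phi> s)"
proof -
  have "Poly_Mapping.keys (free_scale c s) \<subseteq> Poly_Mapping.keys s"
    by (auto simp: in_keys_iff lookup_free_scale)
  then show ?thesis
    by (simp add: free_lift_superset[of "Poly_Mapping.keys s"] lookup_free_scale scale_sum_right)
qed

lemma free_lift_0 [simp]: "free_lift scale \<phi> 0 = 0"
  by (simp add: free_lift_def)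

lemma free_lift_uminus: "free_lift scale \<phi> (- s) = - free_lift scale \<phi> s"
  using free_lift_add[of \<phi> s "- s"] by (simp add: eq_neg_iff_add_eq_0 add.commute)

lemma free_lift_diff: "free_lift scale \<phi> (s - t) = free_lift scale \<phi> s - free_lift scale \<phi> t"
  using free_lift_add[of \<phi> s "- t"] by (simp add: free_lift_uminus)

lemma free_lift_sum: "free_lift scale \<phi> (\<Sum>i\<in>I. s i) = (\<Sum>i\<in>I. free_lift scale \<phi> (s i))"
  by (induction I rule: infinite_finite_induct) (simp_all add: free_lift_add)

lemma free_lift_single: "free_lift scale \<phi> (Poly_Mapping.single p c) = scale c (\<phi> p)"
  by (cases "c = 0") (simp_all add: free_lift_def)

lemma free_lift_free_map: "free_lift scale \<phi> (free_map f s) = free_lift scale (\<lambda>p. \<phi> (f p)) s"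
  by (simp add: free_map_def free_lift_sum free_lift_single) (simp add: free_lift_def)

lemmas free_lift_linear = free_lift_add free_lift_free_scale free_lift_uminus free_lift_diff
  free_lift_sum free_lift_single

text \<open>
  Extend a basis of the subspace by the outside point, and send that point to \<open>1\<close> and the basis to
  \<open>0\<close>. This is how tensors are shown to be null: a functional on the free vector space that kills the
  multilinearity relations is a multilinear form.
\<close>

lemma ex_separating_functional:
  assumes "x \<notin> span N"
  shows "\<exists>F. Vector_Spaces.linear scale (*) F \<and> (\<forall>y\<in>span N. F y = 0) \<and> F x \<noteq> 0"
proof -
  interpret vector_space_pair scale "(*) :: 'a \<Rightarrow> 'a \<Rightarrow> 'a"
    by unfold_locales (auto simp: algebra_simps)
  obtain B where B: "B \<subseteq> N" "independent B" "N \<subseteq> span B"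
    using maximal_independent_subset by blast
  then have span_B: "span B = span N"
    using span_mono[OF B(1)] span_mono[OF B(3)] by (simp add: span_span)
  then have "independent (insert x B)"
    using assms B by (simp add: independent_insert)
  then obtain F where F: "Vector_Spaces.linear scale (*) F"
    "\<forall>b\<in>insert x B. F b = (if b = x then 1 else 0)"
    using linear_independent_extend[where f = "\<lambda>b. if b = x then 1 else 0"] by blast
  interpret F: Vector_Spaces.linear scale "(*)" F by (fact F(1))
  have "x \<notin> B"
    using assms span_B span_base by blast
  then have "F b = 0" if "b \<in> B" for b
    using F(2) that by auto
  then have "F y = 0" if "y \<in> span B" for y
    using F.eq_0_on_span that by blast
  then show ?thesis
    using F span_B by auto
qed

end

lemma vector_space_times: "vector_space ((*) :: 'k::field \<Rightarrow> 'k \<Rightarrow> 'k)"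
  by unfold_locales (auto simp: algebra_simps)

lemma dualI:
  assumes "vector_space scale" "\<And>x y. \<zeta> (x + y) = \<zeta> x + \<zeta> y" "\<And>c x. \<zeta> (scale c x) = c * \<zeta> x"
  shows "\<zeta> \<in> dual scale"
  using assms by (simp add: dual_def Vector_Spaces.linear_iff vector_space_times)

lemma
  assumes "\<zeta> \<in> dual scale"
  shows dual_add: "\<zeta> (x + y) = \<zeta> x + \<zeta> y"
    and dual_scale: "\<zeta> (scale c x) = c * \<zeta> x"
    and dual_uminus: "\<zeta> (- x) = - \<zeta> x"
    and dual_diff: "\<zeta> (x - y) = \<zeta> x - \<zeta> y"
    and dual_0: "\<zeta> 0 = 0"
    and dual_sum: "\<zeta> (\<Sum>i\<in>I. f i) = (\<Sum>i\<in>I. \<zeta> (f i))"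
proof -
  interpret Vector_Spaces.linear scale "(*)" \<zeta>
    using assms by (simp add: dual_def)
  show "\<zeta> (x + y) = \<zeta> x + \<zeta> y" "\<zeta> (scale c x) = c * \<zeta> x" "\<zeta> (- x) = - \<zeta> x"
    "\<zeta> (x - y) = \<zeta> x - \<zeta> y" "\<zeta> 0 = 0" "\<zeta> (\<Sum>i\<in>I. f i) = (\<Sum>i\<in>I. \<zeta> (f i))"
    by (rule add scale neg diff zero sum)+
qed

lemmas dual_simps = dual_add dual_scale dual_uminus dual_diff dual_0

definition pairing3 ::
  "('a, 'k::field) tensor3 \<Rightarrow> ('a \<Rightarrow> 'k) \<Rightarrow> ('a \<Rightarrow> 'k) \<Rightarrow> ('a \<Rightarrow> 'k) \<Rightarrow> 'k" where
  "pairing3 s \<zeta> \<eta> \<theta> = free_lift (*) (\<lambda>(x, y, z). \<zeta> x * \<eta> y * \<theta> z) s"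

lemma pairing_eq_free_lift: "pairing s \<zeta> \<eta> = free_lift (*) (\<lambda>(x, y). \<zeta> x * \<eta> y) s"
  by (simp add: pairing_def free_lift_def case_prod_beta)

lemmas field_lift = vector_space.free_lift_linear[OF vector_space_times]

lemma pairing_linear:
  shows pairing_add: "pairing (s + t) \<zeta> \<eta> = pairing s \<zeta> \<eta> + pairing t \<zeta> \<eta>"
    and "pairing (free_scale c s) \<zeta> \<eta> = c * pairing s \<zeta> \<eta>"
    and "pairing (- s) \<zeta> \<eta> = - pairing s \<zeta> \<eta>"
    and pairing_diff: "pairing (s - t) \<zeta> \<eta> = pairing s \<zeta> \<eta> - pairing t \<zeta> \<eta>"
    and pairing_0: "pairing 0 \<zeta> \<eta> = 0"
    and "pairing (free_gen (x, y)) \<zeta> \<eta> = \<zeta> x * \<eta> y"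
  by (simp_all add: pairing_eq_free_lift field_lift vector_space.free_lift_0[OF vector_space_times])

lemma pairing3_linear:
  shows "pairing3 (s + t) \<zeta> \<eta> \<theta> = pairing3 s \<zeta> \<eta> \<theta> + pairing3 t \<zeta> \<eta> \<theta>"
    and "pairing3 (free_scale c s) \<zeta> \<eta> \<theta> = c * pairing3 s \<zeta> \<eta> \<theta>"
    and pairing3_diff: "pairing3 (s - t) \<zeta> \<eta> \<theta> = pairing3 s \<zeta> \<eta> \<theta> - pairing3 t \<zeta> \<eta> \<theta>"
    and pairing3_0: "pairing3 0 \<zeta> \<eta> \<theta> = 0"
    and "pairing3 (\<Sum>i\<in>I. u i) \<zeta> \<eta> \<theta> = (\<Sum>i\<in>I. pairing3 (u i) \<zeta> \<eta> \<theta>)"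
    and "pairing3 (free_gen (x, y, z)) \<zeta> \<eta> \<theta> = \<zeta> x * \<eta> y * \<theta> z"
  by (simp_all add: pairing3_def field_lift vector_space.free_lift_0[OF vector_space_times])

lemma pairing_tensor_map:
  "pairing (tensor_map f g s) \<zeta> \<eta> = pairing s (\<lambda>x. \<zeta> (f x)) (\<lambda>x. \<eta> (g x))"
  by (simp add: pairing_eq_free_lift tensor_map_def case_prod_unfold
      vector_space.free_lift_free_map[OF vector_space_times])

lemma pairing_flip: "pairing (flip s) \<zeta> \<eta> = pairing s \<eta> \<zeta>"
  by (simp add: pairing_eq_free_lift flip_def case_prod_unfold mult.commute
      vector_space.free_lift_free_map[OF vector_space_times])

text \<open>
  Bilinearity holds for arbitrary functions, so sums inside a pairing expand without side conditions.
\<close>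

lemma pairing_args:
  shows "pairing s (\<lambda>x. \<zeta> x + \<zeta>' x) \<eta> = pairing s \<zeta> \<eta> + pairing s \<zeta>' \<eta>"
    and "pairing s \<zeta> (\<lambda>x. \<eta> x + \<eta>' x) = pairing s \<zeta> \<eta> + pairing s \<zeta> \<eta>'"
    and "pairing s (\<lambda>x. \<zeta> x - \<zeta>' x) \<eta> = pairing s \<zeta> \<eta> - pairing s \<zeta>' \<eta>"
    and "pairing s \<zeta> (\<lambda>x. \<eta> x - \<eta>' x) = pairing s \<zeta> \<eta> - pairing s \<zeta> \<eta>'"
    and "pairing s (\<lambda>x. - \<zeta> x) \<eta> = - pairing s \<zeta> \<eta>"
    and "pairing s \<zeta> (\<lambda>x. - \<eta> x) = - pairing s \<zeta> \<eta>"
    and "pairing s (\<lambda>x. c * \<zeta> x) \<eta> = c * pairing s \<zeta> \<eta>"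
    and "pairing s \<zeta> (\<lambda>x. c * \<eta> x) = c * pairing s \<zeta> \<eta>"
  by (simp_all add: pairing_def algebra_simps sum.distrib sum_subtractf sum_negf sum_distrib_left)

lemma free_expansion:
  "u = (\<Sum>p\<in>Poly_Mapping.keys u. free_scale (Poly_Mapping.lookup u p) (free_gen p))"
  by (rule poly_mapping_eqI)
    (simp add: lookup_sum lookup_free_scale lookup_single when_def in_keys_iff if_distrib
      sum.If_cases
      cong: if_cong)

locale fd_total = fd_space scale UNIV
  for scale :: "'k::field \<Rightarrow> 'a::ab_group_add \<Rightarrow> 'a"
begin

lemma ex_dual_basis:
  obtains B and coord :: "'a \<Rightarrow> 'a \<Rightarrow> 'k"
  where "finite B" "\<And>b. coord b \<in> dual scale" "\<And>x. (\<Sum>b\<in>B. scale (coord b x) b) = x"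
    "\<And>\<zeta> x. \<zeta> \<in> dual scale \<Longrightarrow> \<zeta> x = (\<Sum>b\<in>B. \<zeta> b * coord b x)"
proof -
  obtain B0 where B0: "finite B0" "span B0 = UNIV"
    using finite_dim by blast
  obtain B where B: "B \<subseteq> B0" "independent B" "B0 \<subseteq> span B"
    using maximal_independent_subset by blast
  then have fin: "finite B" and span_B: "span B = UNIV"
    using B0 finite_subset span_mono[of B0 "span B"] by (auto simp: span_span)
  define coord where "coord b x = representation B x b" for b x
  have sum_eq: "(\<Sum>b\<in>B. scale (coord b x) b) = x" for x
    unfolding coord_def using sum_representation_eq[OF B(2) _ fin] span_B by auto
  show ?thesis
  proof (rule that[OF fin _ sum_eq])
    show "coord b \<in> dual scale" for b
      by (rule dualI)
        (simp_all add: coord_def B(2) span_B representation_add representation_scale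
          vector_space_axioms)
    show "\<zeta> x = (\<Sum>b\<in>B. \<zeta> b * coord b x)" if "\<zeta> \<in> dual scale" for \<zeta> x
    proof -
      have "\<zeta> x = \<zeta> (\<Sum>b\<in>B. scale (coord b x) b)"
        by (simp only: sum_eq)
      also have "\<dots> = (\<Sum>b\<in>B. \<zeta> b * coord b x)"
        using that by (simp add: dual_sum dual_scale mult.commute)
      finally show ?thesis .
    qed
  qed
qed

lemma dual_eqI:
  assumes "\<And>\<theta>. \<theta> \<in> dual scale \<Longrightarrow> \<theta> x = \<theta> y"
  shows "x = y"
proof -
  obtain B and coord :: "'a \<Rightarrow> 'a \<Rightarrow> 'k" where
    dual: "\<And>b. coord b \<in> dual scale" and sum: "\<And>x. (\<Sum>b\<in>B. scale (coord b x) b) = x"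
    using ex_dual_basis by metis
  have "(\<Sum>b\<in>B. scale (coord b x) b) = (\<Sum>b\<in>B. scale (coord b y) b)"
    using assms[OF dual] by simp
  then show ?thesis
    by (simp only: sum)
qed

text \<open>
  If \<open>u\<close> were not null, a functional \<open>F\<close> vanishing on the bilinearity relations would have
  \<open>F u \<noteq> 0\<close>. It is given by a bilinear form \<open>\<beta>\<close> on \<open>A\<close>, and expanding \<open>\<beta>\<close> in dual coordinates writes
  \<open>F u\<close> as a combination of the pairings of \<open>u\<close> with pairs of coordinate functionals.
\<close>

lemma tensor_null_iff:
  "u \<in> tensor_null scale \<longleftrightarrow> (\<forall>\<zeta>\<in>dual scale. \<forall>\<eta>\<in>dual scale. pairing u \<zeta> \<eta> = 0)"
proof (intro iffI ballI)
  interpret free: vector_space "free_scale :: 'k \<Rightarrow> ('a, 'k) tensor \<Rightarrow> ('a, 'k) tensor"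
    by (rule vector_space_free_scale)
  show "pairing u \<zeta> \<eta> = 0"
    if "u \<in> tensor_null scale" "\<zeta> \<in> dual scale" "\<eta> \<in> dual scale" for \<zeta> \<eta>
    using that(1) unfolding tensor_null_def
  proof (rule free.span_induct)
    show "free.subspace {u. pairing u \<zeta> \<eta> = 0}"
      by (auto simp: free.subspace_def pairing_linear)
  qed (use that in \<open>auto simp: pairing_linear dual_simps distrib_left distrib_right\<close>)
next
  interpret free: vector_space "free_scale :: 'k \<Rightarrow> ('a, 'k) tensor \<Rightarrow> ('a, 'k) tensor"
    by (rule vector_space_free_scale)
  assume zero: "\<forall>\<zeta>\<in>dual scale. \<forall>\<eta>\<in>dual scale. pairing u \<zeta> \<eta> = 0"
  show "u \<in> tensor_null scale"
  proof (rule ccontr)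
    assume u: "u \<notin> tensor_null scale"
    from free.ex_separating_functional[OF u[unfolded tensor_null_def]]
    obtain F where lin: "Vector_Spaces.linear free_scale (*) F"
      and F_null: "\<forall>v\<in>tensor_null scale. F v = 0" and "F u \<noteq> 0"
      unfolding tensor_null_def[symmetric] by blast
    interpret F: Vector_Spaces.linear free_scale "(*)" F
      by (fact lin)
    define \<beta> where "\<beta> x y = F (free_gen (x, y))" for x y
    have "\<beta> (x + x') y = \<beta> x y + \<beta> x' y" for x x' y
    proof -
      have "free_gen (x + x', y) - free_gen (x, y) - free_gen (x', y) \<in> tensor_null scale"
        unfolding tensor_null_def by (rule free.span_base) blast
      from F_null[rule_format, OF this] show ?thesis
        by (simp add: \<beta>_def F.diff F.add diff_diff_eq)
    qed
    moreover have "\<beta> x (y + y') = \<beta> x y + \<beta> x y'" for x y y'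
    proof -
      have "free_gen (x, y + y') - free_gen (x, y) - free_gen (x, y') \<in> tensor_null scale"
        unfolding tensor_null_def by (rule free.span_base) blast
      from F_null[rule_format, OF this] show ?thesis
        by (simp add: \<beta>_def F.diff F.add diff_diff_eq)
    qed
    moreover have "\<beta> (scale c x) y = c * \<beta> x y" for c x y
    proof -
      have "free_gen (scale c x, y) - free_scale c (free_gen (x, y)) \<in> tensor_null scale"
        unfolding tensor_null_def by (rule free.span_base) blast
      from F_null[rule_format, OF this] show ?thesis
        by (simp add: \<beta>_def F.diff F.scale)
    qed
    moreover have "\<beta> x (scale c y) = c * \<beta> x y" for c x y
    proof -
      have "free_gen (x, scale c y) - free_scale c (free_gen (x, y)) \<in> tensor_null scale"
        unfolding tensor_null_def by (rule free.span_base) blast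
      from F_null[rule_format, OF this] show ?thesis
        by (simp add: \<beta>_def F.diff F.scale)
    qed
    ultimately have \<beta>_dual: "\<beta> x \<in> dual scale" "(\<lambda>x. \<beta> x y) \<in> dual scale" for x y
      by (auto intro!: dualI vector_space_axioms)
    obtain B and coord :: "'a \<Rightarrow> 'a \<Rightarrow> 'k" where dual: "\<And>b. coord b \<in> dual scale"
      and expand: "\<And>\<zeta> x. \<zeta> \<in> dual scale \<Longrightarrow> \<zeta> x = (\<Sum>b\<in>B. \<zeta> b * coord b x)"
      using ex_dual_basis by metis
    have \<beta>_expand: "\<beta> x y = (\<Sum>b\<in>B. \<Sum>b'\<in>B. \<beta> b b' * (coord b x * coord b' y))" for x y
    proof -
      have "\<beta> x y = (\<Sum>b\<in>B. \<beta> b y * coord b x)"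
        by (rule expand[OF \<beta>_dual(2)])
      also have "\<dots> = (\<Sum>b\<in>B. (\<Sum>b'\<in>B. \<beta> b b' * coord b' y) * coord b x)"
        by (simp only: expand[OF \<beta>_dual(1), symmetric])
      finally show ?thesis
        by (simp only: sum_distrib_left sum_distrib_right mult_ac)
    qed
    \<comment> \<open>Expanding \<open>\<beta>\<close> and exchanging sums, the inner sum over the support of \<open>u\<close> is a pairing.\<close>
    have "F u = (\<Sum>p\<in>Poly_Mapping.keys u. Poly_Mapping.lookup u p * \<beta> (fst p) (snd p))"
      by (subst free_expansion) (simp add: F.sum F.scale \<beta>_def)
    also have "\<dots> = (\<Sum>p\<in>Poly_Mapping.keys u. \<Sum>b\<in>B. \<Sum>b'\<in>B.
        Poly_Mapping.lookup u p * (\<beta> b b' * (coord b (fst p) * coord b' (snd p))))"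
      by (simp only: \<beta>_expand[of "fst _"] sum_distrib_left)
    also have "\<dots> = (\<Sum>b\<in>B. \<Sum>b'\<in>B. \<beta> b b' * pairing u (coord b) (coord b'))"
      by (simp only: sum.swap[of _ _ "Poly_Mapping.keys u"] pairing_def sum_distrib_left mult_ac)
    also have "\<dots> = 0"
      using zero dual by simp
    finally show False
      using \<open>F u \<noteq> 0\<close> by simp
  qed
qed

text \<open>
  The same argument with a trilinear form.
\<close>

lemma tensor3_null_iff:
  "u \<in> tensor3_null scale \<longleftrightarrow>
     (\<forall>\<zeta>\<in>dual scale. \<forall>\<eta>\<in>dual scale. \<forall>\<theta>\<in>dual scale. pairing3 u \<zeta> \<eta> \<theta> = 0)"
proof (intro iffI ballI)
  interpret free: vector_space "free_scale :: 'k \<Rightarrow> ('a, 'k) tensor3 \<Rightarrow> ('a, 'k) tensor3"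
    by (rule vector_space_free_scale)
  show "pairing3 u \<zeta> \<eta> \<theta> = 0"
    if "u \<in> tensor3_null scale" "\<zeta> \<in> dual scale" "\<eta> \<in> dual scale" "\<theta> \<in> dual scale" for \<zeta> \<eta> \<theta>
    using that(1) unfolding tensor3_null_def
  proof (rule free.span_induct)
    show "free.subspace {u. pairing3 u \<zeta> \<eta> \<theta> = 0}"
      by (auto simp: free.subspace_def pairing3_linear)
  qed (use that in \<open>auto simp: pairing3_linear dual_simps distrib_left distrib_right\<close>)
next
  interpret free: vector_space "free_scale :: 'k \<Rightarrow> ('a, 'k) tensor3 \<Rightarrow> ('a, 'k) tensor3"
    by (rule vector_space_free_scale)
  assume zero: "\<forall>\<zeta>\<in>dual scale. \<forall>\<eta>\<in>dual scale. \<forall>\<theta>\<in>dual scale. pairing3 u \<zeta> \<eta> \<theta> = 0"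
  show "u \<in> tensor3_null scale"
  proof (rule ccontr)
    assume u: "u \<notin> tensor3_null scale"
    from free.ex_separating_functional[OF u[unfolded tensor3_null_def]]
    obtain F where lin: "Vector_Spaces.linear free_scale (*) F"
      and F_null: "\<forall>v\<in>tensor3_null scale. F v = 0" and "F u \<noteq> 0"
      unfolding tensor3_null_def[symmetric] by blast
    interpret F: Vector_Spaces.linear free_scale "(*)" F
      by (fact lin)
    define \<beta> where "\<beta> x y z = F (free_gen (x, y, z))" for x y z
    have "\<beta> (x + x') y z = \<beta> x y z + \<beta> x' y z" for x x' y z
    proof -
      have "free_gen (x + x', y, z) - free_gen (x, y, z) - free_gen (x', y, z) \<in> tensor3_null scale"
        unfolding tensor3_null_def by (rule free.span_base, simp only: Un_iff mem_Collect_eq) fast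
      from F_null[rule_format, OF this] show ?thesis
        by (simp add: \<beta>_def F.diff F.add diff_diff_eq)
    qed
    moreover have "\<beta> x (y + y') z = \<beta> x y z + \<beta> x y' z" for x y y' z
    proof -
      have "free_gen (x, y + y', z) - free_gen (x, y, z) - free_gen (x, y', z) \<in> tensor3_null scale"
        unfolding tensor3_null_def by (rule free.span_base, simp only: Un_iff mem_Collect_eq) fast
      from F_null[rule_format, OF this] show ?thesis
        by (simp add: \<beta>_def F.diff F.add diff_diff_eq)
    qed
    moreover have "\<beta> x y (z + z') = \<beta> x y z + \<beta> x y z'" for x y z z'
    proof -
      have "free_gen (x, y, z + z') - free_gen (x, y, z) - free_gen (x, y, z') \<in> tensor3_null scale"
        unfolding tensor3_null_def by (rule free.span_base, simp only: Un_iff mem_Collect_eq) fast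
      from F_null[rule_format, OF this] show ?thesis
        by (simp add: \<beta>_def F.diff F.add diff_diff_eq)
    qed
    moreover have "\<beta> (scale c x) y z = c * \<beta> x y z" for c x y z
    proof -
      have "free_gen (scale c x, y, z) - free_scale c (free_gen (x, y, z)) \<in> tensor3_null scale"
        unfolding tensor3_null_def by (rule free.span_base, simp only: Un_iff mem_Collect_eq) fast
      from F_null[rule_format, OF this] show ?thesis
        by (simp add: \<beta>_def F.diff F.scale)
    qed
    moreover have "\<beta> x (scale c y) z = c * \<beta> x y z" for c x y z
    proof -
      have "free_gen (x, scale c y, z) - free_scale c (free_gen (x, y, z)) \<in> tensor3_null scale"
        unfolding tensor3_null_def by (rule free.span_base, simp only: Un_iff mem_Collect_eq) fast
      from F_null[rule_format, OF this] show ?thesis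
        by (simp add: \<beta>_def F.diff F.scale)
    qed
    moreover have "\<beta> x y (scale c z) = c * \<beta> x y z" for c x y z
    proof -
      have "free_gen (x, y, scale c z) - free_scale c (free_gen (x, y, z)) \<in> tensor3_null scale"
        unfolding tensor3_null_def by (rule free.span_base, simp only: Un_iff mem_Collect_eq) fast
      from F_null[rule_format, OF this] show ?thesis
        by (simp add: \<beta>_def F.diff F.scale)
    qed
    ultimately have \<beta>_dual: "\<beta> x y \<in> dual scale" "(\<lambda>y. \<beta> x y z) \<in> dual scale"
      "(\<lambda>x. \<beta> x y z) \<in> dual scale" for x y z
      by (auto intro!: dualI vector_space_axioms)
    obtain B and coord :: "'a \<Rightarrow> 'a \<Rightarrow> 'k" where dual: "\<And>b. coord b \<in> dual scale"
      and expand: "\<And>\<zeta> x. \<zeta> \<in> dual scale \<Longrightarrow> \<zeta> x = (\<Sum>b\<in>B. \<zeta> b * coord b x)"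
      using ex_dual_basis by metis
    have \<beta>_expand: "\<beta> x y z =
        (\<Sum>b\<in>B. \<Sum>b'\<in>B. \<Sum>b''\<in>B. \<beta> b b' b'' * (coord b x * coord b' y * coord b'' z))" for x y z
    proof -
      have "\<beta> x y z = (\<Sum>b\<in>B. \<beta> b y z * coord b x)"
        by (rule expand[OF \<beta>_dual(3)])
      also have "\<dots> = (\<Sum>b\<in>B. (\<Sum>b'\<in>B. \<beta> b b' z * coord b' y) * coord b x)"
        by (simp only: expand[OF \<beta>_dual(2), symmetric])
      also have "\<dots> = (\<Sum>b\<in>B. (\<Sum>b'\<in>B. (\<Sum>b''\<in>B. \<beta> b b' b'' * coord b'' z) * coord b' y) * coord b x)"
        by (simp only: expand[OF \<beta>_dual(1), symmetric])
      finally show ?thesis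
        by (simp only: sum_distrib_left sum_distrib_right mult_ac)
    qed
    have "F u = (\<Sum>p\<in>Poly_Mapping.keys u.
        Poly_Mapping.lookup u p * \<beta> (fst p) (fst (snd p)) (snd (snd p)))"
      by (subst free_expansion) (simp add: F.sum F.scale \<beta>_def)
    also have "\<dots> = (\<Sum>p\<in>Poly_Mapping.keys u. \<Sum>b\<in>B. \<Sum>b'\<in>B. \<Sum>b''\<in>B. Poly_Mapping.lookup u p *
        (\<beta> b b' b'' * (coord b (fst p) * coord b' (fst (snd p)) * coord b'' (snd (snd p)))))"
      by (simp only: \<beta>_expand[of "fst _"] sum_distrib_left)
    also have "\<dots> = (\<Sum>b\<in>B. \<Sum>b'\<in>B. \<Sum>b''\<in>B.
        \<beta> b b' b'' * pairing3 u (coord b) (coord b') (coord b''))"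
      by (simp only: sum.swap[of _ _ "Poly_Mapping.keys u"] pairing3_def free_lift_def
          case_prod_unfold sum_distrib_left mult_ac)
    also have "\<dots> = 0"
      using zero dual by simp
    finally show False
      using \<open>F u \<noteq> 0\<close> by simp
  qed
qed

lemma tensor_eq_iff:
  "s \<approx> t \<longleftrightarrow> (\<forall>\<zeta>\<in>dual scale. \<forall>\<eta>\<in>dual scale. pairing s \<zeta> \<eta> = pairing t \<zeta> \<eta>)"
  by (simp add: tensor_eq_def tensor_null_iff pairing_diff)

lemma tensor3_eq_iff:
  "tensor3_eq s t \<longleftrightarrow>
     (\<forall>\<zeta>\<in>dual scale. \<forall>\<eta>\<in>dual scale. \<forall>\<theta>\<in>dual scale. pairing3 s \<zeta> \<eta> \<theta> = pairing3 t \<zeta> \<eta> \<theta>)"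
  by (simp add: tensor3_eq_def tensor3_null_iff pairing3_diff)

end

section \<open>From anti-pre-Poisson algebras to Poisson algebras\<close>

context fd_space
begin

lemma
  shows V_0: "0 \<in> V"
    and V_add: "x \<in> V \<Longrightarrow> y \<in> V \<Longrightarrow> x + y \<in> V"
    and V_scale: "x \<in> V \<Longrightarrow> scale c x \<in> V"
    and V_uminus: "x \<in> V \<Longrightarrow> - x \<in> V"
    and V_diff: "x \<in> V \<Longrightarrow> y \<in> V \<Longrightarrow> x - y \<in> V"
  using finite_dim by (auto simp: span_zero span_add span_scale span_neg span_diff)

lemmas V_closed = V_0 V_add V_scale V_uminus V_diff

end

context fd_algebra
begin

lemma
  assumes "x \<in> V" "y \<in> V"
  shows mult_uminus_left: "mult (- x) y = - mult x y"
    and mult_uminus_right: "mult x (- y) = - mult x y"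
  using mult_scale_left[OF assms, of "- 1"] mult_scale_right[OF assms, of "- 1"] by simp_all

lemma
  assumes "x \<in> V" "y \<in> V" "z \<in> V"
  shows mult_diff_left: "mult (x - y) z = mult x z - mult y z"
    and mult_diff_right: "mult x (y - z) = mult x y - mult x z"
  using mult_add_left[of x "- y" z] mult_add_right[of x y "- z"] assms
  by (simp_all add: mult_uminus_left mult_uminus_right V_closed)

lemma
  assumes "x \<in> V"
  shows mult_0_left: "mult 0 x = 0" and mult_0_right: "mult x 0 = 0"
  using mult_scale_left[OF assms assms, of 0] mult_scale_right[OF assms assms, of 0] by simp_all

lemmas mult_linear = mult_closed mult_add_left mult_add_right mult_scale_left mult_scale_right
  mult_uminus_left mult_uminus_right mult_diff_left mult_diff_right mult_0_left mult_0_right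

end

context anti_pre_poisson
begin

lemmas ast_linear = fd_algebra.mult_linear[OF anti_zinbiel.axioms(1)[OF anti_zinbiel_axioms]]
lemmas circ_linear = fd_algebra.mult_linear[OF anti_pre_lie.axioms(1)[OF anti_pre_lie_axioms]]

lemmas bilinear_simps = ast_linear circ_linear V_closed symmetrized_def commutator_def

lemma star_ast:
  "x \<in> V \<Longrightarrow> y \<in> V \<Longrightarrow> z \<in> V \<Longrightarrow> symmetrized (\<ast>) x y \<ast> z = - (x \<ast> (y \<ast> z))"
  by (simp add: zinbiel_1 symmetrized_def)

text \<open>
  The word \<open>x \<ast> (y \<ast> z)\<close> is symmetric in its three arguments, and both bracketings of the
  symmetrized product are equal to it: of the three copies that arise, one is cancelled by
  \<open>(x \<star> y) \<ast> z = - x \<ast> (y \<ast> z)\<close>.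
\<close>

lemma star_star:
  assumes "x \<in> V" "y \<in> V" "z \<in> V"
  shows "symmetrized (\<ast>) x (symmetrized (\<ast>) y z) = x \<ast> (y \<ast> z)"
    and "symmetrized (\<ast>) (symmetrized (\<ast>) x y) z = x \<ast> (y \<ast> z)"
proof -
  have "symmetrized (\<ast>) u (symmetrized (\<ast>) v w) = u \<ast> (v \<ast> w)"
    if "u \<in> V" "v \<in> V" "w \<in> V" for u v w
  proof -
    have "symmetrized (\<ast>) u (symmetrized (\<ast>) v w)
        = u \<ast> (v \<ast> w) + u \<ast> (w \<ast> v) + symmetrized (\<ast>) v w \<ast> u"
      using that by (simp add: bilinear_simps)
    also have "\<dots> = u \<ast> (v \<ast> w) + u \<ast> (w \<ast> v) - v \<ast> (w \<ast> u)"
      using that by (simp add: star_ast)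
    also have "v \<ast> (w \<ast> u) = u \<ast> (w \<ast> v)"
      using that by (metis zinbiel_3)
    finally show ?thesis
      by simp
  qed
  moreover have "z \<ast> (x \<ast> y) = x \<ast> (y \<ast> z)"
    using assms by (metis zinbiel_3 zinbiel_4)
  ultimately show "symmetrized (\<ast>) x (symmetrized (\<ast>) y z) = x \<ast> (y \<ast> z)"
    "symmetrized (\<ast>) (symmetrized (\<ast>) x y) z = x \<ast> (y \<ast> z)"
    using assms by (simp_all add: symmetrized_def add.commute)
qed

text \<open>
  The words \<open>x \<circ> (y \<circ> z)\<close> in the Jacobi sum collapse in pairs by the first identity; what is left are
  cyclic sums of words \<open>[x, y] \<circ> z\<close>, which vanish by the second.
\<close>

lemma commutator_jacobi:
  assumes "x \<in> V" "y \<in> V" "z \<in> V"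
  shows "commutator (\<odot>) x (commutator (\<odot>) y z) + commutator (\<odot>) y (commutator (\<odot>) z x)
    + commutator (\<odot>) z (commutator (\<odot>) x y) = 0"
proof -
  have "commutator (\<odot>) x (commutator (\<odot>) y z) + commutator (\<odot>) y (commutator (\<odot>) z x)
      + commutator (\<odot>) z (commutator (\<odot>) x y)
    = (x \<odot> (y \<odot> z) - y \<odot> (x \<odot> z)) + (y \<odot> (z \<odot> x) - z \<odot> (y \<odot> x)) + (z \<odot> (x \<odot> y) - x \<odot> (z \<odot> y))
      - (commutator (\<odot>) x y \<odot> z + commutator (\<odot>) y z \<odot> x + commutator (\<odot>) z x \<odot> y)"
    using assms by (simp add: bilinear_simps algebra_simps)
  also have "\<dots> = (commutator (\<odot>) y x \<odot> z + commutator (\<odot>) z y \<odot> x + commutator (\<odot>) x z \<odot> y)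
      - (commutator (\<odot>) x y \<odot> z + commutator (\<odot>) y z \<odot> x + commutator (\<odot>) z x \<odot> y)"
    using assms by (simp only: anti_pre_lie_1)
  also have "\<dots> = 0"
    using assms anti_pre_lie_2[of x y z] anti_pre_lie_2[of z y x] by (simp add: add_ac)
  finally show ?thesis .
qed

text \<open>
  The difference of the two sides is a sum of differences of the compatibility identities; the
  third one is used twice.
\<close>

lemma commutator_leibniz:
  assumes "x \<in> V" "y \<in> V" "z \<in> V"
  shows "commutator (\<odot>) x (symmetrized (\<ast>) y z)
    = symmetrized (\<ast>) (commutator (\<odot>) x y) z + symmetrized (\<ast>) y (commutator (\<odot>) x z)"
proof -
  have "commutator (\<odot>) x (symmetrized (\<ast>) y z)
      - (symmetrized (\<ast>) (commutator (\<odot>) x y) z + symmetrized (\<ast>) y (commutator (\<odot>) x z))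
    = (x \<odot> (y \<ast> z + z \<ast> y) + y \<ast> (z \<odot> x) + z \<ast> (y \<odot> x) - (y \<ast> (x \<odot> z) + z \<ast> (x \<odot> y)))
      - ((y \<ast> z + z \<ast> y) \<odot> x - (- (y \<ast> (z \<odot> x)) - z \<ast> (y \<odot> x)))
      - ((x \<odot> y - y \<odot> x) \<ast> z - (y \<ast> (x \<odot> z) - x \<odot> (y \<ast> z)))
      - ((x \<odot> z - z \<odot> x) \<ast> y - (z \<ast> (x \<odot> y) - x \<odot> (z \<ast> y)))
      + (x \<odot> (y \<ast> z + z \<ast> y) + y \<ast> (z \<odot> x) + z \<ast> (y \<odot> x) - (y \<ast> (x \<odot> z) + z \<ast> (x \<odot> y)))"
    using assms by (simp add: bilinear_simps algebra_simps)
  also have "\<dots> = 0"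
    using assms by (simp only: compat_1 compat_2 compat_3) (simp add: bilinear_simps algebra_simps)
  finally show ?thesis
    by simp
qed

lemma poisson_symmetrized_commutator: "poisson scale V (symmetrized (\<ast>)) (commutator (\<odot>))"
proof unfold_locales
  fix x y z assume V: "x \<in> V" "y \<in> V" "z \<in> V"
  show "symmetrized (\<ast>) (symmetrized (\<ast>) x y) z = symmetrized (\<ast>) x (symmetrized (\<ast>) y z)"
    using V by (simp add: star_star)
  show "commutator (\<odot>) x (commutator (\<odot>) y z) + commutator (\<odot>) y (commutator (\<odot>) z x)
      + commutator (\<odot>) z (commutator (\<odot>) x y) = 0"
    using V by (rule commutator_jacobi)
  show "commutator (\<odot>) x (symmetrized (\<ast>) y z)
      = symmetrized (\<ast>) (commutator (\<odot>) x y) z + symmetrized (\<ast>) y (commutator (\<odot>) x z)"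
    using V by (rule commutator_leibniz)
qed (simp_all add: bilinear_simps algebra_simps scale_right_diff_distrib)

end

text \<open>
  Identities pass to a subalgebra, here along an injective homomorphism \<open>\<phi>\<close>; bilinearity of
  the operations is among them.
\<close>

lemma anti_pre_poisson_pullback:
  assumes alg: "anti_pre_poisson s' W m' c'" and fd: "fd_space s V"
    and closed: "\<And>x y. x \<in> V \<Longrightarrow> y \<in> V \<Longrightarrow> m x y \<in> V" "\<And>x y. x \<in> V \<Longrightarrow> y \<in> V \<Longrightarrow> c x y \<in> V"
    and inj: "inj_on \<phi> V" and image: "\<And>x. x \<in> V \<Longrightarrow> \<phi> x \<in> W"
    and add: "\<And>x y. x \<in> V \<Longrightarrow> y \<in> V \<Longrightarrow> \<phi> (x + y) = \<phi> x + \<phi> y"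
    and scale: "\<And>a x. x \<in> V \<Longrightarrow> \<phi> (s a x) = s' a (\<phi> x)"
    and m: "\<And>x y. x \<in> V \<Longrightarrow> y \<in> V \<Longrightarrow> \<phi> (m x y) = m' (\<phi> x) (\<phi> y)"
    and c: "\<And>x y. x \<in> V \<Longrightarrow> y \<in> V \<Longrightarrow> \<phi> (c x y) = c' (\<phi> x) (\<phi> y)"
  shows "anti_pre_poisson s V m c"
proof -
  interpret V: fd_space s V by (fact fd)
  interpret W: anti_pre_poisson s' W m' c' by (fact alg)
  have \<phi>0: "\<phi> 0 = 0"
    using add[of 0 0] V.V_0 by simp
  have neg: "\<phi> (- x) = - \<phi> x" if "x \<in> V" for x
    using add[of x "- x"] that by (simp add: V.V_closed \<phi>0 eq_neg_iff_add_eq_0 add.commute)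
  have diff: "\<phi> (x - y) = \<phi> x - \<phi> y" if "x \<in> V" "y \<in> V" for x y
    using add[of x "- y"] that by (simp add: V.V_closed neg)
  have eqI: "x = y" if "\<phi> x = \<phi> y" "x \<in> V" "y \<in> V" for x y
    using inj_onD[OF inj] that by blast
  note simps = closed V.V_closed image add scale m c \<phi>0 neg diff commutator_def
    W.ast_linear W.circ_linear
  show ?thesis
  proof unfold_locales
    fix x y z assume V: "x \<in> V" "y \<in> V" "z \<in> V"
    note W = V[THEN image]
    show "m x (m y z) = - m (m x y + m y x) z"
      using W.zinbiel_1[OF W] V by (intro eqI) (simp_all add: simps)
    show "m x (m y z) = - m (m y z + m z y) x"
      using W.zinbiel_2[OF W] V by (intro eqI) (simp_all add: simps)
    show "m x (m y z) = m z (m y x)"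
      using W.zinbiel_3[OF W] V by (intro eqI) (simp_all add: simps)
    show "m z (m x y) = m x (m z y)"
      using W.zinbiel_4[OF W] V by (intro eqI) (simp_all add: simps)
    show "c x (c y z) - c y (c x z) = c (commutator c y x) z"
      using W.anti_pre_lie_1[OF W] V by (intro eqI) (simp_all add: simps)
    show "c (commutator c x y) z + c (commutator c y z) x + c (commutator c z x) y = 0"
      using W.anti_pre_lie_2[OF W] V by (intro eqI) (simp_all add: simps)
    show "m (c x y - c y x) z = m y (c x z) - c x (m y z)"
      using W.compat_1[OF W] V by (intro eqI) (simp_all add: simps)
    show "c (m x y + m y x) z = - m x (c y z) - m y (c x z)"
      using W.compat_2[OF W] V by (intro eqI) (simp_all add: simps)
    show "c z (m x y + m y x) + m x (c y z) + m y (c x z) = m x (c z y) + m y (c z x)"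
      using W.compat_3[OF W] V by (intro eqI) (simp_all add: simps)
  qed (auto intro!: eqI simp: simps)
qed

text \<open>
  On \<open>A \<oplus> A\<^sup>*\<close> the symmetrized operations and those built from \<open>L\<^sub>\<ast>\<^sup>*\<close>, \<open>L\<^sub>\<circ>\<^sup>*\<close> agree only on linear
  functionals, that is, on the carrier and not on the whole type.
\<close>

lemma poisson_cong:
  assumes "poisson s V m c"
    and "\<And>x y. x \<in> V \<Longrightarrow> y \<in> V \<Longrightarrow> m' x y = m x y" "\<And>x y. x \<in> V \<Longrightarrow> y \<in> V \<Longrightarrow> c' x y = c x y"
  shows "poisson s V m' c'"
proof -
  interpret poisson s V m c by fact
  note [simp] = assms(2,3) prod.mult_linear lie.mult_linear prod.V_closed
  show ?thesis
  proof unfold_locales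
    show "m' x y = m' y x" if "x \<in> V" "y \<in> V" for x y
      using that by (simp add: star_commute)
  qed (simp_all add: star_assoc br_alternating br_jacobi leibniz)
qed

section \<open>The coadjoint actions on the dual space\<close>

lemma vector_space_dual_scale: "vector_space dual_scale"
  by unfold_locales (auto simp: dual_scale_def fun_eq_iff algebra_simps)

lemma sum_fun_apply: "(\<Sum>i\<in>I. f i) x = (\<Sum>i\<in>I. f i x)"
  by (induction I rule: infinite_finite_induct) simp_all

lemma vector_space_sum_scale:
  assumes "vector_space s1" "vector_space s2"
  shows "vector_space (sum_scale s1 s2)"
proof -
  interpret s1: vector_space s1 by fact
  interpret s2: vector_space s2 by fact
  show ?thesis
    by unfold_locales
      (auto simp: sum_scale_def s1.scale_left_distrib s1.scale_right_distrib
        s2.scale_left_distrib s2.scale_right_distrib)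
qed

lemma fd_space_sum:
  assumes "fd_space s1 V1" "fd_space s2 V2"
  shows "fd_space (sum_scale s1 s2) (V1 \<times> V2)"
proof -
  interpret s1: fd_space s1 V1 by fact
  interpret s2: fd_space s2 V2 by fact
  interpret s: vector_space "sum_scale s1 s2"
    by (rule vector_space_sum_scale) unfold_locales
  have sum_scale_Pair: "sum_scale s1 s2 c (x, y) = (s1 c x, s2 c y)" for c x y
    by (simp add: sum_scale_def)
  obtain B1 B2 where B: "finite B1" "s1.span B1 = V1" "finite B2" "s2.span B2 = V2"
    using s1.finite_dim s2.finite_dim by blast
  let ?B = "(\<lambda>b. (b, 0)) ` B1 \<union> (\<lambda>b. (0, b)) ` B2"
  have "(x, 0) \<in> s.span ?B" if "x \<in> V1" for x
    using that unfolding B(2)[symmetric]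
  proof (induction rule: s1.span_induct)
    case base
    show ?case
      using s.span_add[of "(x, 0)" ?B "(y, 0)" for x y] s.span_scale[of "(x, 0)" ?B for x]
        s.span_zero[of ?B]
      by (auto simp: s1.subspace_def sum_scale_Pair zero_prod_def)
  next
    case (step b)
    then show ?case
      by (auto intro: s.span_base)
  qed
  moreover have "(0, x) \<in> s.span ?B" if "x \<in> V2" for x
    using that unfolding B(4)[symmetric]
  proof (induction rule: s2.span_induct)
    case base
    show ?case
      using s.span_add[of "(0, x)" ?B "(0, y)" for x y] s.span_scale[of "(0, x)" ?B for x]
        s.span_zero[of ?B]
      by (auto simp: s2.subspace_def sum_scale_Pair zero_prod_def)
  next
    case (step b)
    then show ?case
      by (auto intro: s.span_base)
  qed
  ultimately have "V1 \<times> V2 \<subseteq> s.span ?B"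
    using s.span_add by fastforce
  moreover have "s.span ?B \<subseteq> V1 \<times> V2"
  proof (rule s.span_minimal)
    show "?B \<subseteq> V1 \<times> V2"
      using B s1.span_base s2.span_base s1.V_0 s2.V_0 by auto
    show "s.subspace (V1 \<times> V2)"
      by (auto simp: s.subspace_def sum_scale_def s1.V_closed s2.V_closed zero_prod_def)
  qed
  ultimately have "finite ?B \<and> s.span ?B = V1 \<times> V2"
    using B by auto
  then show ?thesis
    by unfold_locales blast
qed

context fd_total
begin

lemma subspace_dual: "module.subspace dual_scale (dual scale)"
proof -
  interpret dual: vector_space "dual_scale :: 'k \<Rightarrow> ('a \<Rightarrow> 'k) \<Rightarrow> _"
    by (rule vector_space_dual_scale)
  show ?thesis
    by (auto simp: dual.subspace_def dual_scale_def dual_simps algebra_simps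
        intro!: dualI vector_space_axioms)
qed

lemma fd_space_dual: "fd_space dual_scale (dual scale)"
proof -
  interpret dual: vector_space "dual_scale :: 'k \<Rightarrow> ('a \<Rightarrow> 'k) \<Rightarrow> _"
    by (rule vector_space_dual_scale)
  obtain B and coord :: "'a \<Rightarrow> 'a \<Rightarrow> 'k" where B: "finite B" "\<And>b. coord b \<in> dual scale"
    "\<And>\<zeta> x. \<zeta> \<in> dual scale \<Longrightarrow> \<zeta> x = (\<Sum>b\<in>B. \<zeta> b * coord b x)"
    using ex_dual_basis by metis
  have "\<zeta> \<in> dual.span (coord ` B)" if "\<zeta> \<in> dual scale" for \<zeta>
  proof -
    have "\<zeta> = (\<Sum>b\<in>B. dual_scale (\<zeta> b) (coord b))"
      by (simp add: fun_eq_iff sum_fun_apply dual_scale_def B(3)[OF that, symmetric])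
    also have "\<dots> \<in> dual.span (coord ` B)"
      by (intro dual.span_sum dual.span_scale dual.span_base) auto
    finally show ?thesis .
  qed
  moreover have "dual.span (coord ` B) \<subseteq> dual scale"
    using B(2) subspace_dual by (intro dual.span_minimal) auto
  ultimately have "finite (coord ` B) \<and> dual.span (coord ` B) = dual scale"
    using B(1) by auto
  then show ?thesis
    by unfold_locales blast
qed

text \<open>
  The definite description denotes the contraction of \<open>s\<close> with \<open>\<zeta>\<close>; it is unique because
  functionals separate points. All later facts on tensor operators are derived from this one.
\<close>

lemma dual_tensor_operator:
  assumes "\<eta> \<in> dual scale"
  shows "\<eta> (tensor_operator scale s \<zeta>) = pairing s \<zeta> \<eta>"
proof -
  let ?x = "\<Sum>p\<in>Poly_Mapping.keys s. scale (Poly_Mapping.lookup s p * \<zeta> (fst p)) (snd p)"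
  have x: "\<forall>\<eta>\<in>dual scale. \<eta> ?x = pairing s \<zeta> \<eta>"
    by (simp add: dual_sum dual_scale pairing_def mult.assoc)
  have "tensor_operator scale s \<zeta> = ?x"
    unfolding tensor_operator_def
  proof (rule the_equality)
    show "\<forall>\<eta>\<in>dual scale. \<eta> ?x = pairing s \<zeta> \<eta>"
      by (fact x)
    fix y assume y: "\<forall>\<eta>\<in>dual scale. \<eta> y = pairing s \<zeta> \<eta>"
    show "y = ?x"
      by (rule dual_eqI) (simp only: bspec[OF x] bspec[OF y])
  qed
  then show ?thesis
    using x assms by simp
qed

lemma tensor_operator_linear:
  shows "tensor_operator scale s (\<zeta> + \<eta>) = tensor_operator scale s \<zeta> + tensor_operator scale s \<eta>"
    and "tensor_operator scale s (dual_scale c \<zeta>) = scale c (tensor_operator scale s \<zeta>)"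
  by (rule dual_eqI, simp add: dual_tensor_operator dual_simps pairing_args plus_fun_def
    dual_scale_def)+

lemma tensor_operator_add:
  "tensor_operator scale (s + t) \<zeta> = tensor_operator scale s \<zeta> + tensor_operator scale t \<zeta>"
  by (rule dual_eqI) (simp add: dual_tensor_operator dual_simps pairing_add)

end

locale total_anti_pre_poisson = anti_pre_poisson scale UNIV ast circ
  for scale :: "'k::field \<Rightarrow> 'a::ab_group_add \<Rightarrow> 'a"
    and ast (infixl \<open>\<ast>\<close> 70) and circ (infixl \<open>\<odot>\<close> 70)
begin

sublocale fd_total scale
  by unfold_locales

abbreviation star (infixl \<open>\<star>\<close> 70) where "x \<star> y \<equiv> symmetrized (\<ast>) x y"
abbreviation bracket (\<open>\<lbrakk>_, _\<rbrakk>\<close>) where "\<lbrakk>x, y\<rbrakk> \<equiv> commutator (\<odot>) x y"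

text \<open>
  The four actions of \<open>A\<close> on its dual from which the semidirect sum is built: \<open>L\<^sub>\<star>\<^sup>*\<close> and \<open>-R\<^sub>\<ast>\<^sup>*\<close> are
  the left and right actions for \<open>\<ast>\<close>, and \<open>-ad\<^sup>*\<close> and \<open>R\<^sub>\<circ>\<^sup>*\<close> those for \<open>\<circ>\<close>. They are constants so that
  the simplifier keeps their signs in place.
\<close>

definition star_coact :: "'a \<Rightarrow> ('a \<Rightarrow> 'k) \<Rightarrow> ('a \<Rightarrow> 'k)" where
  "star_coact = dual_rep (symmetrized (\<ast>))"
definition ast_coact :: "'a \<Rightarrow> ('a \<Rightarrow> 'k) \<Rightarrow> ('a \<Rightarrow> 'k)" where
  "ast_coact = (\<lambda>x \<zeta>. - dual_rep (\<lambda>y z. z \<ast> y) x \<zeta>)"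
definition ad_coact :: "'a \<Rightarrow> ('a \<Rightarrow> 'k) \<Rightarrow> ('a \<Rightarrow> 'k)" where
  "ad_coact = (\<lambda>x \<zeta>. - dual_rep (commutator (\<odot>)) x \<zeta>)"
definition circ_coact :: "'a \<Rightarrow> ('a \<Rightarrow> 'k) \<Rightarrow> ('a \<Rightarrow> 'k)" where "circ_coact = dual_rep (\<lambda>y z. z \<odot> y)"

lemma coact_apply:
  "star_coact x \<zeta> w = - \<zeta> (x \<star> w)" "ast_coact x \<zeta> w = \<zeta> (w \<ast> x)"
  "ad_coact x \<zeta> w = \<zeta> \<lbrakk>x, w\<rbrakk>" "circ_coact x \<zeta> w = - \<zeta> (w \<odot> x)"
  by (simp_all add: star_coact_def ast_coact_def ad_coact_def circ_coact_def dual_rep_def)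

lemma dual_comp_mult:
  assumes "\<zeta> \<in> dual scale"
  shows "(\<lambda>z. \<zeta> (x \<ast> z)) \<in> dual scale" "(\<lambda>z. \<zeta> (z \<ast> x)) \<in> dual scale"
    "(\<lambda>z. \<zeta> (x \<odot> z)) \<in> dual scale" "(\<lambda>z. \<zeta> (z \<odot> x)) \<in> dual scale"
    "(\<lambda>z. \<zeta> (x \<star> z)) \<in> dual scale" "(\<lambda>z. \<zeta> \<lbrakk>x, z\<rbrakk>) \<in> dual scale"
  using assms
  by (auto intro!: dualI vector_space_axioms simp: bilinear_simps dual_simps algebra_simps)

sublocale dual: fd_space "dual_scale :: 'k \<Rightarrow> ('a \<Rightarrow> 'k) \<Rightarrow> _" "dual scale"
  by (rule fd_space_dual)

lemma coact_dual:
  assumes "\<zeta> \<in> dual scale"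
  shows "star_coact x \<zeta> \<in> dual scale" "ast_coact x \<zeta> \<in> dual scale" "ad_coact x \<zeta> \<in> dual scale"
    "circ_coact x \<zeta> \<in> dual scale"
  using dual_comp_mult[OF assms, of x] dual.V_uminus
  by (auto simp: star_coact_def ast_coact_def ad_coact_def circ_coact_def dual_rep_def
    fun_Compl_def)

lemma coact_linear:
  assumes "\<zeta> \<in> dual scale" "\<eta> \<in> dual scale"
  shows "star_coact x (\<zeta> + \<eta>) = star_coact x \<zeta> + star_coact x \<eta>"
    "ast_coact x (\<zeta> + \<eta>) = ast_coact x \<zeta> + ast_coact x \<eta>"
    "ad_coact x (\<zeta> + \<eta>) = ad_coact x \<zeta> + ad_coact x \<eta>"
    "circ_coact x (\<zeta> + \<eta>) = circ_coact x \<zeta> + circ_coact x \<eta>"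
    "star_coact x (dual_scale c \<zeta>) = dual_scale c (star_coact x \<zeta>)"
    "ast_coact x (dual_scale c \<zeta>) = dual_scale c (ast_coact x \<zeta>)"
    "ad_coact x (dual_scale c \<zeta>) = dual_scale c (ad_coact x \<zeta>)"
    "circ_coact x (dual_scale c \<zeta>) = dual_scale c (circ_coact x \<zeta>)"
    "star_coact (x + y) \<zeta> = star_coact x \<zeta> + star_coact y \<zeta>"
    "ast_coact (x + y) \<zeta> = ast_coact x \<zeta> + ast_coact y \<zeta>"
    "ad_coact (x + y) \<zeta> = ad_coact x \<zeta> + ad_coact y \<zeta>"
    "circ_coact (x + y) \<zeta> = circ_coact x \<zeta> + circ_coact y \<zeta>"
    "star_coact (scale c x) \<zeta> = dual_scale c (star_coact x \<zeta>)"
    "ast_coact (scale c x) \<zeta> = dual_scale c (ast_coact x \<zeta>)"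
    "ad_coact (scale c x) \<zeta> = dual_scale c (ad_coact x \<zeta>)"
    "circ_coact (scale c x) \<zeta> = dual_scale c (circ_coact x \<zeta>)"
  using assms
  by (auto simp: coact_apply fun_eq_iff dual_scale_def bilinear_simps dual_simps algebra_simps
      simp flip: scale_right_distrib scale_right_diff_distrib)

lemma coact_diff:
  assumes "\<zeta> \<in> dual scale" "\<eta> \<in> dual scale"
  shows "star_coact x (\<zeta> - \<eta>) = star_coact x \<zeta> - star_coact x \<eta>"
    "ast_coact x (\<zeta> - \<eta>) = ast_coact x \<zeta> - ast_coact x \<eta>"
    "ad_coact x (\<zeta> - \<eta>) = ad_coact x \<zeta> - ad_coact x \<eta>"
    "circ_coact x (\<zeta> - \<eta>) = circ_coact x \<zeta> - circ_coact x \<eta>"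
    "star_coact (x - y) \<zeta> = star_coact x \<zeta> - star_coact y \<zeta>"
    "ast_coact (x - y) \<zeta> = ast_coact x \<zeta> - ast_coact y \<zeta>"
    "ad_coact (x - y) \<zeta> = ad_coact x \<zeta> - ad_coact y \<zeta>"
    "circ_coact (x - y) \<zeta> = circ_coact x \<zeta> - circ_coact y \<zeta>"
  using assms
  by (auto simp: coact_apply fun_eq_iff bilinear_simps dual_simps algebra_simps)

text \<open>
  The next three lemmas list the identities of \<open>A\<close> in three letters as linear relations between the
  values of a functional on words. With these relations a consequence of the axioms that is dualized
  or paired with functionals is a question of linear algebra over the field, decided by
  \<open>algebra\<close>.
\<close>

lemma zinbiel_words:
  assumes "\<zeta> \<in> dual scale"
  shows "\<zeta> (x \<ast> y \<ast> z) + \<zeta> (y \<ast> x \<ast> z) + \<zeta> (x \<ast> (y \<ast> z)) = 0"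
    "\<zeta> (x \<ast> z \<ast> y) + \<zeta> (z \<ast> x \<ast> y) + \<zeta> (x \<ast> (y \<ast> z)) = 0"
    "\<zeta> (y \<ast> z \<ast> x) + \<zeta> (z \<ast> y \<ast> x) + \<zeta> (x \<ast> (y \<ast> z)) = 0"
    "\<zeta> (x \<ast> (z \<ast> y)) = \<zeta> (x \<ast> (y \<ast> z))" "\<zeta> (y \<ast> (x \<ast> z)) = \<zeta> (x \<ast> (y \<ast> z))"
    "\<zeta> (y \<ast> (z \<ast> x)) = \<zeta> (x \<ast> (y \<ast> z))" "\<zeta> (z \<ast> (x \<ast> y)) = \<zeta> (x \<ast> (y \<ast> z))"
    "\<zeta> (z \<ast> (y \<ast> x)) = \<zeta> (x \<ast> (y \<ast> z))"
proof -
  have sym: "x \<ast> (z \<ast> y) = x \<ast> (y \<ast> z)" "y \<ast> (x \<ast> z) = x \<ast> (y \<ast> z)" "y \<ast> (z \<ast> x) = x \<ast> (y \<ast> z)"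
    "z \<ast> (x \<ast> y) = x \<ast> (y \<ast> z)" "z \<ast> (y \<ast> x) = x \<ast> (y \<ast> z)"
    by (metis UNIV_I zinbiel_3 zinbiel_4)+
  then show "\<zeta> (x \<ast> (z \<ast> y)) = \<zeta> (x \<ast> (y \<ast> z))" "\<zeta> (y \<ast> (x \<ast> z)) = \<zeta> (x \<ast> (y \<ast> z))"
    "\<zeta> (y \<ast> (z \<ast> x)) = \<zeta> (x \<ast> (y \<ast> z))" "\<zeta> (z \<ast> (x \<ast> y)) = \<zeta> (x \<ast> (y \<ast> z))"
    "\<zeta> (z \<ast> (y \<ast> x)) = \<zeta> (x \<ast> (y \<ast> z))"
    by simp_all
  have "\<zeta> (a \<ast> b \<ast> c) + \<zeta> (b \<ast> a \<ast> c) + \<zeta> (a \<ast> (b \<ast> c)) = 0" for a b c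
    using arg_cong[OF zinbiel_1[of a b c], of \<zeta>] by (simp add: bilinear_simps dual_simps[OF assms])
  from this[of x y z] this[of x z y] this[of y z x]
  show "\<zeta> (x \<ast> y \<ast> z) + \<zeta> (y \<ast> x \<ast> z) + \<zeta> (x \<ast> (y \<ast> z)) = 0"
    "\<zeta> (x \<ast> z \<ast> y) + \<zeta> (z \<ast> x \<ast> y) + \<zeta> (x \<ast> (y \<ast> z)) = 0"
    "\<zeta> (y \<ast> z \<ast> x) + \<zeta> (z \<ast> y \<ast> x) + \<zeta> (x \<ast> (y \<ast> z)) = 0"
    by (simp_all add: sym)
qed

lemma lie_words:
  assumes "\<zeta> \<in> dual scale"
  shows "\<zeta> (x \<odot> (y \<odot> z)) - \<zeta> (y \<odot> (x \<odot> z)) = \<zeta> (y \<odot> x \<odot> z) - \<zeta> (x \<odot> y \<odot> z)"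
    "\<zeta> (x \<odot> (z \<odot> y)) - \<zeta> (z \<odot> (x \<odot> y)) = \<zeta> (z \<odot> x \<odot> y) - \<zeta> (x \<odot> z \<odot> y)"
    "\<zeta> (y \<odot> (z \<odot> x)) - \<zeta> (z \<odot> (y \<odot> x)) = \<zeta> (z \<odot> y \<odot> x) - \<zeta> (y \<odot> z \<odot> x)"
    "\<zeta> (x \<odot> y \<odot> z) - \<zeta> (y \<odot> x \<odot> z) + (\<zeta> (y \<odot> z \<odot> x) - \<zeta> (z \<odot> y \<odot> x))
      + (\<zeta> (z \<odot> x \<odot> y) - \<zeta> (x \<odot> z \<odot> y)) = 0"
proof -
  note simps = bilinear_simps dual_simps[OF assms]
  have 1: "\<zeta> (a \<odot> (b \<odot> c)) - \<zeta> (b \<odot> (a \<odot> c)) = \<zeta> (b \<odot> a \<odot> c) - \<zeta> (a \<odot> b \<odot> c)" for a b c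
    using arg_cong[OF anti_pre_lie_1[of a b c], of \<zeta>] by (simp add: simps)
  show "\<zeta> (x \<odot> (y \<odot> z)) - \<zeta> (y \<odot> (x \<odot> z)) = \<zeta> (y \<odot> x \<odot> z) - \<zeta> (x \<odot> y \<odot> z)"
    "\<zeta> (x \<odot> (z \<odot> y)) - \<zeta> (z \<odot> (x \<odot> y)) = \<zeta> (z \<odot> x \<odot> y) - \<zeta> (x \<odot> z \<odot> y)"
    "\<zeta> (y \<odot> (z \<odot> x)) - \<zeta> (z \<odot> (y \<odot> x)) = \<zeta> (z \<odot> y \<odot> x) - \<zeta> (y \<odot> z \<odot> x)"
    by (rule 1)+
  show "\<zeta> (x \<odot> y \<odot> z) - \<zeta> (y \<odot> x \<odot> z) + (\<zeta> (y \<odot> z \<odot> x) - \<zeta> (z \<odot> y \<odot> x))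
      + (\<zeta> (z \<odot> x \<odot> y) - \<zeta> (x \<odot> z \<odot> y)) = 0"
    using arg_cong[OF anti_pre_lie_2[of x y z], of \<zeta>] by (simp add: simps)
qed

lemma compat_words:
  assumes "\<zeta> \<in> dual scale"
  shows "\<zeta> ((x \<odot> y) \<ast> z) - \<zeta> ((y \<odot> x) \<ast> z) = \<zeta> (y \<ast> (x \<odot> z)) - \<zeta> (x \<odot> (y \<ast> z))"
    "\<zeta> ((x \<odot> z) \<ast> y) - \<zeta> ((z \<odot> x) \<ast> y) = \<zeta> (z \<ast> (x \<odot> y)) - \<zeta> (x \<odot> (z \<ast> y))"
    "\<zeta> ((y \<odot> z) \<ast> x) - \<zeta> ((z \<odot> y) \<ast> x) = \<zeta> (z \<ast> (y \<odot> x)) - \<zeta> (y \<odot> (z \<ast> x))"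
    "\<zeta> ((y \<odot> x) \<ast> z) - \<zeta> ((x \<odot> y) \<ast> z) = \<zeta> (x \<ast> (y \<odot> z)) - \<zeta> (y \<odot> (x \<ast> z))"
    "\<zeta> ((z \<odot> x) \<ast> y) - \<zeta> ((x \<odot> z) \<ast> y) = \<zeta> (x \<ast> (z \<odot> y)) - \<zeta> (z \<odot> (x \<ast> y))"
    "\<zeta> ((z \<odot> y) \<ast> x) - \<zeta> ((y \<odot> z) \<ast> x) = \<zeta> (y \<ast> (z \<odot> x)) - \<zeta> (z \<odot> (y \<ast> x))"
    "\<zeta> ((x \<ast> y) \<odot> z) + \<zeta> ((y \<ast> x) \<odot> z) = - \<zeta> (x \<ast> (y \<odot> z)) - \<zeta> (y \<ast> (x \<odot> z))"
    "\<zeta> ((x \<ast> z) \<odot> y) + \<zeta> ((z \<ast> x) \<odot> y) = - \<zeta> (x \<ast> (z \<odot> y)) - \<zeta> (z \<ast> (x \<odot> y))"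
    "\<zeta> ((y \<ast> z) \<odot> x) + \<zeta> ((z \<ast> y) \<odot> x) = - \<zeta> (y \<ast> (z \<odot> x)) - \<zeta> (z \<ast> (y \<odot> x))"
    "\<zeta> (z \<odot> (x \<ast> y)) + \<zeta> (z \<odot> (y \<ast> x)) + \<zeta> (x \<ast> (y \<odot> z)) + \<zeta> (y \<ast> (x \<odot> z))
      = \<zeta> (x \<ast> (z \<odot> y)) + \<zeta> (y \<ast> (z \<odot> x))"
    "\<zeta> (y \<odot> (x \<ast> z)) + \<zeta> (y \<odot> (z \<ast> x)) + \<zeta> (x \<ast> (z \<odot> y)) + \<zeta> (z \<ast> (x \<odot> y))
      = \<zeta> (x \<ast> (y \<odot> z)) + \<zeta> (z \<ast> (y \<odot> x))"
    "\<zeta> (x \<odot> (y \<ast> z)) + \<zeta> (x \<odot> (z \<ast> y)) + \<zeta> (y \<ast> (z \<odot> x)) + \<zeta> (z \<ast> (y \<odot> x))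
      = \<zeta> (y \<ast> (x \<odot> z)) + \<zeta> (z \<ast> (x \<odot> y))"
proof -
  note simps = bilinear_simps dual_simps[OF assms]
  have 1: "\<zeta> ((a \<odot> b) \<ast> c) - \<zeta> ((b \<odot> a) \<ast> c) = \<zeta> (b \<ast> (a \<odot> c)) - \<zeta> (a \<odot> (b \<ast> c))"
    and 2: "\<zeta> ((a \<ast> b) \<odot> c) + \<zeta> ((b \<ast> a) \<odot> c) = - \<zeta> (a \<ast> (b \<odot> c)) - \<zeta> (b \<ast> (a \<odot> c))"
    and 3: "\<zeta> (c \<odot> (a \<ast> b)) + \<zeta> (c \<odot> (b \<ast> a)) + \<zeta> (a \<ast> (b \<odot> c)) + \<zeta> (b \<ast> (a \<odot> c))
      = \<zeta> (a \<ast> (c \<odot> b)) + \<zeta> (b \<ast> (c \<odot> a))" for a b c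
    using arg_cong[OF compat_1[of a b c], of \<zeta>] arg_cong[OF compat_2[of a b c], of \<zeta>]
      arg_cong[OF compat_3[of a b c], of \<zeta>]
    by (simp_all add: simps)
  show "\<zeta> ((x \<odot> y) \<ast> z) - \<zeta> ((y \<odot> x) \<ast> z) = \<zeta> (y \<ast> (x \<odot> z)) - \<zeta> (x \<odot> (y \<ast> z))"
    "\<zeta> ((x \<odot> z) \<ast> y) - \<zeta> ((z \<odot> x) \<ast> y) = \<zeta> (z \<ast> (x \<odot> y)) - \<zeta> (x \<odot> (z \<ast> y))"
    "\<zeta> ((y \<odot> z) \<ast> x) - \<zeta> ((z \<odot> y) \<ast> x) = \<zeta> (z \<ast> (y \<odot> x)) - \<zeta> (y \<odot> (z \<ast> x))"
    "\<zeta> ((y \<odot> x) \<ast> z) - \<zeta> ((x \<odot> y) \<ast> z) = \<zeta> (x \<ast> (y \<odot> z)) - \<zeta> (y \<odot> (x \<ast> z))"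
    "\<zeta> ((z \<odot> x) \<ast> y) - \<zeta> ((x \<odot> z) \<ast> y) = \<zeta> (x \<ast> (z \<odot> y)) - \<zeta> (z \<odot> (x \<ast> y))"
    "\<zeta> ((z \<odot> y) \<ast> x) - \<zeta> ((y \<odot> z) \<ast> x) = \<zeta> (y \<ast> (z \<odot> x)) - \<zeta> (z \<odot> (y \<ast> x))"
    "\<zeta> ((x \<ast> y) \<odot> z) + \<zeta> ((y \<ast> x) \<odot> z) = - \<zeta> (x \<ast> (y \<odot> z)) - \<zeta> (y \<ast> (x \<odot> z))"
    "\<zeta> ((x \<ast> z) \<odot> y) + \<zeta> ((z \<ast> x) \<odot> y) = - \<zeta> (x \<ast> (z \<odot> y)) - \<zeta> (z \<ast> (x \<odot> y))"
    "\<zeta> ((y \<ast> z) \<odot> x) + \<zeta> ((z \<ast> y) \<odot> x) = - \<zeta> (y \<ast> (z \<odot> x)) - \<zeta> (z \<ast> (y \<odot> x))"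
    "\<zeta> (z \<odot> (x \<ast> y)) + \<zeta> (z \<odot> (y \<ast> x)) + \<zeta> (x \<ast> (y \<odot> z)) + \<zeta> (y \<ast> (x \<odot> z))
      = \<zeta> (x \<ast> (z \<odot> y)) + \<zeta> (y \<ast> (z \<odot> x))"
    "\<zeta> (y \<odot> (x \<ast> z)) + \<zeta> (y \<odot> (z \<ast> x)) + \<zeta> (x \<ast> (z \<odot> y)) + \<zeta> (z \<ast> (x \<odot> y))
      = \<zeta> (x \<ast> (y \<odot> z)) + \<zeta> (z \<ast> (y \<odot> x))"
    "\<zeta> (x \<odot> (y \<ast> z)) + \<zeta> (x \<odot> (z \<ast> y)) + \<zeta> (y \<ast> (z \<odot> x)) + \<zeta> (z \<ast> (y \<odot> x))
      = \<zeta> (y \<ast> (x \<odot> z)) + \<zeta> (z \<ast> (x \<odot> y))"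
    by (rule 1 2 3)+
qed

text \<open>
  The next lemmas say that the coadjoint actions form a bimodule: they are the axioms of an
  anti-pre-Poisson algebra with one argument replaced by a functional. Evaluated at a vector, each is
  an identity of \<open>A\<close> read in the dual.
\<close>

lemma coact_zinbiel:
  assumes "\<zeta> \<in> dual scale"
  shows "star_coact x (star_coact y \<zeta>) = ast_coact (x \<ast> y) \<zeta>"
    "star_coact x (ast_coact y \<zeta>) = ast_coact (x \<ast> y) \<zeta>"
    "ast_coact (x \<ast> y) \<zeta> = ast_coact (y \<ast> x) \<zeta>"
    "star_coact (x \<ast> y) \<zeta> + star_coact (y \<ast> x) \<zeta> = - ast_coact (x \<ast> y) \<zeta>"
    "ast_coact y (star_coact x \<zeta>) + ast_coact y (ast_coact x \<zeta>) = - ast_coact (x \<ast> y) \<zeta>"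
proof (rule_tac [!] ext)
  fix w
  note f = zinbiel_words[OF assms, where x = x and y = y and z = w]
  show "star_coact x (star_coact y \<zeta>) w = ast_coact (x \<ast> y) \<zeta> w"
    using f by (simp add: coact_apply bilinear_simps dual_simps[OF assms]) algebra
  show "star_coact x (ast_coact y \<zeta>) w = ast_coact (x \<ast> y) \<zeta> w"
    using f by (simp add: coact_apply bilinear_simps dual_simps[OF assms]) algebra
  show "ast_coact (x \<ast> y) \<zeta> w = ast_coact (y \<ast> x) \<zeta> w"
    using f by (simp add: coact_apply bilinear_simps dual_simps[OF assms])
  show "(star_coact (x \<ast> y) \<zeta> + star_coact (y \<ast> x) \<zeta>) w = (- ast_coact (x \<ast> y) \<zeta>) w"
    using f by (simp add: coact_apply bilinear_simps dual_simps[OF assms]) algebra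
  show "(ast_coact y (star_coact x \<zeta>) + ast_coact y (ast_coact x \<zeta>)) w = (- ast_coact (x \<ast> y) \<zeta>) w"
    using f by (simp add: coact_apply bilinear_simps dual_simps[OF assms])
qed

text \<open>
  The commuted form of the last rule, for use as a rewrite rule.
\<close>

lemma coact_zinbiel':
  assumes "\<zeta> \<in> dual scale"
  shows "ast_coact y (ast_coact x \<zeta>) + ast_coact y (star_coact x \<zeta>) = - ast_coact (x \<ast> y) \<zeta>"
  using coact_zinbiel(5)[OF assms] by (simp add: add.commute)

lemma coact_lie:
  assumes "\<zeta> \<in> dual scale"
  shows "ad_coact x (circ_coact y \<zeta>) - circ_coact (x \<odot> y) \<zeta> = circ_coact y (circ_coact x \<zeta>)
    - circ_coact y (ad_coact x \<zeta>)"
    "ad_coact x (ad_coact y \<zeta>) - ad_coact y (ad_coact x \<zeta>) = ad_coact (y \<odot> x) \<zeta>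
      - ad_coact (x \<odot> y) \<zeta>"
    "circ_coact y (ad_coact x \<zeta>) - circ_coact y (circ_coact x \<zeta>)
      + (circ_coact x (circ_coact y \<zeta>) - circ_coact x (ad_coact y \<zeta>))
      = ad_coact (x \<odot> y) \<zeta> - ad_coact (y \<odot> x) \<zeta>"
proof (rule_tac [!] ext)
  fix w
  note f = lie_words[OF assms, where x = x and y = y and z = w]
  show "(ad_coact x (circ_coact y \<zeta>) - circ_coact (x \<odot> y) \<zeta>) w
    = (circ_coact y (circ_coact x \<zeta>) - circ_coact y (ad_coact x \<zeta>)) w"
    using f by (simp add: coact_apply bilinear_simps dual_simps[OF assms]) algebra
  show "(ad_coact x (ad_coact y \<zeta>) - ad_coact y (ad_coact x \<zeta>)) w
    = (ad_coact (y \<odot> x) \<zeta> - ad_coact (x \<odot> y) \<zeta>) w"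
    using f by (simp add: coact_apply bilinear_simps dual_simps[OF assms]) algebra
  show "(circ_coact y (ad_coact x \<zeta>) - circ_coact y (circ_coact x \<zeta>)
    + (circ_coact x (circ_coact y \<zeta>) - circ_coact x (ad_coact y \<zeta>))) w
      = (ad_coact (x \<odot> y) \<zeta> - ad_coact (y \<odot> x) \<zeta>) w"
    using f by (simp add: coact_apply bilinear_simps dual_simps[OF assms]) algebra
qed

lemma coact_compat:
  assumes "\<zeta> \<in> dual scale"
  shows "ast_coact y (circ_coact x \<zeta>) - ast_coact y (ad_coact x \<zeta>) = star_coact x (circ_coact y \<zeta>)
    - circ_coact (x \<ast> y) \<zeta>"
    "ast_coact y (ad_coact x \<zeta>) - ast_coact y (circ_coact x \<zeta>) = ast_coact (x \<odot> y) \<zeta>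
      - ad_coact x (ast_coact y \<zeta>)"
    "star_coact (x \<odot> y) \<zeta> - star_coact (y \<odot> x) \<zeta> = star_coact y (ad_coact x \<zeta>)
      - ad_coact x (star_coact y \<zeta>)"
    "circ_coact y (ast_coact x \<zeta>) + circ_coact y (star_coact x \<zeta>) = - ast_coact (x \<odot> y) \<zeta>
      - star_coact x (circ_coact y \<zeta>)"
    "ad_coact (x \<ast> y) \<zeta> + ad_coact (y \<ast> x) \<zeta> = - star_coact x (ad_coact y \<zeta>)
      - star_coact y (ad_coact x \<zeta>)"
    "ad_coact y (ast_coact x \<zeta>) + ad_coact y (star_coact x \<zeta>) = ast_coact (y \<odot> x) \<zeta>
      + star_coact x (ad_coact y \<zeta>) - ast_coact (x \<odot> y) \<zeta> - star_coact x (circ_coact y \<zeta>)"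
    "circ_coact (x \<ast> y) \<zeta> + circ_coact (y \<ast> x) \<zeta> = star_coact x (circ_coact y \<zeta>)
      + star_coact y (circ_coact x \<zeta>) - star_coact x (ad_coact y \<zeta>) - star_coact y (ad_coact x \<zeta>)"
proof (rule_tac [!] ext)
  fix w
  note f = compat_words[OF assms, where x = x and y = y and z = w]
  show "(ast_coact y (circ_coact x \<zeta>) - ast_coact y (ad_coact x \<zeta>)) w
    = (star_coact x (circ_coact y \<zeta>) - circ_coact (x \<ast> y) \<zeta>) w"
    using f by (simp add: coact_apply bilinear_simps dual_simps[OF assms]) algebra
  show "(ast_coact y (ad_coact x \<zeta>) - ast_coact y (circ_coact x \<zeta>)) w
    = (ast_coact (x \<odot> y) \<zeta> - ad_coact x (ast_coact y \<zeta>)) w"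
    using f by (simp add: coact_apply bilinear_simps dual_simps[OF assms])
  show "(star_coact (x \<odot> y) \<zeta> - star_coact (y \<odot> x) \<zeta>) w
    = (star_coact y (ad_coact x \<zeta>) - ad_coact x (star_coact y \<zeta>)) w"
    using f by (simp add: coact_apply bilinear_simps dual_simps[OF assms]) algebra
  show "(circ_coact y (ast_coact x \<zeta>) + circ_coact y (star_coact x \<zeta>)) w
    = (- ast_coact (x \<odot> y) \<zeta> - star_coact x (circ_coact y \<zeta>)) w"
    using f by (simp add: coact_apply bilinear_simps dual_simps[OF assms])
  show "(ad_coact (x \<ast> y) \<zeta> + ad_coact (y \<ast> x) \<zeta>) w
    = (- star_coact x (ad_coact y \<zeta>) - star_coact y (ad_coact x \<zeta>)) w"
    using f by (simp add: coact_apply bilinear_simps dual_simps[OF assms]) algebra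
  show "(ad_coact y (ast_coact x \<zeta>) + ad_coact y (star_coact x \<zeta>)) w
    = (ast_coact (y \<odot> x) \<zeta> + star_coact x (ad_coact y \<zeta>) - ast_coact (x \<odot> y) \<zeta>
    - star_coact x (circ_coact y \<zeta>)) w"
    using f by (simp add: coact_apply bilinear_simps dual_simps[OF assms]) algebra
  show "(circ_coact (x \<ast> y) \<zeta> + circ_coact (y \<ast> x) \<zeta>) w
    = (star_coact x (circ_coact y \<zeta>) + star_coact y (circ_coact x \<zeta>) - star_coact x (ad_coact y \<zeta>)
    - star_coact y (ad_coact x \<zeta>)) w"
    using f by (simp add: coact_apply bilinear_simps dual_simps[OF assms]) algebra
qed

end

section \<open>The algebra \<open>A \<oplus> A\<^sup>*\<close> of an invariant form\<close>

text \<open>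
  A symmetric invariant tensor enters only through its operator \<open>S\<close>. Symmetry and invariance are
  stated as identities between values of functionals.
\<close>

locale symmetric_invariant = total_anti_pre_poisson scale ast circ
  for scale :: "'k::field \<Rightarrow> 'a::ab_group_add \<Rightarrow> 'a"
    and ast (infixl \<open>\<ast>\<close> 70) and circ (infixl \<open>\<odot>\<close> 70) +
  fixes S :: "('a \<Rightarrow> 'k) \<Rightarrow> 'a"
  assumes S_add: "\<zeta> \<in> dual scale \<Longrightarrow> \<eta> \<in> dual scale \<Longrightarrow> S (\<zeta> + \<eta>) = S \<zeta> + S \<eta>"
    and S_scale: "\<zeta> \<in> dual scale \<Longrightarrow> S (dual_scale c \<zeta>) = scale c (S \<zeta>)"
    and S_symmetric: "\<zeta> \<in> dual scale \<Longrightarrow> \<eta> \<in> dual scale \<Longrightarrow> \<zeta> (S \<eta>) = \<eta> (S \<zeta>)"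
    and S_ast: "\<zeta> \<in> dual scale \<Longrightarrow> \<eta> \<in> dual scale \<Longrightarrow> \<eta> (x \<star> S \<zeta>) = - \<zeta> (x \<ast> S \<eta>)"
    and S_circ: "\<zeta> \<in> dual scale \<Longrightarrow> \<eta> \<in> dual scale \<Longrightarrow> \<eta> \<lbrakk>x, S \<zeta>\<rbrakk> = \<zeta> (x \<odot> S \<eta>)"
begin

text \<open>
  The products \<open>\<zeta> \<ast>\<^sub>s \<eta>\<close> and \<open>\<zeta> \<circ>\<^sub>s \<eta>\<close>: the second factor is acted on by the image of the first.
\<close>

definition "ast_S \<zeta> \<eta> = star_coact (S \<zeta>) \<eta>"
definition "circ_S \<zeta> \<eta> = ad_coact (S \<zeta>) \<eta>"

definition E_ast (infixl \<open>\<ast>\<^sub>E\<close> 70)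
  where "(\<ast>\<^sub>E) = sum_mult (\<ast>) ast_S star_coact ast_coact"
definition E_circ (infixl \<open>\<odot>\<^sub>E\<close> 70)
  where "(\<odot>\<^sub>E) = sum_mult (\<odot>) circ_S ad_coact circ_coact"

text \<open>
  Like \<open>fst\<close> a homomorphism onto \<open>A\<close>; it is through this one that \<open>E\<close> acts on \<open>A\<^sup>*\<close>.
\<close>

definition proj :: "'a \<times> ('a \<Rightarrow> 'k) \<Rightarrow> 'a" where "proj u = fst u + S (snd u)"

abbreviation "E_scale \<equiv> sum_scale scale (dual_scale :: 'k \<Rightarrow> ('a \<Rightarrow> 'k) \<Rightarrow> _)"
abbreviation "E \<equiv> (UNIV :: 'a set) \<times> dual scale"

text \<open>
  \<open>S\<close> is a bimodule homomorphism from the dual to \<open>A\<close>: pair with a functional, move it across by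
  symmetry, and apply invariance.
\<close>

lemma S_coact:
  assumes "\<zeta> \<in> dual scale"
  shows "S (star_coact x \<zeta>) = x \<ast> S \<zeta>" "S (ast_coact x \<zeta>) = S \<zeta> \<ast> x"
    "S (ad_coact x \<zeta>) = x \<odot> S \<zeta>" "S (circ_coact x \<zeta>) = S \<zeta> \<odot> x"
proof -
  have ast: "\<theta> (S \<zeta> \<ast> x) = - \<zeta> (x \<ast> S \<theta>) - \<theta> (x \<ast> S \<zeta>)"
    and circ: "\<theta> (S \<zeta> \<odot> x) = \<theta> (x \<odot> S \<zeta>) - \<zeta> (x \<odot> S \<theta>)" if "\<theta> \<in> dual scale" for \<theta>
    using S_ast[OF assms that, of x] S_circ[OF assms that, of x] that
    by (simp_all add: symmetrized_def commutator_def dual_simps algebra_simps)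
  show "S (star_coact x \<zeta>) = x \<ast> S \<zeta>"
  proof (rule dual_eqI)
    fix \<theta> assume \<theta>: "\<theta> \<in> dual scale"
    have "\<theta> (S (star_coact x \<zeta>)) = - \<zeta> (x \<star> S \<theta>)"
      using S_symmetric[OF \<theta> coact_dual(1)[OF assms]] by (simp add: coact_apply)
    then show "\<theta> (S (star_coact x \<zeta>)) = \<theta> (x \<ast> S \<zeta>)"
      using S_ast[OF \<theta> assms] by simp
  qed
  show "S (ast_coact x \<zeta>) = S \<zeta> \<ast> x"
  proof (rule dual_eqI)
    fix \<theta> assume \<theta>: "\<theta> \<in> dual scale"
    have "\<theta> (S (ast_coact x \<zeta>)) = \<zeta> (S \<theta> \<ast> x)"
      using S_symmetric[OF \<theta> coact_dual(2)[OF assms]] by (simp add: coact_apply)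
    also have "\<dots> = \<zeta> (x \<star> S \<theta>) - \<zeta> (x \<ast> S \<theta>)"
      using assms by (simp add: symmetrized_def dual_simps)
    finally show "\<theta> (S (ast_coact x \<zeta>)) = \<theta> (S \<zeta> \<ast> x)"
      using S_ast[OF \<theta> assms] ast[OF \<theta>] by simp
  qed
  show "S (ad_coact x \<zeta>) = x \<odot> S \<zeta>"
  proof (rule dual_eqI)
    fix \<theta> assume \<theta>: "\<theta> \<in> dual scale"
    have "\<theta> (S (ad_coact x \<zeta>)) = \<zeta> \<lbrakk>x, S \<theta>\<rbrakk>"
      using S_symmetric[OF \<theta> coact_dual(3)[OF assms]] by (simp add: coact_apply)
    then show "\<theta> (S (ad_coact x \<zeta>)) = \<theta> (x \<odot> S \<zeta>)"
      using S_circ[OF \<theta> assms] by simp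
  qed
  show "S (circ_coact x \<zeta>) = S \<zeta> \<odot> x"
  proof (rule dual_eqI)
    fix \<theta> assume \<theta>: "\<theta> \<in> dual scale"
    have "\<theta> (S (circ_coact x \<zeta>)) = - \<zeta> (S \<theta> \<odot> x)"
      using S_symmetric[OF \<theta> coact_dual(4)[OF assms]] by (simp add: coact_apply)
    also have "\<dots> = \<zeta> \<lbrakk>x, S \<theta>\<rbrakk> - \<zeta> (x \<odot> S \<theta>)"
      using assms by (simp add: commutator_def dual_simps)
    finally show "\<theta> (S (circ_coact x \<zeta>)) = \<theta> (S \<zeta> \<odot> x)"
      using S_circ[OF \<theta> assms] circ[OF \<theta>] by simp
  qed
qed

text \<open>
  By invariance the products can as well be read as right actions of the image of the second factor.
\<close>

lemma S_mult_right:
  assumes "\<zeta> \<in> dual scale" "\<eta> \<in> dual scale"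
  shows "ast_S \<zeta> \<eta> = ast_coact (S \<eta>) \<zeta>" "circ_S \<zeta> \<eta> = circ_coact (S \<eta>) \<zeta>"
proof -
  have "- \<eta> (S \<zeta> \<star> w) = \<zeta> (w \<ast> S \<eta>)" for w
    using S_ast[OF assms, of w] by (simp add: symmetrized_def add.commute)
  moreover have "\<eta> \<lbrakk>S \<zeta>, w\<rbrakk> = - \<zeta> (w \<odot> S \<eta>)" for w
  proof -
    have "\<eta> \<lbrakk>S \<zeta>, w\<rbrakk> = - \<eta> \<lbrakk>w, S \<zeta>\<rbrakk>"
      using assms by (simp add: commutator_def dual_simps)
    then show ?thesis
      using S_circ[OF assms] by simp
  qed
  ultimately show "ast_S \<zeta> \<eta> = ast_coact (S \<eta>) \<zeta>" "circ_S \<zeta> \<eta> = circ_coact (S \<eta>) \<zeta>"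
    by (simp_all add: ast_S_def circ_S_def coact_apply fun_eq_iff)
qed

lemma S_mult_dual: "\<zeta> \<in> dual scale \<Longrightarrow> \<eta> \<in> dual scale \<Longrightarrow> ast_S \<zeta> \<eta> \<in> dual scale"
  "\<zeta> \<in> dual scale \<Longrightarrow> \<eta> \<in> dual scale \<Longrightarrow> circ_S \<zeta> \<eta> \<in> dual scale"
  unfolding ast_S_def circ_S_def by (simp_all only: coact_dual)

lemma E_scale_Pair: "E_scale c (x, \<zeta>) = (scale c x, dual_scale c \<zeta>)"
  by (simp add: sum_scale_def)

lemma fd_algebra_E: "fd_algebra E_scale E E_ast" "fd_algebra E_scale E E_circ"
proof -
  interpret E: fd_space E_scale E
    by (rule fd_space_sum) unfold_locales
  have dual_scale_add: "dual_scale c (\<zeta> + \<eta>) = dual_scale c \<zeta> + dual_scale c \<eta>" for c :: 'k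
    and \<zeta> \<eta> :: "'a \<Rightarrow> 'k"
    by (simp add: dual_scale_def fun_eq_iff distrib_left)
  show "fd_algebra E_scale E E_ast"
    by unfold_locales
      (auto simp: E_ast_def sum_mult_def ast_S_def bilinear_simps E_scale_Pair dual_scale_add
        dual.V_closed S_add S_scale coact_linear intro!: dual.V_closed coact_dual)
  show "fd_algebra E_scale E E_circ"
    by unfold_locales
      (auto simp: E_circ_def sum_mult_def circ_S_def bilinear_simps E_scale_Pair dual_scale_add
        dual.V_closed S_add S_scale coact_linear intro!: dual.V_closed coact_dual)
qed

lemmas E_ast_linear = fd_algebra.mult_linear[OF fd_algebra_E(1)]
lemmas E_circ_linear = fd_algebra.mult_linear[OF fd_algebra_E(2)]

sublocale E: fd_space E_scale E
  by (rule fd_space_sum) unfold_locales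

lemma proj_add: "u \<in> E \<Longrightarrow> v \<in> E \<Longrightarrow> proj (u + v) = proj u + proj v"
  by (auto simp: proj_def S_add)

lemma S_0: "S 0 = 0"
  using S_add[of 0 0] dual.V_0 by simp

lemma S_uminus: "\<zeta> \<in> dual scale \<Longrightarrow> S (- \<zeta>) = - S \<zeta>"
  using S_add[of \<zeta> "- \<zeta>"] by (simp add: dual.V_closed S_0 eq_neg_iff_add_eq_0 add.commute)

lemma proj_uminus: "u \<in> E \<Longrightarrow> proj (- u) = - proj u"
  by (auto simp: proj_def S_uminus)

lemma proj_diff: "u \<in> E \<Longrightarrow> v \<in> E \<Longrightarrow> proj (u - v) = proj u - proj v"
  using proj_add[of u "- v"] by (simp add: E.V_closed proj_uminus)

lemma proj_mult:
  assumes "u \<in> E" "v \<in> E"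
  shows "proj (E_ast u v) = proj u \<ast> proj v" "proj (E_circ u v) = proj u \<odot> proj v"
  using assms
  by (auto simp: proj_def E_ast_def E_circ_def sum_mult_def ast_S_def circ_S_def S_add S_coact
    coact_dual
      dual.V_closed bilinear_simps)

text \<open>
  The second summand is an ideal on which \<open>E\<close> acts through \<open>proj\<close>: the contribution of the functional
  in \<open>u\<close> is the left action of its image when it stands on the left, and by \<open>S_mult_right\<close> the right
  action when it stands on the right.
\<close>

lemma E_act:
  assumes "u \<in> E" "\<zeta> \<in> dual scale"
  shows "E_ast u (0, \<zeta>) = (0, star_coact (proj u) \<zeta>)" "E_ast (0, \<zeta>) u = (0, ast_coact (proj u) \<zeta>)"
    "E_circ u (0, \<zeta>) = (0, ad_coact (proj u) \<zeta>)" "E_circ (0, \<zeta>) u = (0, circ_coact (proj u) \<zeta>)"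
proof -
  obtain x \<eta> where u: "u = (x, \<eta>)" "\<eta> \<in> dual scale"
    using assms by auto
  have zero: "star_coact 0 \<eta> = 0" "ast_coact 0 \<eta> = 0" "ad_coact 0 \<eta> = 0" "circ_coact 0 \<eta> = 0"
    using u(2) by (simp_all add: coact_apply fun_eq_iff bilinear_simps dual_simps)
  show "E_ast u (0, \<zeta>) = (0, star_coact (proj u) \<zeta>)"
    unfolding u(1) E_ast_def proj_def sum_mult_def prod.case fst_conv snd_conv ast_S_def zero
      coact_linear(9)[OF assms(2) assms(2)] by (simp add: bilinear_simps)
  show "E_circ u (0, \<zeta>) = (0, ad_coact (proj u) \<zeta>)"
    unfolding u(1) E_circ_def proj_def sum_mult_def prod.case fst_conv snd_conv circ_S_def zero
      coact_linear(11)[OF assms(2) assms(2)] by (simp add: bilinear_simps)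
  show "E_ast (0, \<zeta>) u = (0, ast_coact (proj u) \<zeta>)"
    unfolding u(1) E_ast_def proj_def sum_mult_def prod.case fst_conv snd_conv S_mult_right[OF
      assms(2) u(2)] zero
      coact_linear(10)[OF assms(2) assms(2)] by (simp add: bilinear_simps)
  show "E_circ (0, \<zeta>) u = (0, circ_coact (proj u) \<zeta>)"
    unfolding u(1) E_circ_def proj_def sum_mult_def prod.case fst_conv snd_conv S_mult_right[OF
      assms(2) u(2)] zero
      coact_linear(12)[OF assms(2) assms(2)] by (simp add: bilinear_simps)
qed

lemma E_act_A: "E_ast (x, 0) (y, 0) = (x \<ast> y, 0)" "E_circ (x, 0) (y, 0) = (x \<odot> y, 0)"
  by (simp_all add: E_ast_def E_circ_def sum_mult_def ast_S_def circ_S_def coact_apply fun_eq_iff)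

text \<open>
  By additivity a trilinear identity on \<open>E\<close> needs to be checked only when all arguments lie in \<open>A\<close>,
  where it is an axiom, or when at least one of them lies in the dual and the others are
  arbitrary. The second case covers all products of several functionals at once.
\<close>

lemma E_trilinear_0:
  assumes "u \<in> E" "v \<in> E" "w \<in> E"
    and "\<And>u u' v w. u \<in> E \<Longrightarrow> u' \<in> E \<Longrightarrow> v \<in> E \<Longrightarrow> w \<in> E \<Longrightarrow> F (u + u') v w = F u v w + F u' v w"
    and "\<And>u v v' w. u \<in> E \<Longrightarrow> v \<in> E \<Longrightarrow> v' \<in> E \<Longrightarrow> w \<in> E \<Longrightarrow> F u (v + v') w = F u v w + F u v' w"
    and "\<And>u v w w'. u \<in> E \<Longrightarrow> v \<in> E \<Longrightarrow> w \<in> E \<Longrightarrow> w' \<in> E \<Longrightarrow> F u v (w + w') = F u v w + F u v w'"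
    and "\<And>x y z. F (x, 0) (y, 0) (z, 0) = 0"
    and "\<And>\<zeta> u v. \<zeta> \<in> dual scale \<Longrightarrow> u \<in> E \<Longrightarrow> v \<in> E \<Longrightarrow>
      F (0, \<zeta>) u v = 0 \<and> F u (0, \<zeta>) v = 0 \<and> F u v (0, \<zeta>) = 0"
  shows "F u v w = (0 :: 'a \<times> ('a \<Rightarrow> 'k))"
proof -
  have in_E: "(x, 0) \<in> E" "(0, snd t) \<in> E" "snd t \<in> dual scale" if "t \<in> E" for x t
    using that dual.V_0 by auto
  have "F u v w = F ((fst u, 0) + (0, snd u)) v w"
    by simp
  also have "\<dots> = F (fst u, 0) v w"
    using assms in_E by (subst assms(4)) auto
  also have "\<dots> = F (fst u, 0) ((fst v, 0) + (0, snd v)) w"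
    by simp
  also have "\<dots> = F (fst u, 0) (fst v, 0) w"
    using assms in_E by (subst assms(5)) auto
  also have "\<dots> = F (fst u, 0) (fst v, 0) ((fst w, 0) + (0, snd w))"
    by simp
  also have "\<dots> = F (fst u, 0) (fst v, 0) (fst w, 0)"
    using assms in_E by (subst assms(6)) auto
  finally show ?thesis
    using assms(7) by simp
qed

lemmas E_linear = E_ast_linear E_circ_linear E.V_closed

lemmas E_act_simps = E_act E_linear proj_mult proj_add proj_diff coact_dual dual.V_closed
  coact_linear coact_diff

text \<open>
  The axioms on \<open>E\<close>, one by one: by \<open>E_act\<close> the cases with an argument in the dual are the bimodule
  identities at the images of the other two arguments.
\<close>

lemma E_zinbiel_1:
  assumes "u \<in> E" "v \<in> E" "w \<in> E"
  shows "u \<ast>\<^sub>E (v \<ast>\<^sub>E w) + (u \<ast>\<^sub>E v + v \<ast>\<^sub>E u) \<ast>\<^sub>E w = 0"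
  using assms
proof (rule E_trilinear_0)
  show "(x, 0) \<ast>\<^sub>E ((y, 0) \<ast>\<^sub>E (z, 0)) + ((x, 0) \<ast>\<^sub>E (y, 0) + (y, 0) \<ast>\<^sub>E (x, 0)) \<ast>\<^sub>E (z, 0)
    = 0" for x y z
    using zinbiel_1[of x y z] by (simp add: E_act_A zero_prod_def commutator_def)
next
  fix \<zeta> u v assume \<zeta>: "\<zeta> \<in> dual scale" and uv: "u \<in> E" "v \<in> E"
  show "(0, \<zeta>) \<ast>\<^sub>E (u \<ast>\<^sub>E v) + ((0, \<zeta>) \<ast>\<^sub>E u + u \<ast>\<^sub>E (0, \<zeta>)) \<ast>\<^sub>E v = 0 \<and>
    u \<ast>\<^sub>E ((0, \<zeta>) \<ast>\<^sub>E v) + (u \<ast>\<^sub>E (0, \<zeta>) + (0, \<zeta>) \<ast>\<^sub>E u) \<ast>\<^sub>E v = 0 \<and>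
    u \<ast>\<^sub>E (v \<ast>\<^sub>E (0, \<zeta>)) + (u \<ast>\<^sub>E v + v \<ast>\<^sub>E u) \<ast>\<^sub>E (0, \<zeta>) = 0"
    using \<zeta> uv by (simp add: E_act_simps coact_zinbiel coact_zinbiel' zero_prod_def del:
      mem_Times_iff)
qed (simp_all add: E_linear add_ac)

lemma E_zinbiel_2:
  assumes "u \<in> E" "v \<in> E" "w \<in> E"
  shows "u \<ast>\<^sub>E (v \<ast>\<^sub>E w) + (v \<ast>\<^sub>E w + w \<ast>\<^sub>E v) \<ast>\<^sub>E u = 0"
  using assms
proof (rule E_trilinear_0)
  show "(x, 0) \<ast>\<^sub>E ((y, 0) \<ast>\<^sub>E (z, 0)) + ((y, 0) \<ast>\<^sub>E (z, 0) + (z, 0) \<ast>\<^sub>E (y, 0)) \<ast>\<^sub>E (x, 0)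
    = 0" for x y z
    using zinbiel_2[of x y z] by (simp add: E_act_A zero_prod_def commutator_def)
next
  fix \<zeta> u v assume \<zeta>: "\<zeta> \<in> dual scale" and uv: "u \<in> E" "v \<in> E"
  show "(0, \<zeta>) \<ast>\<^sub>E (u \<ast>\<^sub>E v) + (u \<ast>\<^sub>E v + v \<ast>\<^sub>E u) \<ast>\<^sub>E (0, \<zeta>) = 0 \<and>
    u \<ast>\<^sub>E ((0, \<zeta>) \<ast>\<^sub>E v) + ((0, \<zeta>) \<ast>\<^sub>E v + v \<ast>\<^sub>E (0, \<zeta>)) \<ast>\<^sub>E u = 0 \<and>
    u \<ast>\<^sub>E (v \<ast>\<^sub>E (0, \<zeta>)) + (v \<ast>\<^sub>E (0, \<zeta>) + (0, \<zeta>) \<ast>\<^sub>E v) \<ast>\<^sub>E u = 0"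
    using \<zeta> uv by (simp add: E_act_simps coact_zinbiel coact_zinbiel' zero_prod_def del:
      mem_Times_iff)
qed (simp_all add: E_linear add_ac)

lemma E_zinbiel_3:
  assumes "u \<in> E" "v \<in> E" "w \<in> E"
  shows "u \<ast>\<^sub>E (v \<ast>\<^sub>E w) - w \<ast>\<^sub>E (v \<ast>\<^sub>E u) = 0"
  using assms
proof (rule E_trilinear_0)
  show "(x, 0) \<ast>\<^sub>E ((y, 0) \<ast>\<^sub>E (z, 0)) - (z, 0) \<ast>\<^sub>E ((y, 0) \<ast>\<^sub>E (x, 0)) = 0" for x y z
    using zinbiel_3[of x y z] by (simp add: E_act_A zero_prod_def commutator_def)
next
  fix \<zeta> u v assume \<zeta>: "\<zeta> \<in> dual scale" and uv: "u \<in> E" "v \<in> E"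
  show "(0, \<zeta>) \<ast>\<^sub>E (u \<ast>\<^sub>E v) - v \<ast>\<^sub>E (u \<ast>\<^sub>E (0, \<zeta>)) = 0 \<and>
    u \<ast>\<^sub>E ((0, \<zeta>) \<ast>\<^sub>E v) - v \<ast>\<^sub>E ((0, \<zeta>) \<ast>\<^sub>E u) = 0 \<and>
    u \<ast>\<^sub>E (v \<ast>\<^sub>E (0, \<zeta>)) - (0, \<zeta>) \<ast>\<^sub>E (v \<ast>\<^sub>E u) = 0"
    using \<zeta> uv by (simp add: E_act_simps coact_zinbiel coact_zinbiel' zero_prod_def del:
      mem_Times_iff)
qed (simp_all add: E_linear add_ac)

lemma E_zinbiel_4:
  assumes "u \<in> E" "v \<in> E" "w \<in> E"
  shows "w \<ast>\<^sub>E (u \<ast>\<^sub>E v) - u \<ast>\<^sub>E (w \<ast>\<^sub>E v) = 0"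
  using assms
proof (rule E_trilinear_0)
  show "(z, 0) \<ast>\<^sub>E ((x, 0) \<ast>\<^sub>E (y, 0)) - (x, 0) \<ast>\<^sub>E ((z, 0) \<ast>\<^sub>E (y, 0)) = 0" for x y z
    using zinbiel_4[of x y z] by (simp add: E_act_A zero_prod_def commutator_def)
next
  fix \<zeta> u v assume \<zeta>: "\<zeta> \<in> dual scale" and uv: "u \<in> E" "v \<in> E"
  show "v \<ast>\<^sub>E ((0, \<zeta>) \<ast>\<^sub>E u) - (0, \<zeta>) \<ast>\<^sub>E (v \<ast>\<^sub>E u) = 0 \<and>
    v \<ast>\<^sub>E (u \<ast>\<^sub>E (0, \<zeta>)) - u \<ast>\<^sub>E (v \<ast>\<^sub>E (0, \<zeta>)) = 0 \<and>
    (0, \<zeta>) \<ast>\<^sub>E (u \<ast>\<^sub>E v) - u \<ast>\<^sub>E ((0, \<zeta>) \<ast>\<^sub>E v) = 0"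
    using \<zeta> uv by (simp add: E_act_simps coact_zinbiel coact_zinbiel' zero_prod_def del:
      mem_Times_iff)
qed (simp_all add: E_linear add_ac)

lemma E_lie_1:
  assumes "u \<in> E" "v \<in> E" "w \<in> E"
  shows "u \<odot>\<^sub>E (v \<odot>\<^sub>E w) - v \<odot>\<^sub>E (u \<odot>\<^sub>E w) - (v \<odot>\<^sub>E u - u \<odot>\<^sub>E v) \<odot>\<^sub>E w = 0"
  using assms
proof (rule E_trilinear_0)
  show "(x, 0) \<odot>\<^sub>E ((y, 0) \<odot>\<^sub>E (z, 0)) - (y, 0) \<odot>\<^sub>E ((x, 0) \<odot>\<^sub>E (z, 0))
    - ((y, 0) \<odot>\<^sub>E (x, 0) - (x, 0) \<odot>\<^sub>E (y, 0)) \<odot>\<^sub>E (z, 0) = 0" for x y z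
    using anti_pre_lie_1[of x y z] by (simp add: E_act_A zero_prod_def commutator_def)
next
  fix \<zeta> u v assume \<zeta>: "\<zeta> \<in> dual scale" and uv: "u \<in> E" "v \<in> E"
  show "(0, \<zeta>) \<odot>\<^sub>E (u \<odot>\<^sub>E v) - u \<odot>\<^sub>E ((0, \<zeta>) \<odot>\<^sub>E v) - (u \<odot>\<^sub>E (0, \<zeta>) - (0, \<zeta>) \<odot>\<^sub>E u) \<odot>\<^sub>E v = 0 \<and>
    u \<odot>\<^sub>E ((0, \<zeta>) \<odot>\<^sub>E v) - (0, \<zeta>) \<odot>\<^sub>E (u \<odot>\<^sub>E v) - ((0, \<zeta>) \<odot>\<^sub>E u - u \<odot>\<^sub>E (0, \<zeta>)) \<odot>\<^sub>E v = 0 \<and>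
    u \<odot>\<^sub>E (v \<odot>\<^sub>E (0, \<zeta>)) - v \<odot>\<^sub>E (u \<odot>\<^sub>E (0, \<zeta>)) - (v \<odot>\<^sub>E u - u \<odot>\<^sub>E v) \<odot>\<^sub>E (0, \<zeta>) = 0"
    using coact_lie[OF \<zeta>, of "proj u" "proj v"] coact_lie[OF \<zeta>, of "proj v" "proj u"] \<zeta> uv
    by (simp add: E_act_simps zero_prod_def del: mem_Times_iff) (simp add: algebra_simps)
qed (simp_all add: E_linear add_ac)

lemma E_lie_2:
  assumes "u \<in> E" "v \<in> E" "w \<in> E"
  shows "(u \<odot>\<^sub>E v - v \<odot>\<^sub>E u) \<odot>\<^sub>E w + (v \<odot>\<^sub>E w - w \<odot>\<^sub>E v) \<odot>\<^sub>E u + (w \<odot>\<^sub>E u - u \<odot>\<^sub>E w) \<odot>\<^sub>E v = 0"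
  using assms
proof (rule E_trilinear_0)
  show "((x, 0) \<odot>\<^sub>E (y, 0) - (y, 0) \<odot>\<^sub>E (x, 0)) \<odot>\<^sub>E (z, 0)
    + ((y, 0) \<odot>\<^sub>E (z, 0) - (z, 0) \<odot>\<^sub>E (y, 0)) \<odot>\<^sub>E (x, 0)
    + ((z, 0) \<odot>\<^sub>E (x, 0) - (x, 0) \<odot>\<^sub>E (z, 0)) \<odot>\<^sub>E (y, 0) = 0" for x y z
    using anti_pre_lie_2[of x y z] by (simp add: E_act_A zero_prod_def commutator_def)
next
  fix \<zeta> u v assume \<zeta>: "\<zeta> \<in> dual scale" and uv: "u \<in> E" "v \<in> E"
  show "((0, \<zeta>) \<odot>\<^sub>E u - u \<odot>\<^sub>E (0, \<zeta>)) \<odot>\<^sub>E v + (u \<odot>\<^sub>E v - v \<odot>\<^sub>E u) \<odot>\<^sub>E (0, \<zeta>)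
    + (v \<odot>\<^sub>E (0, \<zeta>) - (0, \<zeta>) \<odot>\<^sub>E v) \<odot>\<^sub>E u = 0 \<and>
    (u \<odot>\<^sub>E (0, \<zeta>) - (0, \<zeta>) \<odot>\<^sub>E u) \<odot>\<^sub>E v + ((0, \<zeta>) \<odot>\<^sub>E v - v \<odot>\<^sub>E (0, \<zeta>)) \<odot>\<^sub>E u + (v \<odot>\<^sub>E u - u \<odot>\<^sub>E v)
      \<odot>\<^sub>E (0, \<zeta>) = 0 \<and>
    (u \<odot>\<^sub>E v - v \<odot>\<^sub>E u) \<odot>\<^sub>E (0, \<zeta>) + (v \<odot>\<^sub>E (0, \<zeta>) - (0, \<zeta>) \<odot>\<^sub>E v) \<odot>\<^sub>E u + ((0, \<zeta>) \<odot>\<^sub>E u - u \<odot>\<^sub>E (0,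
      \<zeta>)) \<odot>\<^sub>E v = 0"
    using coact_lie[OF \<zeta>, of "proj u" "proj v"] coact_lie[OF \<zeta>, of "proj v" "proj u"] \<zeta> uv
    by (simp add: E_act_simps zero_prod_def del: mem_Times_iff) (simp add: algebra_simps)
qed (simp_all add: E_linear add_ac)

lemma E_compat_1:
  assumes "u \<in> E" "v \<in> E" "w \<in> E"
  shows "(u \<odot>\<^sub>E v - v \<odot>\<^sub>E u) \<ast>\<^sub>E w - (v \<ast>\<^sub>E (u \<odot>\<^sub>E w) - u \<odot>\<^sub>E (v \<ast>\<^sub>E w)) = 0"
  using assms
proof (rule E_trilinear_0)
  show "((x, 0) \<odot>\<^sub>E (y, 0) - (y, 0) \<odot>\<^sub>E (x, 0)) \<ast>\<^sub>E (z, 0)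
    - ((y, 0) \<ast>\<^sub>E ((x, 0) \<odot>\<^sub>E (z, 0)) - (x, 0) \<odot>\<^sub>E ((y, 0) \<ast>\<^sub>E (z, 0))) = 0" for x y z
    using compat_1[of x y z] by (simp add: E_act_A zero_prod_def commutator_def)
next
  fix \<zeta> u v assume \<zeta>: "\<zeta> \<in> dual scale" and uv: "u \<in> E" "v \<in> E"
  show "((0, \<zeta>) \<odot>\<^sub>E u - u \<odot>\<^sub>E (0, \<zeta>)) \<ast>\<^sub>E v - (u \<ast>\<^sub>E ((0, \<zeta>) \<odot>\<^sub>E v) - (0, \<zeta>) \<odot>\<^sub>E (u \<ast>\<^sub>E v)) = 0 \<and>
    (u \<odot>\<^sub>E (0, \<zeta>) - (0, \<zeta>) \<odot>\<^sub>E u) \<ast>\<^sub>E v - ((0, \<zeta>) \<ast>\<^sub>E (u \<odot>\<^sub>E v) - u \<odot>\<^sub>E ((0, \<zeta>) \<ast>\<^sub>E v)) = 0 \<and>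
    (u \<odot>\<^sub>E v - v \<odot>\<^sub>E u) \<ast>\<^sub>E (0, \<zeta>) - (v \<ast>\<^sub>E (u \<odot>\<^sub>E (0, \<zeta>)) - u \<odot>\<^sub>E (v \<ast>\<^sub>E (0, \<zeta>))) = 0"
    using coact_compat[OF \<zeta>, of "proj u" "proj v"] coact_compat[OF \<zeta>, of "proj v" "proj u"] \<zeta> uv
    by (simp add: E_act_simps zero_prod_def del: mem_Times_iff)
qed (simp_all add: E_linear add_ac)

lemma E_compat_2:
  assumes "u \<in> E" "v \<in> E" "w \<in> E"
  shows "(u \<ast>\<^sub>E v + v \<ast>\<^sub>E u) \<odot>\<^sub>E w + (u \<ast>\<^sub>E (v \<odot>\<^sub>E w) + v \<ast>\<^sub>E (u \<odot>\<^sub>E w)) = 0"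
  using assms
proof (rule E_trilinear_0)
  show "((x, 0) \<ast>\<^sub>E (y, 0) + (y, 0) \<ast>\<^sub>E (x, 0)) \<odot>\<^sub>E (z, 0)
    + ((x, 0) \<ast>\<^sub>E ((y, 0) \<odot>\<^sub>E (z, 0)) + (y, 0) \<ast>\<^sub>E ((x, 0) \<odot>\<^sub>E (z, 0))) = 0" for x y z
    using compat_2[of x y z] by (simp add: E_act_A zero_prod_def commutator_def)
next
  fix \<zeta> u v assume \<zeta>: "\<zeta> \<in> dual scale" and uv: "u \<in> E" "v \<in> E"
  show "((0, \<zeta>) \<ast>\<^sub>E u + u \<ast>\<^sub>E (0, \<zeta>)) \<odot>\<^sub>E v + ((0, \<zeta>) \<ast>\<^sub>E (u \<odot>\<^sub>E v) + u \<ast>\<^sub>E ((0, \<zeta>) \<odot>\<^sub>E v)) = 0 \<and>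
    (u \<ast>\<^sub>E (0, \<zeta>) + (0, \<zeta>) \<ast>\<^sub>E u) \<odot>\<^sub>E v + (u \<ast>\<^sub>E ((0, \<zeta>) \<odot>\<^sub>E v) + (0, \<zeta>) \<ast>\<^sub>E (u \<odot>\<^sub>E v)) = 0 \<and>
    (u \<ast>\<^sub>E v + v \<ast>\<^sub>E u) \<odot>\<^sub>E (0, \<zeta>) + (u \<ast>\<^sub>E (v \<odot>\<^sub>E (0, \<zeta>)) + v \<ast>\<^sub>E (u \<odot>\<^sub>E (0, \<zeta>))) = 0"
    using coact_compat[OF \<zeta>, of "proj u" "proj v"] coact_compat[OF \<zeta>, of "proj v" "proj u"] \<zeta> uv
    by (simp add: E_act_simps zero_prod_def del: mem_Times_iff) (simp add: algebra_simps)
qed (simp_all add: E_linear add_ac)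

lemma E_compat_3:
  assumes "u \<in> E" "v \<in> E" "w \<in> E"
  shows "w \<odot>\<^sub>E (u \<ast>\<^sub>E v + v \<ast>\<^sub>E u) + u \<ast>\<^sub>E (v \<odot>\<^sub>E w) + v \<ast>\<^sub>E (u \<odot>\<^sub>E w)
    - (u \<ast>\<^sub>E (w \<odot>\<^sub>E v) + v \<ast>\<^sub>E (w \<odot>\<^sub>E u)) = 0"
  using assms
proof (rule E_trilinear_0)
  show "(z, 0) \<odot>\<^sub>E ((x, 0) \<ast>\<^sub>E (y, 0) + (y, 0) \<ast>\<^sub>E (x, 0)) + (x, 0) \<ast>\<^sub>E ((y, 0) \<odot>\<^sub>E (z, 0))
    + (y, 0) \<ast>\<^sub>E ((x, 0) \<odot>\<^sub>E (z, 0)) - ((x, 0) \<ast>\<^sub>E ((z, 0) \<odot>\<^sub>E (y, 0))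
    + (y, 0) \<ast>\<^sub>E ((z, 0) \<odot>\<^sub>E (x, 0))) = 0" for x y z
    using compat_3[of x y z] by (simp add: E_act_A zero_prod_def commutator_def)
next
  fix \<zeta> u v assume \<zeta>: "\<zeta> \<in> dual scale" and uv: "u \<in> E" "v \<in> E"
  show "v \<odot>\<^sub>E ((0, \<zeta>) \<ast>\<^sub>E u + u \<ast>\<^sub>E (0, \<zeta>)) + (0, \<zeta>) \<ast>\<^sub>E (u \<odot>\<^sub>E v) + u \<ast>\<^sub>E ((0, \<zeta>) \<odot>\<^sub>E v)
    - ((0, \<zeta>) \<ast>\<^sub>E (v \<odot>\<^sub>E u) + u \<ast>\<^sub>E (v \<odot>\<^sub>E (0, \<zeta>))) = 0 \<and>
    v \<odot>\<^sub>E (u \<ast>\<^sub>E (0, \<zeta>) + (0, \<zeta>) \<ast>\<^sub>E u) + u \<ast>\<^sub>E ((0, \<zeta>) \<odot>\<^sub>E v) + (0, \<zeta>) \<ast>\<^sub>E (u \<odot>\<^sub>E v)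
      - (u \<ast>\<^sub>E (v \<odot>\<^sub>E (0, \<zeta>)) + (0, \<zeta>) \<ast>\<^sub>E (v \<odot>\<^sub>E u)) = 0 \<and>
    (0, \<zeta>) \<odot>\<^sub>E (u \<ast>\<^sub>E v + v \<ast>\<^sub>E u) + u \<ast>\<^sub>E (v \<odot>\<^sub>E (0, \<zeta>)) + v \<ast>\<^sub>E (u \<odot>\<^sub>E (0, \<zeta>))
      - (u \<ast>\<^sub>E ((0, \<zeta>) \<odot>\<^sub>E v) + v \<ast>\<^sub>E ((0, \<zeta>) \<odot>\<^sub>E u)) = 0"
    using coact_compat[OF \<zeta>, of "proj u" "proj v"] coact_compat[OF \<zeta>, of "proj v" "proj u"] \<zeta> uv
    by (simp add: E_act_simps zero_prod_def del: mem_Times_iff) (simp add: algebra_simps)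
qed (simp_all add: E_linear add_ac)

theorem anti_pre_poisson_E: "anti_pre_poisson E_scale E E_ast E_circ"
proof -
  interpret ast: fd_algebra E_scale E E_ast
    by (rule fd_algebra_E)
  interpret circ: fd_algebra E_scale E E_circ
    by (rule fd_algebra_E)
  show ?thesis
  proof unfold_locales
    fix u v w assume E: "u \<in> E" "v \<in> E" "w \<in> E"
    show "u \<ast>\<^sub>E (v \<ast>\<^sub>E w) = - ((u \<ast>\<^sub>E v + v \<ast>\<^sub>E u) \<ast>\<^sub>E w)"
      using E_zinbiel_1[OF E] by (simp add: eq_neg_iff_add_eq_0)
    show "u \<ast>\<^sub>E (v \<ast>\<^sub>E w) = - ((v \<ast>\<^sub>E w + w \<ast>\<^sub>E v) \<ast>\<^sub>E u)"
      using E_zinbiel_2[OF E] by (simp add: eq_neg_iff_add_eq_0)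
    show "u \<ast>\<^sub>E (v \<ast>\<^sub>E w) = w \<ast>\<^sub>E (v \<ast>\<^sub>E u)"
      using E_zinbiel_3[OF E] by simp
    show "w \<ast>\<^sub>E (u \<ast>\<^sub>E v) = u \<ast>\<^sub>E (w \<ast>\<^sub>E v)"
      using E_zinbiel_4[OF E] by simp
    show "u \<odot>\<^sub>E (v \<odot>\<^sub>E w) - v \<odot>\<^sub>E (u \<odot>\<^sub>E w) = (commutator E_circ v u) \<odot>\<^sub>E w"
      using E_lie_1[OF E] by (simp add: commutator_def)
    show "(commutator E_circ u v) \<odot>\<^sub>E w + (commutator E_circ v w) \<odot>\<^sub>E u
        + (commutator E_circ w u) \<odot>\<^sub>E v = 0"
      using E_lie_2[OF E] by (simp add: commutator_def)
    show "(u \<odot>\<^sub>E v - v \<odot>\<^sub>E u) \<ast>\<^sub>E w = v \<ast>\<^sub>E (u \<odot>\<^sub>E w) - u \<odot>\<^sub>E (v \<ast>\<^sub>E w)"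
      using E_compat_1[OF E] by simp
    have "(u \<ast>\<^sub>E v + v \<ast>\<^sub>E u) \<odot>\<^sub>E w = - (u \<ast>\<^sub>E (v \<odot>\<^sub>E w) + v \<ast>\<^sub>E (u \<odot>\<^sub>E w))"
      using E_compat_2[OF E] by (simp only: eq_neg_iff_add_eq_0)
    then show "(u \<ast>\<^sub>E v + v \<ast>\<^sub>E u) \<odot>\<^sub>E w = - (u \<ast>\<^sub>E (v \<odot>\<^sub>E w)) - v \<ast>\<^sub>E (u \<odot>\<^sub>E w)"
      by simp
    show "w \<odot>\<^sub>E (u \<ast>\<^sub>E v + v \<ast>\<^sub>E u) + u \<ast>\<^sub>E (v \<odot>\<^sub>E w) + v \<ast>\<^sub>E (u \<odot>\<^sub>E w)
        = u \<ast>\<^sub>E (w \<odot>\<^sub>E v) + v \<ast>\<^sub>E (w \<odot>\<^sub>E u)"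
      using E_compat_3[OF E] by simp
  qed
qed

lemma proj_dual: "proj (0, \<zeta>) = S \<zeta>"
  by (simp add: proj_def)

lemma anti_pre_poisson_dual: "anti_pre_poisson dual_scale (dual scale) ast_S circ_S"
proof (rule anti_pre_poisson_pullback[OF anti_pre_poisson_E, where \<phi> = "\<lambda>\<zeta>. (0, \<zeta>)"])
  show "fd_space dual_scale (dual scale)"
    by (rule fd_space_dual)
  show "inj_on (Pair (0::'a)) (dual scale)"
    by (rule inj_onI) simp
qed (auto simp: S_mult_dual E_scale_Pair E_act proj_dual ast_S_def circ_S_def coact_dual)

lemma A_anti_pre_poisson_dual:
  "A_anti_pre_poisson scale (\<ast>) (\<odot>) dual_scale (dual scale) ast_S circ_S
      star_coact ast_coact ad_coact circ_coact"
  unfolding A_anti_pre_poisson_def linear_to_End_def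
  using anti_pre_poisson_dual anti_pre_poisson_E
  by (auto simp: E_ast_def E_circ_def coact_linear coact_dual)

text \<open>
  The required Poisson structure on \<open>A \<oplus> A\<^sup>*\<close> is the one that \<open>E\<close> carries as an anti-pre-Poisson
  algebra, because \<open>L\<^sub>\<star>\<^sup>* - R\<^sub>\<ast>\<^sup>* = L\<^sub>\<ast>\<^sup>*\<close> and \<open>-ad\<^sup>* - R\<^sub>\<circ>\<^sup>* = -L\<^sub>\<circ>\<^sup>*\<close>.
\<close>

lemma A_poisson_dual:
  "A_poisson scale (symmetrized (\<ast>)) (commutator (\<odot>)) dual_scale (dual scale)
     (symmetrized ast_S) (commutator circ_S) (dual_rep (\<ast>)) (\<lambda>x \<zeta>. - dual_rep (\<odot>) x \<zeta>)"
proof -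
  have \<mu>: "dual_rep (\<ast>) x \<zeta> = star_coact x \<zeta> + ast_coact x \<zeta>"
    and \<rho>: "dual_rep (\<odot>) x \<zeta> = circ_coact x \<zeta> - ad_coact x \<zeta>"
    if "\<zeta> \<in> dual scale" for x \<zeta>
    using that by (auto simp: coact_apply dual_rep_def fun_eq_iff symmetrized_def commutator_def
      dual_simps)
  interpret D: anti_pre_poisson dual_scale "dual scale" ast_S circ_S
    by (rule anti_pre_poisson_dual)
  interpret E: anti_pre_poisson E_scale E E_ast E_circ
    by (rule anti_pre_poisson_E)
  have dual_scale_linear: "dual_scale c (\<zeta> + \<eta>) = dual_scale c \<zeta> + dual_scale c \<eta>"
    "dual_scale c (\<zeta> - \<eta>) = dual_scale c \<zeta> - dual_scale c \<eta>" for c :: 'k and \<zeta> \<eta> :: "'a \<Rightarrow> 'k"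
    by (auto simp: dual_scale_def fun_eq_iff algebra_simps)
  have "poisson E_scale E
      (sum_mult (symmetrized (\<ast>)) (symmetrized ast_S) (dual_rep (\<ast>)) (dual_rep (\<ast>)))
      (sum_mult (commutator (\<odot>)) (commutator circ_S) (\<lambda>x \<zeta>. - dual_rep (\<odot>) x \<zeta>)
        (\<lambda>x \<zeta>. - (- dual_rep (\<odot>) x \<zeta>)))"
    by (rule poisson_cong[OF E.poisson_symmetrized_commutator])
      (auto simp: sum_mult_def symmetrized_def commutator_def E_ast_def E_circ_def \<mu> \<rho>
        algebra_simps simp del: minus_minus)
  moreover have "linear_to_End scale dual_scale (dual scale) (dual_rep (\<ast>))"
    "linear_to_End scale dual_scale (dual scale) (\<lambda>x \<zeta>. - dual_rep (\<odot>) x \<zeta>)"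
    unfolding linear_to_End_def
    by (auto simp: \<mu> \<rho> coact_dual dual.V_closed coact_linear dual_scale_linear algebra_simps)
  ultimately show ?thesis
    unfolding A_poisson_def using D.poisson_symmetrized_commutator by blast
qed

end

section \<open>The Yang-Baxter equation as a Rota-Baxter identity\<close>

locale invariant_symmetrization = total_anti_pre_poisson scale ast circ
  for scale :: "'k::field \<Rightarrow> 'a::ab_group_add \<Rightarrow> 'a"
    and ast (infixl \<open>\<ast>\<close> 70) and circ (infixl \<open>\<odot>\<close> 70) +
  fixes r :: "('a, 'k) tensor"
  assumes invariant: "invariant_tensor scale (\<ast>) (\<odot>) (r + flip r)"
begin

definition "S = tensor_operator scale (r + flip r)"
definition "T = tensor_operator scale r"
definition "T' = tensor_operator scale (flip r)"

lemma S_eq: "S \<zeta> = T \<zeta> + T' \<zeta>"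
  by (simp add: S_def T_def T'_def tensor_operator_add)

lemma T_pairing: "\<eta> \<in> dual scale \<Longrightarrow> \<eta> (T \<zeta>) = pairing r \<zeta> \<eta>"
  and T'_pairing: "\<eta> \<in> dual scale \<Longrightarrow> \<eta> (T' \<zeta>) = pairing r \<eta> \<zeta>"
  by (simp_all add: T_def T'_def dual_tensor_operator pairing_flip)

lemma T_transpose: "\<zeta> \<in> dual scale \<Longrightarrow> \<eta> \<in> dual scale \<Longrightarrow> \<eta> (T \<zeta>) = \<zeta> (T' \<eta>)"
  by (simp add: T_pairing T'_pairing)

sublocale symmetric_invariant scale ast circ S
proof unfold_locales
  let ?s = "r + flip r"
  have sym: "pairing ?s \<zeta> \<eta> = pairing ?s \<eta> \<zeta>" for \<zeta> \<eta>
    by (simp add: pairing_add pairing_flip add.commute)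
  show "S (\<zeta> + \<eta>) = S \<zeta> + S \<eta>" "S (dual_scale c \<zeta>) = scale c (S \<zeta>)" for \<zeta> \<eta> c
    by (simp_all add: S_def tensor_operator_linear)
  fix \<zeta> \<eta> assume dual: "\<zeta> \<in> dual scale" "\<eta> \<in> dual scale"
  show "\<zeta> (S \<eta>) = \<eta> (S \<zeta>)"
    using dual by (simp add: S_def dual_tensor_operator sym[of \<zeta>])
  fix x
  have "pairing (tensor_map id (symmetrized (\<ast>) x) ?s + tensor_map ((\<ast>) x) id ?s) \<zeta> \<eta> = 0"
    "pairing (tensor_map ((\<odot>) x) id ?s - tensor_map id (commutator (\<odot>) x) ?s) \<zeta> \<eta> = 0"
    using invariant dual unfolding invariant_tensor_def tensor_eq_iff pairing_0 by blast+
  then have inv: "pairing ?s \<zeta> (\<lambda>z. \<eta> (x \<star> z)) = - pairing ?s \<eta> (\<lambda>z. \<zeta> (x \<ast> z))"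
    "pairing ?s \<zeta> (\<lambda>z. \<eta> \<lbrakk>x, z\<rbrakk>) = pairing ?s \<eta> (\<lambda>z. \<zeta> (x \<odot> z))"
    unfolding pairing_add[of "tensor_map _ _ _"] pairing_diff pairing_tensor_map id_apply sym[of _
      \<eta>]
    by (simp_all only: eq_neg_iff_add_eq_0 right_minus_eq)
  show "\<eta> (x \<star> S \<zeta>) = - \<zeta> (x \<ast> S \<eta>)"
    using inv(1) dual_tensor_operator[OF dual_comp_mult(5)[OF dual(2)]]
      dual_tensor_operator[OF dual_comp_mult(1)[OF dual(1)]]
    by (simp only: S_def)
  show "\<eta> \<lbrakk>x, S \<zeta>\<rbrakk> = \<zeta> (x \<odot> S \<eta>)"
    using inv(2) dual_tensor_operator[OF dual_comp_mult(6)[OF dual(2)]]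
      dual_tensor_operator[OF dual_comp_mult(3)[OF dual(1)]]
    by (simp only: S_def)
qed

text \<open>
  The values of \<open>D(r)\<close> and \<open>S(r)\<close> on \<open>\<zeta> \<otimes> \<eta> \<otimes> \<theta>\<close>; see \<open>pairing3_YBE\<close>.
\<close>

definition D_form :: "('a \<Rightarrow> 'k) \<Rightarrow> ('a \<Rightarrow> 'k) \<Rightarrow> ('a \<Rightarrow> 'k) \<Rightarrow> 'k" where
  "D_form \<zeta> \<eta> \<theta> = \<eta> (T \<zeta> \<ast> T' \<theta>) - \<zeta> (T' \<eta> \<ast> T' \<theta>) + \<theta> (T \<zeta> \<star> T \<eta>)"

definition S_form :: "('a \<Rightarrow> 'k) \<Rightarrow> ('a \<Rightarrow> 'k) \<Rightarrow> ('a \<Rightarrow> 'k) \<Rightarrow> 'k" where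
  "S_form \<zeta> \<eta> \<theta> = \<zeta> (T' \<eta> \<odot> T' \<theta>) + \<eta> (T \<zeta> \<odot> T' \<theta>) - \<theta> \<lbrakk>T \<zeta>, T \<eta>\<rbrakk>"

text \<open>
  A bilinear form on values of \<open>T\<close> and \<open>T'\<close> is a double sum over the support of \<open>r\<close>, contracted as in
  the definition of the Yang-Baxter equation.
\<close>

lemma bilinear_T:
  assumes "\<And>x. \<beta> x \<in> dual scale" "\<And>y. (\<lambda>x. \<beta> x y) \<in> dual scale"
  shows "\<beta> (T \<zeta>) (T \<theta>) = (\<Sum>p\<in>Poly_Mapping.keys r. \<Sum>q\<in>Poly_Mapping.keys r.
      Poly_Mapping.lookup r p * Poly_Mapping.lookup r q * (\<zeta> (fst p) * \<theta> (fst q) * \<beta> (snd p) (snd q)))"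
    and "\<beta> (T \<zeta>) (T' \<theta>) = (\<Sum>p\<in>Poly_Mapping.keys r. \<Sum>q\<in>Poly_Mapping.keys r.
      Poly_Mapping.lookup r p * Poly_Mapping.lookup r q * (\<zeta> (fst p) * \<beta> (snd p) (fst q) * \<theta> (snd q)))"
    and "\<beta> (T' \<zeta>) (T' \<theta>) = (\<Sum>p\<in>Poly_Mapping.keys r. \<Sum>q\<in>Poly_Mapping.keys r.
      Poly_Mapping.lookup r p * Poly_Mapping.lookup r q * (\<beta> (fst p) (fst q) * \<zeta> (snd p) * \<theta> (snd q)))"
proof -
  have T: "\<beta> (T \<zeta>) y
    = (\<Sum>p\<in>Poly_Mapping.keys r. Poly_Mapping.lookup r p * (\<zeta> (fst p) * \<beta> (snd p) y))"
    and T': "\<beta> (T' \<zeta>) y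
      = (\<Sum>p\<in>Poly_Mapping.keys r. Poly_Mapping.lookup r p * (\<beta> (fst p) y * \<zeta> (snd p)))" for y
    using T_pairing[OF assms(2)[of y]] T'_pairing[OF assms(2)[of y]] by (simp_all add: pairing_def)
  note simps = T_pairing[OF assms(1)] T'_pairing[OF assms(1)] pairing_def sum_distrib_left
    sum_distrib_right mult_ac
  show "\<beta> (T \<zeta>) (T \<theta>) = (\<Sum>p\<in>Poly_Mapping.keys r. \<Sum>q\<in>Poly_Mapping.keys r.
      Poly_Mapping.lookup r p * Poly_Mapping.lookup r q * (\<zeta> (fst p) * \<theta> (fst q) * \<beta> (snd p) (snd q)))"
    unfolding T by (simp only: simps)
  show "\<beta> (T \<zeta>) (T' \<theta>) = (\<Sum>p\<in>Poly_Mapping.keys r. \<Sum>q\<in>Poly_Mapping.keys r.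
      Poly_Mapping.lookup r p * Poly_Mapping.lookup r q * (\<zeta> (fst p) * \<beta> (snd p) (fst q) * \<theta> (snd q)))"
    unfolding T by (simp only: simps)
  show "\<beta> (T' \<zeta>) (T' \<theta>) = (\<Sum>p\<in>Poly_Mapping.keys r. \<Sum>q\<in>Poly_Mapping.keys r.
      Poly_Mapping.lookup r p * Poly_Mapping.lookup r q * (\<beta> (fst p) (fst q) * \<zeta> (snd p) * \<theta> (snd q)))"
    unfolding T' by (simp only: simps)
qed

lemma dual_comp_mult_left:
  assumes "\<zeta> \<in> dual scale"
  shows "(\<lambda>x. \<zeta> (x \<star> y)) \<in> dual scale" "(\<lambda>x. \<zeta> \<lbrakk>x, y\<rbrakk>) \<in> dual scale"
  using assms
  by (auto intro!: dualI vector_space_axioms simp: bilinear_simps dual_simps algebra_simps)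

lemma pairing3_YBE:
  assumes "\<zeta> \<in> dual scale" "\<eta> \<in> dual scale" "\<theta> \<in> dual scale"
  shows "pairing3 (YBE_D (\<ast>) r) \<zeta> \<eta> \<theta> = D_form \<zeta> \<eta> \<theta>"
    and "pairing3 (YBE_S (\<odot>) r) \<zeta> \<eta> \<theta> = S_form \<zeta> \<eta> \<theta>"
proof -
  note T = bilinear_T[of "\<lambda>x y. \<eta> (x \<ast> y)", OF dual_comp_mult(1,2)]
    bilinear_T[of "\<lambda>x y. \<zeta> (x \<ast> y)", OF dual_comp_mult(1,2)]
    bilinear_T[of "\<lambda>x y. \<theta> (x \<star> y)", OF dual_comp_mult(5) dual_comp_mult_left(1)]
    bilinear_T[of "\<lambda>x y. \<eta> (x \<odot> y)", OF dual_comp_mult(3,4)]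
    bilinear_T[of "\<lambda>x y. \<zeta> (x \<odot> y)", OF dual_comp_mult(3,4)]
    bilinear_T[of "\<lambda>x y. \<theta> \<lbrakk>x, y\<rbrakk>", OF dual_comp_mult(6) dual_comp_mult_left(2)]
  show "pairing3 (YBE_D (\<ast>) r) \<zeta> \<eta> \<theta> = D_form \<zeta> \<eta> \<theta>"
    using assms by (simp add: YBE_D_def D_form_def T pairing3_linear sum.distrib sum_subtractf
      algebra_simps)
  show "pairing3 (YBE_S (\<odot>) r) \<zeta> \<eta> \<theta> = S_form \<zeta> \<eta> \<theta>"
    using assms by (simp add: YBE_S_def S_form_def T pairing3_linear sum.distrib sum_subtractf
      algebra_simps)
qed

lemma APP_YBE_iff:
  "APP_YBE scale (\<ast>) (\<odot>) r \<longleftrightarrow>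
    (\<forall>\<zeta>\<in>dual scale. \<forall>\<eta>\<in>dual scale. \<forall>\<theta>\<in>dual scale. D_form \<zeta> \<eta> \<theta> = 0) \<and>
    (\<forall>\<zeta>\<in>dual scale. \<forall>\<eta>\<in>dual scale. \<forall>\<theta>\<in>dual scale. S_form \<zeta> \<eta> \<theta> = 0)"
  by (simp add: APP_YBE_def tensor3_eq_iff pairing3_0 pairing3_YBE)

text \<open>
  Here invariance does its work. Transposing \<open>T\<close> turns the left-hand sides into words in
  \<open>T\<close> and \<open>T'\<close>, plus a term with \<open>S\<close> from the products on the dual, which invariance moves onto
  another functional. In the first two cases the form appears with its last two arguments exchanged,
  and a second instance of invariance, at \<open>T \<zeta>\<close>, is needed to replace a \<open>T'\<close> by \<open>-T\<close>.
\<close>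

lemma Rota_Baxter_defect:
  assumes "\<zeta> \<in> dual scale" "\<eta> \<in> dual scale" "\<theta> \<in> dual scale"
  shows "\<theta> (T (star_coact (T \<zeta>) \<eta> + ast_coact (T \<eta>) \<zeta> + dual_scale (- 1) (ast_S \<zeta> \<eta>)))
    = \<theta> (T \<zeta> \<ast> T \<eta>) + D_form \<zeta> \<theta> \<eta>"
    and "\<theta> (T (ad_coact (T \<zeta>) \<eta> + circ_coact (T \<eta>) \<zeta> + dual_scale (- 1) (circ_S \<zeta> \<eta>)))
      = \<theta> (T \<zeta> \<odot> T \<eta>) + S_form \<zeta> \<theta> \<eta>"
    and "\<theta> (T (dual_rep (\<ast>) (T \<zeta>) \<eta> + dual_rep (\<ast>) (T \<eta>) \<zeta>
      + dual_scale (- 1) (symmetrized ast_S \<zeta> \<eta>)))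
      = \<theta> (T \<zeta> \<star> T \<eta>) - D_form \<zeta> \<eta> \<theta>"
    and "\<theta> (T (- dual_rep (\<odot>) (T \<zeta>) \<eta> - (- dual_rep (\<odot>) (T \<eta>) \<zeta>)
      + dual_scale (- 1) (commutator circ_S \<zeta> \<eta>)))
      = \<theta> \<lbrakk>T \<zeta>, T \<eta>\<rbrakk> + S_form \<zeta> \<eta> \<theta>"
proof -
  have transpose: "\<theta> (T f) = f (T' \<theta>)" if "f \<in> dual scale" for f
    using T_transpose[OF that assms(3)] .
  note simps = coact_apply dual_scale_def ast_S_def circ_S_def S_eq D_form_def S_form_def
    bilinear_simps dual_simps[OF assms(1)] dual_simps[OF assms(2)] dual_simps[OF assms(3)]
  note closed = dual.V_closed coact_dual S_mult_dual assms
  show "\<theta> (T (star_coact (T \<zeta>) \<eta> + ast_coact (T \<eta>) \<zeta> + dual_scale (- 1) (ast_S \<zeta> \<eta>)))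
    = \<theta> (T \<zeta> \<ast> T \<eta>) + D_form \<zeta> \<theta> \<eta>"
    using S_ast[OF assms(3) assms(2), of "T \<zeta>"] S_ast[OF assms(1,2), of "T' \<theta>"]
    by (subst transpose) (simp_all only: closed, simp add: simps, algebra)
  show "\<theta> (T (ad_coact (T \<zeta>) \<eta> + circ_coact (T \<eta>) \<zeta> + dual_scale (- 1) (circ_S \<zeta> \<eta>)))
    = \<theta> (T \<zeta> \<odot> T \<eta>) + S_form \<zeta> \<theta> \<eta>"
    using S_circ[OF assms(3) assms(2), of "T \<zeta>"] S_circ[OF assms(1,2), of "T' \<theta>"]
    by (subst transpose) (simp_all only: closed, simp add: simps, algebra)
  have rep: "dual_rep (\<ast>) x f \<in> dual scale"
    "dual_rep (\<odot>) x f \<in> dual scale" if "f \<in> dual scale" for x f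
    using dual_comp_mult[OF that, of x] dual.V_uminus by (auto simp: dual_rep_def fun_Compl_def)
  show "\<theta> (T (dual_rep (\<ast>) (T \<zeta>) \<eta> + dual_rep (\<ast>) (T \<eta>) \<zeta>
    + dual_scale (- 1) (symmetrized ast_S \<zeta> \<eta>)))
      = \<theta> (T \<zeta> \<star> T \<eta>) - D_form \<zeta> \<eta> \<theta>"
    using S_ast[OF assms(1,2), of "T' \<theta>"]
    by (subst transpose)
      (simp_all only: closed rep symmetrized_def[of ast_S], simp add: simps dual_rep_def, algebra)
  show "\<theta> (T (- dual_rep (\<odot>) (T \<zeta>) \<eta> - (- dual_rep (\<odot>) (T \<eta>) \<zeta>)
    + dual_scale (- 1) (commutator circ_S \<zeta> \<eta>)))
      = \<theta> \<lbrakk>T \<zeta>, T \<eta>\<rbrakk> + S_form \<zeta> \<eta> \<theta>"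
    using S_circ[OF assms(1,2), of "T' \<theta>"]
    by (subst transpose)
      (simp_all only: closed rep commutator_def[of circ_S], simp add: simps dual_rep_def, algebra)
qed

lemma Rota_Baxter_iff_APP_YBE:
  shows "relative_RB_anti_pre_poisson scale (\<ast>) (\<odot>) dual_scale (dual scale) ast_S circ_S
      star_coact ast_coact ad_coact circ_coact (- 1) T
      \<longleftrightarrow> APP_YBE scale (\<ast>) (\<odot>) r"
    and "relative_RB_poisson scale (symmetrized (\<ast>)) (commutator (\<odot>)) dual_scale (dual scale)
      (symmetrized ast_S) (commutator circ_S) (dual_rep (\<ast>)) (\<lambda>x \<zeta>. - dual_rep (\<odot>) x \<zeta>) (- 1) T
      \<longleftrightarrow> APP_YBE scale (\<ast>) (\<odot>) r"
proof -
  have T: "linear_from scale dual_scale (dual scale) T"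
    by (simp add: linear_from_def T_def tensor_operator_linear)
  have eq_iff: "x = y \<longleftrightarrow> (\<forall>\<theta>\<in>dual scale. \<theta> x = \<theta> y)" for x y
    using dual_eqI by blast
  have ast: "T \<zeta> \<ast> T \<eta> = T (star_coact (T \<zeta>) \<eta> + ast_coact (T \<eta>) \<zeta> + dual_scale (- 1) (ast_S \<zeta> \<eta>)) \<longleftrightarrow>
      (\<forall>\<theta>\<in>dual scale. D_form \<zeta> \<theta> \<eta> = 0)"
    and circ: "T \<zeta> \<odot> T \<eta> = T (ad_coact (T \<zeta>) \<eta> + circ_coact (T \<eta>) \<zeta>
      + dual_scale (- 1) (circ_S \<zeta> \<eta>)) \<longleftrightarrow>
      (\<forall>\<theta>\<in>dual scale. S_form \<zeta> \<theta> \<eta> = 0)"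
    and star: "T \<zeta> \<star> T \<eta> = T (dual_rep (\<ast>) (T \<zeta>) \<eta> + dual_rep (\<ast>) (T \<eta>) \<zeta>
        + dual_scale (- 1) (symmetrized ast_S \<zeta> \<eta>)) \<longleftrightarrow>
      (\<forall>\<theta>\<in>dual scale. D_form \<zeta> \<eta> \<theta> = 0)"
    and bracket: "\<lbrakk>T \<zeta>, T \<eta>\<rbrakk> = T (- dual_rep (\<odot>) (T \<zeta>) \<eta> - (- dual_rep (\<odot>) (T \<eta>) \<zeta>)
        + dual_scale (- 1) (commutator circ_S \<zeta> \<eta>)) \<longleftrightarrow>
      (\<forall>\<theta>\<in>dual scale. S_form \<zeta> \<eta> \<theta> = 0)"
    if "\<zeta> \<in> dual scale" "\<eta> \<in> dual scale" for \<zeta> \<eta>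
    by (subst eq_iff, rule ball_cong, rule refl, simp only: Rota_Baxter_defect[OF that], simp)+
  show "relative_RB_anti_pre_poisson scale (\<ast>) (\<odot>) dual_scale (dual scale) ast_S circ_S
      star_coact ast_coact ad_coact circ_coact (- 1) T
      \<longleftrightarrow> APP_YBE scale (\<ast>) (\<odot>) r"
    unfolding relative_RB_anti_pre_poisson_def APP_YBE_iff
    by (simp only: T A_anti_pre_poisson_dual ast circ cong: ball_cong) blast
  show "relative_RB_poisson scale (symmetrized (\<ast>)) (commutator (\<odot>)) dual_scale (dual scale)
      (symmetrized ast_S) (commutator circ_S) (dual_rep (\<ast>)) (\<lambda>x \<zeta>. - dual_rep (\<odot>) x \<zeta>) (- 1) T
      \<longleftrightarrow> APP_YBE scale (\<ast>) (\<odot>) r"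
    unfolding relative_RB_poisson_def APP_YBE_iff
    by (simp only: T A_poisson_dual star bracket cong: ball_cong) blast
qed

end

section \<open>The bialgebra of a solution\<close>

context invariant_symmetrization
begin

abbreviation "\<Delta> \<equiv> \<Delta>_of (\<ast>) r"
abbreviation "\<delta> \<equiv> \<delta>_of (\<odot>) r"

lemma pairing_\<Delta>:
  "pairing (\<Delta> x) \<zeta> \<eta> = - pairing r \<zeta> (\<lambda>z. \<eta> (x \<star> z)) - pairing r (\<lambda>z. \<zeta> (x \<ast> z)) \<eta>"
  by (simp add: \<Delta>_of_def pairing_linear pairing_tensor_map)

lemma pairing_\<delta>:
  "pairing (\<delta> x) \<zeta> \<eta> = pairing r (\<lambda>z. \<zeta> (x \<odot> z)) \<eta> - pairing r \<zeta> (\<lambda>z. \<eta> \<lbrakk>x, z\<rbrakk>)"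
  by (simp add: \<delta>_of_def pairing_linear pairing_tensor_map)

text \<open>
  Since \<open>\<tau>(r) = (r + \<tau>(r)) - r\<close>, invariance of the first summand leaves an expression in \<open>r\<close> alone.
\<close>

lemma
  assumes "\<zeta> \<in> dual scale" "\<eta> \<in> dual scale"
  shows pairing_flip_\<Delta>: "pairing (flip (\<Delta> x)) \<zeta> \<eta>
      = pairing r (\<lambda>z. \<zeta> (x \<star> z)) \<eta> + pairing r \<zeta> (\<lambda>z. \<eta> (x \<ast> z))"
    and pairing_flip_\<delta>: "pairing (flip (\<delta> x)) \<zeta> \<eta>
      = pairing r (\<lambda>z. \<zeta> \<lbrakk>x, z\<rbrakk>) \<eta> - pairing r \<zeta> (\<lambda>z. \<eta> (x \<odot> z))"
proof -
  note T = T_pairing[OF dual_comp_mult(1)] T'_pairing[OF dual_comp_mult(1)]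
    T_pairing[OF dual_comp_mult(3)] T'_pairing[OF dual_comp_mult(3)]
    T_pairing[OF dual_comp_mult(5)] T'_pairing[OF dual_comp_mult(5)]
    T_pairing[OF dual_comp_mult(6)] T'_pairing[OF dual_comp_mult(6)]
  have split: "\<zeta> (x \<star> (a + b)) = \<zeta> (x \<star> a) + \<zeta> (x \<star> b)" "\<zeta> \<lbrakk>x, a + b\<rbrakk> = \<zeta> \<lbrakk>x, a\<rbrakk> + \<zeta> \<lbrakk>x, b\<rbrakk>"
    "\<eta> (x \<ast> (a + b)) = \<eta> (x \<ast> a) + \<eta> (x \<ast> b)" "\<eta> (x \<odot> (a + b)) = \<eta> (x \<odot> a) + \<eta> (x \<odot> b)" for a b
    using assms by (simp_all add: bilinear_simps dual_simps)
  have inv_ast: "pairing r \<eta> (\<lambda>z. \<zeta> (x \<star> z)) + pairing r (\<lambda>z. \<zeta> (x \<star> z)) \<eta>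
      = - (pairing r \<zeta> (\<lambda>z. \<eta> (x \<ast> z)) + pairing r (\<lambda>z. \<eta> (x \<ast> z)) \<zeta>)"
    using S_ast[OF assms(2,1), of x] unfolding S_eq split T[OF assms(1)] T[OF assms(2)] .
  have inv_circ: "pairing r \<eta> (\<lambda>z. \<zeta> \<lbrakk>x, z\<rbrakk>) + pairing r (\<lambda>z. \<zeta> \<lbrakk>x, z\<rbrakk>) \<eta>
      = pairing r \<zeta> (\<lambda>z. \<eta> (x \<odot> z)) + pairing r (\<lambda>z. \<eta> (x \<odot> z)) \<zeta>"
    using S_circ[OF assms(2,1), of x] unfolding S_eq split T[OF assms(1)] T[OF assms(2)] .
  show "pairing (flip (\<Delta> x)) \<zeta> \<eta>
      = pairing r (\<lambda>z. \<zeta> (x \<star> z)) \<eta> + pairing r \<zeta> (\<lambda>z. \<eta> (x \<ast> z))"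
    using inv_ast unfolding pairing_flip pairing_\<Delta> by algebra
  show "pairing (flip (\<delta> x)) \<zeta> \<eta>
      = pairing r (\<lambda>z. \<zeta> \<lbrakk>x, z\<rbrakk>) \<eta> - pairing r \<zeta> (\<lambda>z. \<eta> (x \<odot> z))"
    using inv_circ unfolding pairing_flip pairing_\<delta> by algebra
qed

lemma pairing_flip_linear:
  shows "pairing (flip (s + t)) \<zeta> \<eta> = pairing (flip s) \<zeta> \<eta> + pairing (flip t) \<zeta> \<eta>"
    and "pairing (flip (s - t)) \<zeta> \<eta> = pairing (flip s) \<zeta> \<eta> - pairing (flip t) \<zeta> \<eta>"
    and "pairing (flip (- s)) \<zeta> \<eta> = - pairing (flip s) \<zeta> \<eta>"
    and "pairing (flip (flip s)) \<zeta> \<eta> = pairing s \<zeta> \<eta>"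
    and "pairing (flip (tensor_map f g s)) \<zeta> \<eta> = pairing (flip s) (\<lambda>z. \<zeta> (g z)) (\<lambda>z. \<eta> (f z))"
  by (simp_all add: pairing_flip pairing_linear pairing_tensor_map)

text \<open>
  An operator on one tensor factor only can be moved onto the vector that \<open>r\<close> makes of the other
  functional. This turns such terms into values of a functional on words in \<open>A\<close>.
\<close>

lemma pairing_one_sided:
  assumes "\<zeta> \<in> dual scale" "\<And>x y. f (x + y) = f x + f y" "\<And>c x. f (scale c x) = scale c (f x)"
  shows "pairing r (\<lambda>z. \<zeta> (f z)) \<eta> = \<zeta> (f (T' \<eta>))" "pairing r \<eta> (\<lambda>z. \<zeta> (f z)) = \<zeta> (f (T \<eta>))"
proof -
  have "(\<lambda>z. \<zeta> (f z)) \<in> dual scale"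
    using assms by (auto intro!: dualI vector_space_axioms simp: dual_simps)
  from T'_pairing[OF this, of \<eta>] T_pairing[OF this, of \<eta>]
  show "pairing r (\<lambda>z. \<zeta> (f z)) \<eta> = \<zeta> (f (T' \<eta>))" "pairing r \<eta> (\<lambda>z. \<zeta> (f z)) = \<zeta> (f (T \<eta>))"
    by simp_all
qed

text \<open>
  On the dual, \<open>\<Delta>\<close> and \<open>\<delta>\<close> induce exactly the products inside the Rota-Baxter identities for \<open>T\<close>. Those
  identities say that \<open>\<zeta> \<mapsto> (T \<zeta>, -\<zeta>)\<close> is multiplicative: in the second component, the actions change
  sign with the functional while the products on the dual, being bilinear, do not, as it should be
  for weight \<open>-1\<close>.
\<close>

lemma coalgebra_dual:
  assumes "APP_YBE scale (\<ast>) (\<odot>) r"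
  shows "anti_pre_poisson dual_scale (dual scale) (dual_op \<Delta>) (dual_op \<delta>)"
proof -
  have op: "dual_op \<Delta> \<zeta> \<eta> = star_coact (T \<zeta>) \<eta> + ast_coact (T \<eta>) \<zeta> + dual_scale (- 1) (ast_S \<zeta> \<eta>)"
    "dual_op \<delta> \<zeta> \<eta> = ad_coact (T \<zeta>) \<eta> + circ_coact (T \<eta>) \<zeta> + dual_scale (- 1) (circ_S \<zeta> \<eta>)"
    if "\<zeta> \<in> dual scale" "\<eta> \<in> dual scale" for \<zeta> \<eta>
  proof -
    note one_sided = pairing_one_sided(1)[OF that(1), of _ \<eta>] pairing_one_sided(2)[OF that(2), of _
      \<zeta>]
    show "dual_op \<Delta> \<zeta> \<eta> = star_coact (T \<zeta>) \<eta> + ast_coact (T \<eta>) \<zeta> + dual_scale (- 1) (ast_S \<zeta> \<eta>)"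
    proof
      fix x
      show "dual_op \<Delta> \<zeta> \<eta> x = (star_coact (T \<zeta>) \<eta> + ast_coact (T \<eta>) \<zeta>
        + dual_scale (- 1) (ast_S \<zeta> \<eta>)) x"
        using S_ast[OF that, of x]
        by (simp add: dual_op_def pairing_\<Delta> one_sided coact_apply ast_S_def dual_scale_def S_eq
          bilinear_simps scale_right_distrib pairing_args
          dual_simps[OF that(1)] dual_simps[OF that(2)] add_ac) algebra
    qed
    show "dual_op \<delta> \<zeta> \<eta> = ad_coact (T \<zeta>) \<eta> + circ_coact (T \<eta>) \<zeta> + dual_scale (- 1) (circ_S \<zeta> \<eta>)"
    proof
      fix x
      show "dual_op \<delta> \<zeta> \<eta> x = (ad_coact (T \<zeta>) \<eta> + circ_coact (T \<eta>) \<zeta>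
        + dual_scale (- 1) (circ_S \<zeta> \<eta>)) x"
        using S_circ[OF that, of x]
        by (simp add: dual_op_def pairing_\<delta> one_sided coact_apply circ_S_def dual_scale_def S_eq
          bilinear_simps scale_right_distrib pairing_args
          dual_simps[OF that(1)] dual_simps[OF that(2)] add_ac)
    qed
  qed
  have RB: "T \<zeta> \<ast> T \<eta> = T (dual_op \<Delta> \<zeta> \<eta>)" "T \<zeta> \<odot> T \<eta> = T (dual_op \<delta> \<zeta> \<eta>)"
    if "\<zeta> \<in> dual scale" "\<eta> \<in> dual scale" for \<zeta> \<eta>
  proof -
    have "relative_RB_anti_pre_poisson scale (\<ast>) (\<odot>) dual_scale (dual scale) ast_S circ_S
      star_coact ast_coact ad_coact circ_coact (- 1) T"
      using assms by (simp only: Rota_Baxter_iff_APP_YBE)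
    then show "T \<zeta> \<ast> T \<eta> = T (dual_op \<Delta> \<zeta> \<eta>)" "T \<zeta> \<odot> T \<eta> = T (dual_op \<delta> \<zeta> \<eta>)"
      using that unfolding relative_RB_anti_pre_poisson_def op[OF that] by blast+
  qed
  have T_linear: "T (\<zeta> + \<eta>) = T \<zeta> + T \<eta>" "T (dual_scale c \<zeta>) = scale c (T \<zeta>)" for \<zeta> \<eta> c
    by (simp_all add: T_def tensor_operator_linear)
  have dual_scale_minus: "dual_scale (- 1) \<zeta> = - \<zeta>" for \<zeta> :: "'a \<Rightarrow> 'k"
    by (simp add: dual_scale_def fun_eq_iff)
  show ?thesis
  proof (rule anti_pre_poisson_pullback[OF anti_pre_poisson_E, where \<phi> = "\<lambda>\<zeta>. (T \<zeta>, - \<zeta>)"])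
    show "fd_space dual_scale (dual scale)"
      by (rule fd_space_dual)
    show "inj_on (\<lambda>\<zeta>. (T \<zeta>, - \<zeta>)) (dual scale)"
      by (rule inj_onI) simp
    show "dual_op \<Delta> \<zeta> \<eta> \<in> dual scale" "dual_op \<delta> \<zeta> \<eta> \<in> dual scale"
      if "\<zeta> \<in> dual scale" "\<eta> \<in> dual scale" for \<zeta> \<eta>
      unfolding op[OF that] by (intro dual.V_closed coact_dual S_mult_dual that)+
    have neg: "ast_S (- \<zeta>) (- \<eta>) = ast_S \<zeta> \<eta>" "circ_S (- \<zeta>) (- \<eta>) = circ_S \<zeta> \<eta>"
      "star_coact x (- \<zeta>) = - star_coact x \<zeta>" "ast_coact x (- \<zeta>) = - ast_coact x \<zeta>"
      "ad_coact x (- \<zeta>) = - ad_coact x \<zeta>" "circ_coact x (- \<zeta>) = - circ_coact x \<zeta>"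
      if "\<zeta> \<in> dual scale" "\<eta> \<in> dual scale" for \<zeta> \<eta> x
      using that by (auto simp: ast_S_def circ_S_def coact_apply fun_eq_iff S_uminus bilinear_simps
        dual_simps)
    show "(T (dual_op \<Delta> \<zeta> \<eta>), - dual_op \<Delta> \<zeta> \<eta>) = E_ast (T \<zeta>, - \<zeta>) (T \<eta>, - \<eta>)"
      "(T (dual_op \<delta> \<zeta> \<eta>), - dual_op \<delta> \<zeta> \<eta>) = E_circ (T \<zeta>, - \<zeta>) (T \<eta>, - \<eta>)"
      if "\<zeta> \<in> dual scale" "\<eta> \<in> dual scale" for \<zeta> \<eta>
      unfolding E_ast_def E_circ_def sum_mult_def prod.case RB[OF that] op[OF that]
      using that by (simp_all add: neg dual_scale_minus algebra_simps)
  qed (auto simp: dual.V_closed T_linear E_scale_Pair)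
qed

text \<open>
  The eight bialgebra conditions, tested on two functionals. Terms with an operator on each tensor
  factor cancel after expanding symmetrized products and commutators; the one-sided terms are words
  evaluated by \<open>\<zeta>\<close> or \<open>\<eta>\<close>.
\<close>

context
  fixes \<zeta> \<eta> :: "'a \<Rightarrow> 'k"
  assumes \<zeta>: "\<zeta> \<in> dual scale" and \<eta>: "\<eta> \<in> dual scale"
begin

lemmas bialgebra_simps = pairing_linear pairing_flip_linear pairing_tensor_map pairing_\<Delta> pairing_\<delta>
  pairing_flip_\<Delta> pairing_flip_\<delta> \<zeta> \<eta> dual_comp_mult[OF \<zeta>] dual_comp_mult[OF \<eta>]
  bilinear_simps dual_simps[OF \<zeta>] dual_simps[OF \<eta>] pairing_args
  pairing_one_sided(1)[OF \<zeta>, of _ \<eta>] pairing_one_sided(2)[OF \<eta>, of _ \<zeta>] scale_right_distrib add_ac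

lemma pairing_bialgebra_1:
  "pairing (\<Delta> (x \<star> y)) \<zeta> \<eta> =
      pairing (tensor_map id (symmetrized (\<ast>) x) (\<Delta> y) - tensor_map (\<lambda>z. y \<ast> z) id (\<Delta> x)) \<zeta> \<eta>"
  using zinbiel_words[OF \<zeta>, where x = x and y = y and z = "T' \<eta>"]
    zinbiel_words[OF \<eta>, where x = x and y = y and z = "T \<zeta>"]
  by (simp add: bialgebra_simps) algebra

lemma pairing_bialgebra_2:
  "pairing (\<Delta> (x \<ast> y) + flip (\<Delta> (x \<ast> y))) \<zeta> \<eta> =
      pairing (tensor_map (\<lambda>z. x \<ast> z) id (\<Delta> y + flip (\<Delta> y)) - tensor_map id (\<lambda>z. z \<ast> y) (\<Delta> x)) \<zeta> \<eta>"
  using zinbiel_words[OF \<zeta>, where x = x and y = y and z = "T' \<eta>"]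
    zinbiel_words[OF \<eta>, where x = x and y = y and z = "T \<zeta>"]
  by (simp add: bialgebra_simps) algebra

lemma pairing_bialgebra_3:
  "pairing (\<delta> \<lbrakk>x, y\<rbrakk>) \<zeta> \<eta> =
      pairing ((tensor_map id (commutator (\<odot>) x) (\<delta> y) - tensor_map (\<lambda>z. x \<odot> z) id (\<delta> y)) -
      (tensor_map id (commutator (\<odot>) y) (\<delta> x) - tensor_map (\<lambda>z. y \<odot> z) id (\<delta> x))) \<zeta> \<eta>"
  using lie_words[OF \<zeta>, where x = x and y = y and z = "T' \<eta>"]
    lie_words[OF \<eta>, where x = x and y = y and z = "T \<zeta>"]
  by (simp add: bialgebra_simps) algebra

lemma pairing_bialgebra_4:
  "pairing ((\<delta> (x \<odot> y) - tensor_map (\<lambda>z. x \<odot> z) id (\<delta> y) - tensor_map id (\<lambda>z. x \<odot> z) (\<delta> y)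
        + tensor_map id (\<lambda>z. z \<odot> y) (\<delta> x))
      - flip (\<delta> (x \<odot> y) - tensor_map (\<lambda>z. x \<odot> z) id (\<delta> y) - tensor_map id (\<lambda>z. x \<odot> z) (\<delta> y)
        + tensor_map id (\<lambda>z. z \<odot> y) (\<delta> x))) \<zeta> \<eta> = pairing 0 \<zeta> \<eta>"
  using lie_words[OF \<zeta>, where x = x and y = y and z = "T' \<eta>"]
    lie_words[OF \<eta>, where x = x and y = y and z = "T \<zeta>"]
  by (simp add: bialgebra_simps) algebra

lemma pairing_bialgebra_5:
  "pairing (\<delta> (x \<star> y)) \<zeta> \<eta> =
      pairing (tensor_map id (symmetrized (\<ast>) x) (\<delta> y) + tensor_map id (symmetrized (\<ast>) y) (\<delta> x) +
      tensor_map (\<lambda>z. x \<odot> z) id (\<Delta> y) + tensor_map (\<lambda>z. y \<odot> z) id (\<Delta> x)) \<zeta> \<eta>"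
  using compat_words[OF \<zeta>, where x = x and y = y and z = "T' \<eta>"]
    compat_words[OF \<eta>, where x = x and y = y and z = "T \<zeta>"]
  by (simp add: bialgebra_simps) algebra

lemma pairing_bialgebra_6:
  "pairing (\<Delta> \<lbrakk>x, y\<rbrakk>) \<zeta> \<eta> =
      pairing (- tensor_map (\<lambda>z. x \<odot> z) id (\<Delta> y) - tensor_map id (symmetrized (\<ast>) y) (\<delta> x)
      - tensor_map (\<lambda>z. y \<ast> z) id (\<delta> x) + tensor_map id (commutator (\<odot>) x) (\<Delta> y)) \<zeta> \<eta>"
  using compat_words[OF \<zeta>, where x = x and y = y and z = "T' \<eta>"]
    compat_words[OF \<eta>, where x = x and y = y and z = "T \<zeta>"]
  by (simp add: bialgebra_simps) algebra

lemma pairing_bialgebra_7: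
  "pairing (\<Delta> (x \<odot> y) + flip (\<Delta> (x \<odot> y))) \<zeta> \<eta> =
    pairing ((tensor_map (\<lambda>z. x \<odot> z) id (\<Delta> y) + tensor_map id (\<lambda>z. x \<odot> z) (\<Delta> y)
        + tensor_map id (\<lambda>z. z \<ast> y) (\<delta> x))
      + flip (tensor_map (\<lambda>z. x \<odot> z) id (\<Delta> y) + tensor_map id (\<lambda>z. x \<odot> z) (\<Delta> y)
        + tensor_map id (\<lambda>z. z \<ast> y) (\<delta> x))) \<zeta> \<eta>"
  using compat_words[OF \<zeta>, where x = x and y = y and z = "T' \<eta>"]
    compat_words[OF \<eta>, where x = x and y = y and z = "T \<zeta>"]
  by (simp add: bialgebra_simps)

lemma pairing_bialgebra_8:
  "pairing (\<delta> (x \<ast> y) - flip (\<delta> (x \<ast> y))) \<zeta> \<eta> =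
      pairing (tensor_map id (\<lambda>z. x \<ast> z) (\<delta> y) - flip (tensor_map (\<lambda>z. x \<ast> z) id (\<delta> y))
      - tensor_map (\<lambda>z. x \<odot> z) id (\<Delta> y) - flip (tensor_map id (\<lambda>z. x \<odot> z) (\<Delta> y))
      - tensor_map id (\<lambda>z. z \<ast> y) (\<delta> x) - flip (tensor_map id (\<lambda>z. z \<odot> y) (\<Delta> x))) \<zeta> \<eta>"
  using compat_words[OF \<zeta>, where x = x and y = y and z = "T' \<eta>"]
    compat_words[OF \<eta>, where x = x and y = y and z = "T \<zeta>"]
  by (simp add: bialgebra_simps) algebra

end

theorem bialgebra:
  assumes "APP_YBE scale (\<ast>) (\<odot>) r"
  shows "anti_pre_poisson_bialgebra scale (\<ast>) (\<odot>) \<Delta> \<delta>"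
proof (rule anti_pre_poisson_bialgebra.intro)
  show "anti_pre_poisson scale UNIV (\<ast>) (\<odot>)"
    by (rule anti_pre_poisson_axioms)
  show "anti_pre_poisson_bialgebra_axioms scale (\<ast>) (\<odot>) \<Delta> \<delta>"
  proof (rule anti_pre_poisson_bialgebra_axioms.intro)
    show "anti_pre_poisson dual_scale (dual scale) (dual_op \<Delta>) (dual_op \<delta>)"
      using assms by (rule coalgebra_dual)
    show "linear_to_tensor \<Delta>" "linear_to_tensor \<delta>"
      unfolding linear_to_tensor_def tensor_eq_iff
      by (auto simp: pairing_linear pairing_\<Delta> pairing_\<delta> bilinear_simps dual_simps pairing_args
        algebra_simps)
  qed (hypsubst?, unfold tensor_eq_iff, intro ballI,
      rule pairing_bialgebra_1 pairing_bialgebra_2 pairing_bialgebra_3 pairing_bialgebra_4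
        pairing_bialgebra_5 pairing_bialgebra_6 pairing_bialgebra_7 pairing_bialgebra_8; assumption)+
qed

end

theorem theorem5p5:
  fixes scale :: "'k::field \<Rightarrow> 'a::ab_group_add \<Rightarrow> 'a"
    and ast circ :: "'a \<Rightarrow> 'a \<Rightarrow> 'a"
    and r :: "('a, 'k) tensor"
  assumes "anti_pre_poisson scale UNIV ast circ"
    and "invariant_tensor scale ast circ (r + flip r)"
  shows "((APP_YBE scale ast circ r \<and> quasi_triangular scale ast circ r) \<longleftrightarrow>
           relative_RB_anti_pre_poisson scale ast circ
             dual_scale (dual scale)
             (dual_ast scale ast (r + flip r)) (dual_circ scale circ (r + flip r))
             (dual_rep (symmetrized ast)) (\<lambda>x \<zeta>. - dual_rep (\<lambda>y z. ast z y) x \<zeta>)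
             (\<lambda>x \<zeta>. - dual_rep (commutator circ) x \<zeta>) (dual_rep (\<lambda>y z. circ z y))
             (- 1) (tensor_operator scale r)) \<and>
         ((APP_YBE scale ast circ r \<and> quasi_triangular scale ast circ r) \<longleftrightarrow>
           relative_RB_poisson scale (symmetrized ast) (commutator circ)
             dual_scale (dual scale)
             (symmetrized (dual_ast scale ast (r + flip r)))
             (commutator (dual_circ scale circ (r + flip r)))
             (dual_rep ast) (\<lambda>x \<zeta>. - dual_rep circ x \<zeta>)
             (- 1) (tensor_operator scale r))"
proof -
  interpret invariant_symmetrization scale ast circ r
    using assms
    by (simp add: invariant_symmetrization_def invariant_symmetrization_axioms_def
        total_anti_pre_poisson_def)
  have ops: "dual_ast scale ast (r + flip r) = ast_S" "dual_circ scale circ (r + flip r) = circ_S"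
    unfolding fun_eq_iff ast_S_def circ_S_def
    by (simp_all add: dual_ast_def dual_circ_def star_coact_def ad_coact_def S_def)
  have "(APP_YBE scale ast circ r \<and> quasi_triangular scale ast circ r) \<longleftrightarrow> APP_YBE scale ast circ r"
    using bialgebra invariant by (auto simp: quasi_triangular_def)
  then show ?thesis
    unfolding ops
    using Rota_Baxter_iff_APP_YBE[unfolded star_coact_def ast_coact_def ad_coact_def circ_coact_def T_def]
    by blast
qed

end
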